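(* Let $a<b$, $\alpha,\beta>0$, $\mu\in\mathbb{C}$, and let $L:\mathbb{R}\times\mathbb{R}^d\times\mathbb{C}^d\to\mathbb{C}$ be an admissible Lagrangian invariant under a one-parameter group of diffeomorphisms $\Phi=\{\phi_s\}_{s\in\mathbb{R}}$ of $\mathbb{R}^d$. Then, along all solutions $x(t)$ of the fractional Euler-Lagrange equation $$\mathcal{D}^{\beta,\alpha}_{-\mu}\left[\frac{\partial L}{\partial v}(t,x(t),\mathcal{D}^{\alpha,\beta}_{\mu}x(t))\right]=\frac{\partial L}{\partial x}(t,x(t),\mathcal{D}^{\alpha,\beta}_{\mu}x(t)),$$ one has, with $y_t(s)=\phi_s(x(t))$, $$\left.\left[\mathcal{D}^{\beta,\alpha}_{-\mu}\left(\frac{\partial L}{\partial v}\right)\cdot\frac{dy_t}{ds}+\frac{\partial L}{\partial v}\cdot\mathcal{D}^{\alpha,\beta}_{\mu}\left(\frac{dy_t}{ds}\right)\right]\right|_{s=0}=0,$$ where $\frac{\partial L}{\partial v}$ is evaluated at $(t,y_t(s),\mathcal{D}^{\alpha,\beta}_{\mu}y_t(s))$ (hence at $(t,x(t),\mathcal{D}^{\alpha,\beta}_{\mu}x(t))$ for $s=0$) and the fractional operators act on the variable $t$.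
   Context: Admissible Lagrangian: $L(t,x,v)$ is holomorphic in $v$, differentiable in $x$, and real when $v$ is real. For $\alpha>0$ and $n\in\mathbb{N}$ with $n-1\le\alpha<n$: ${}_aD_t^{\alpha}x(t)=\frac{1}{\Gamma(n-\alpha)}\left(\frac{d}{dt}\right)^n\int_a^t(t-s)^{n-\alpha-1}x(s)\,ds$ and ${}_tD_b^{\alpha}x(t)=\frac{1}{\Gamma(n-\alpha)}\left(-\frac{d}{dt}\right)^n\int_t^b(s-t)^{n-\alpha-1}x(s)\,ds$. $\mathcal{D}^{\alpha,\beta}_{\mu}=\frac12\left[{}_aD_t^{\alpha}-{}_tD_b^{\beta}\right]+\frac{i\mu}{2}\left[{}_aD_t^{\alpha}+{}_tD_b^{\beta}\right]$, and $\mathcal{D}^{\beta,\alpha}_{-\mu}$ is obtained by exchanging $\alpha,\beta$ and replacing $\mu$ by $-\mu$. $L$ is invariant under $\Phi$ if $L(t,x,\mathcal{D}^{\alpha,\beta}_{\mu}x)=L(t,\phi_s(x),\mathcal{D}^{\alpha,\beta}_{\mu}(\phi_s(x)))$ for all $s\in\mathbb{R}$ and all curves $t\mapsto x(t)$, where $\phi_s(x)$ denotes the curve $t\mapsto\phi_s(x(t))$. The parameter group satisfies $\phi_0=\mathrm{Id}$. Curves are continuous functions $x:[a,b]\to\mathbb{R}^d$ for which ${}_aD_t^{\alpha}x$ and ${}_tD_b^{\beta}x$ exist. *)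

theory Defs
  imports "HOL-Analysis.Analysis"
begin

text \<open>
  Vectors: \<open>real^'n\<close> is $\mathbf{R}^d$ and \<open>complex^'n\<close> is $\mathbf{C}^d$ with \<open>d = CARD('n)\<close>.
  The dot between vectors of $\mathbf{C}^d$ is bilinear (no conjugation), as it is the pairing of
  a differential with a vector.
\<close>

definition cvec :: "real^'n \<Rightarrow> complex^'n" where
  "cvec x = (\<chi> j. complex_of_real (x $ j))"

definition cdot :: "complex^'n \<Rightarrow> complex^'n \<Rightarrow> complex" where
  "cdot p w = (\<Sum>j\<in>UNIV. p $ j * w $ j)"


section \<open>Riemann--Liouville derivatives\<close>

definition frac_order :: "real \<Rightarrow> nat" where
  "frac_order \<alpha> = nat \<lfloor>\<alpha>\<rfloor> + 1"

lemma frac_order_iff: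
  assumes "\<alpha> > 0"
  shows "n = frac_order \<alpha> \<longleftrightarrow> real n - 1 \<le> \<alpha> \<and> \<alpha> < real n"
proof
  assume "n = frac_order \<alpha>"
  then show "real n - 1 \<le> \<alpha> \<and> \<alpha> < real n"
    using assms unfolding frac_order_def by (auto; linarith)
next
  assume n: "real n - 1 \<le> \<alpha> \<and> \<alpha> < real n"
  then have "\<lfloor>\<alpha>\<rfloor> = int n - 1"
    by (intro floor_unique) auto
  moreover have "n \<ge> 1"
    using n assms by (cases n) auto
  ultimately show "n = frac_order \<alpha>"
    unfolding frac_order_def by simp
qed

definition left_kernel_integrand :: "real \<Rightarrow> (real \<Rightarrow> 'v::euclidean_space) \<Rightarrow> real \<Rightarrow> real \<Rightarrow> 'v" where
  "left_kernel_integrand \<alpha> x t s = (t - s) powr (real (frac_order \<alpha>) - \<alpha> - 1) *\<^sub>R x s"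

definition right_kernel_integrand :: "real \<Rightarrow> (real \<Rightarrow> 'v::euclidean_space) \<Rightarrow> real \<Rightarrow> real \<Rightarrow> 'v" where
  "right_kernel_integrand \<alpha> x t s = (s - t) powr (real (frac_order \<alpha>) - \<alpha> - 1) *\<^sub>R x s"

definition left_integral :: "real \<Rightarrow> real \<Rightarrow> (real \<Rightarrow> 'v::euclidean_space) \<Rightarrow> real \<Rightarrow> 'v" where
  "left_integral a \<alpha> x t = integral {a..t} (left_kernel_integrand \<alpha> x t)"

definition right_integral :: "real \<Rightarrow> real \<Rightarrow> (real \<Rightarrow> 'v::euclidean_space) \<Rightarrow> real \<Rightarrow> 'v" where
  "right_integral b \<alpha> x t = integral {t..b} (right_kernel_integrand \<alpha> x t)"

definition Dt :: "(real \<Rightarrow> 'v::real_normed_vector) \<Rightarrow> real \<Rightarrow> 'v" where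
  "Dt f t = vector_derivative f (at t)"

definition left_RL :: "real \<Rightarrow> real \<Rightarrow> (real \<Rightarrow> 'v::euclidean_space) \<Rightarrow> real \<Rightarrow> 'v" where
  "left_RL a \<alpha> x t =
     (1 / Gamma (real (frac_order \<alpha>) - \<alpha>)) *\<^sub>R (Dt ^^ frac_order \<alpha>) (left_integral a \<alpha> x) t"

definition right_RL :: "real \<Rightarrow> real \<Rightarrow> (real \<Rightarrow> 'v::euclidean_space) \<Rightarrow> real \<Rightarrow> 'v" where
  "right_RL b \<alpha> x t =
     (1 / Gamma (real (frac_order \<alpha>) - \<alpha>)) *\<^sub>R
       ((\<lambda>f \<tau>. - Dt f \<tau>) ^^ frac_order \<alpha>) (right_integral b \<alpha> x) t"

text \<open>
  \<^const>\<open>left_RL\<close> and \<^const>\<open>right_RL\<close> are total functions; the next predicates say that the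
  derivatives they denote really exist. As usual for Riemann--Liouville derivatives (which in
  general blow up at the end points), this is required on the open interval.
\<close>

definition n_times_differentiable_on_interval ::
    "nat \<Rightarrow> (real \<Rightarrow> 'v::real_normed_vector) \<Rightarrow> real \<Rightarrow> real \<Rightarrow> bool" where
  "n_times_differentiable_on_interval n f a b \<longleftrightarrow>
     (\<forall>k<n. \<forall>t\<in>{a<..<b}. (Dt ^^ k) f differentiable (at t))"

definition left_RL_exists :: "real \<Rightarrow> real \<Rightarrow> real \<Rightarrow> (real \<Rightarrow> 'v::euclidean_space) \<Rightarrow> bool" where
  "left_RL_exists a b \<alpha> x \<longleftrightarrow>
     (\<forall>t\<in>{a<..<b}. left_kernel_integrand \<alpha> x t integrable_on {a..t}) \<and>
     n_times_differentiable_on_interval (frac_order \<alpha>) (left_integral a \<alpha> x) a b"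

definition right_RL_exists :: "real \<Rightarrow> real \<Rightarrow> real \<Rightarrow> (real \<Rightarrow> 'v::euclidean_space) \<Rightarrow> bool" where
  "right_RL_exists a b \<alpha> x \<longleftrightarrow>
     (\<forall>t\<in>{a<..<b}. right_kernel_integrand \<alpha> x t integrable_on {t..b}) \<and>
     n_times_differentiable_on_interval (frac_order \<alpha>) (right_integral b \<alpha> x) a b"

definition fracD ::
    "real \<Rightarrow> real \<Rightarrow> real \<Rightarrow> real \<Rightarrow> complex \<Rightarrow> (real \<Rightarrow> complex^'n) \<Rightarrow> real \<Rightarrow> complex^'n" where
  "fracD a b \<alpha> \<beta> \<mu> x t =
     (1/2) *s (left_RL a \<alpha> x t - right_RL b \<beta> x t) +
     (\<i> * \<mu> / 2) *s (left_RL a \<alpha> x t + right_RL b \<beta> x t)"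

definition is_curve :: "real \<Rightarrow> real \<Rightarrow> real \<Rightarrow> real \<Rightarrow> (real \<Rightarrow> real^'n) \<Rightarrow> bool" where
  "is_curve a b \<alpha> \<beta> x \<longleftrightarrow>
     continuous_on {a..b} x \<and> left_RL_exists a b \<alpha> x \<and> right_RL_exists a b \<beta> x"

definition curveD ::
    "real \<Rightarrow> real \<Rightarrow> real \<Rightarrow> real \<Rightarrow> complex \<Rightarrow> (real \<Rightarrow> real^'n) \<Rightarrow> real \<Rightarrow> complex^'n" where
  "curveD a b \<alpha> \<beta> \<mu> x = fracD a b \<alpha> \<beta> \<mu> (\<lambda>t. cvec (x t))"


section \<open>Admissible Lagrangians\<close>

definition admissible_Lagrangian :: "(real \<Rightarrow> real^'n \<Rightarrow> complex^'n \<Rightarrow> complex) \<Rightarrow> bool" where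
  "admissible_Lagrangian L \<longleftrightarrow>
     (\<forall>t x v. \<exists>p. ((\<lambda>w. L t x w) has_derivative (\<lambda>h. cdot p h)) (at v)) \<and>
     (\<forall>t x v. (\<lambda>y. L t y v) differentiable (at x)) \<and>
     (\<forall>t x v. (\<forall>j. v $ j \<in> \<real>) \<longrightarrow> L t x v \<in> \<real>)"

definition dL_dv ::
    "(real \<Rightarrow> real^'n \<Rightarrow> complex^'n \<Rightarrow> complex) \<Rightarrow> real \<Rightarrow> real^'n \<Rightarrow> complex^'n \<Rightarrow> complex^'n" where
  "dL_dv L t x v = (\<chi> j. deriv (\<lambda>z. L t x (v + axis j z)) 0)"

definition dL_dx ::
    "(real \<Rightarrow> real^'n \<Rightarrow> complex^'n \<Rightarrow> complex) \<Rightarrow> real \<Rightarrow> real^'n \<Rightarrow> complex^'n \<Rightarrow> complex^'n" where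
  "dL_dx L t x v = (\<chi> j. vector_derivative (\<lambda>r. L t (x + axis j r) v) (at 0))"


section \<open>One-parameter groups and invariance\<close>

primrec Ck :: "nat \<Rightarrow> ('a::euclidean_space \<Rightarrow> 'b::real_normed_vector) \<Rightarrow> bool" where
  "Ck 0 f \<longleftrightarrow> continuous_on UNIV f"
| "Ck (Suc k) f \<longleftrightarrow>
     (\<forall>x. f differentiable (at x)) \<and> (\<forall>e\<in>Basis. Ck k (\<lambda>x. frechet_derivative f (at x) e))"

definition smooth :: "('a::euclidean_space \<Rightarrow> 'b::real_normed_vector) \<Rightarrow> bool" where
  "smooth f \<longleftrightarrow> (\<forall>k. Ck k f)"

text \<open>
  Every \<open>\<phi> s\<close> is then a smooth diffeomorphism, with smooth inverse \<open>\<phi> (- s)\<close>.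
\<close>

definition one_parameter_group :: "(real \<Rightarrow> real^'n \<Rightarrow> real^'n) \<Rightarrow> bool" where
  "one_parameter_group \<phi> \<longleftrightarrow>
     \<phi> 0 = id \<and> (\<forall>s s'. \<phi> (s + s') = \<phi> s \<circ> \<phi> s') \<and> smooth (\<lambda>(s, y). \<phi> s y)"

text \<open>
  The invariance identity is imposed whenever both of its sides are meaningful, i.e. when the
  transformed curve is again in the domain of the fractional operators.
\<close>

definition invariant_under ::
    "real \<Rightarrow> real \<Rightarrow> real \<Rightarrow> real \<Rightarrow> complex \<Rightarrow> (real \<Rightarrow> real^'n \<Rightarrow> complex^'n \<Rightarrow> complex) \<Rightarrow>
     (real \<Rightarrow> real^'n \<Rightarrow> real^'n) \<Rightarrow> bool" where
  "invariant_under a b \<alpha> \<beta> \<mu> L \<phi> \<longleftrightarrow>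
     (\<forall>s x. is_curve a b \<alpha> \<beta> x \<longrightarrow> is_curve a b \<alpha> \<beta> (\<lambda>\<tau>. \<phi> s (x \<tau>)) \<longrightarrow>
        (\<forall>t\<in>{a<..<b}.
           L t (x t) (curveD a b \<alpha> \<beta> \<mu> x t) =
           L t (\<phi> s (x t)) (curveD a b \<alpha> \<beta> \<mu> (\<lambda>\<tau>. \<phi> s (x \<tau>)) t)))"


section \<open>The fractional Euler--Lagrange equation\<close>

definition momentum ::
    "real \<Rightarrow> real \<Rightarrow> real \<Rightarrow> real \<Rightarrow> complex \<Rightarrow> (real \<Rightarrow> real^'n \<Rightarrow> complex^'n \<Rightarrow> complex) \<Rightarrow>
     (real \<Rightarrow> real^'n) \<Rightarrow> real \<Rightarrow> complex^'n" where
  "momentum a b \<alpha> \<beta> \<mu> L x t = dL_dv L t (x t) (curveD a b \<alpha> \<beta> \<mu> x t)"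

definition fractional_EL_solution ::
    "real \<Rightarrow> real \<Rightarrow> real \<Rightarrow> real \<Rightarrow> complex \<Rightarrow> (real \<Rightarrow> real^'n \<Rightarrow> complex^'n \<Rightarrow> complex) \<Rightarrow>
     (real \<Rightarrow> real^'n) \<Rightarrow> bool" where
  "fractional_EL_solution a b \<alpha> \<beta> \<mu> L x \<longleftrightarrow>
     is_curve a b \<alpha> \<beta> x \<and>
     left_RL_exists a b \<beta> (momentum a b \<alpha> \<beta> \<mu> L x) \<and>
     right_RL_exists a b \<alpha> (momentum a b \<alpha> \<beta> \<mu> L x) \<and>
     (\<forall>t\<in>{a<..<b}.
        fracD a b \<beta> \<alpha> (- \<mu>) (momentum a b \<alpha> \<beta> \<mu> L x) t =
        dL_dx L t (x t) (curveD a b \<alpha> \<beta> \<mu> x t))"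

definition flow_velocity ::
    "(real \<Rightarrow> real^'n \<Rightarrow> real^'n) \<Rightarrow> (real \<Rightarrow> real^'n) \<Rightarrow> real \<Rightarrow> real \<Rightarrow> real^'n" where
  "flow_velocity \<phi> x s t = vector_derivative (\<lambda>\<sigma>. \<phi> \<sigma> (x t)) (at s)"

definition noether_expression ::
    "real \<Rightarrow> real \<Rightarrow> real \<Rightarrow> real \<Rightarrow> complex \<Rightarrow> (real \<Rightarrow> real^'n \<Rightarrow> complex^'n \<Rightarrow> complex) \<Rightarrow>
     (real \<Rightarrow> real^'n \<Rightarrow> real^'n) \<Rightarrow> (real \<Rightarrow> real^'n) \<Rightarrow> real \<Rightarrow> real \<Rightarrow> complex" where
  "noether_expression a b \<alpha> \<beta> \<mu> L \<phi> x s t =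
     cdot (fracD a b \<beta> \<alpha> (- \<mu>) (momentum a b \<alpha> \<beta> \<mu> L (\<lambda>\<tau>. \<phi> s (x \<tau>))) t)
          (cvec (flow_velocity \<phi> x s t)) +
     cdot (momentum a b \<alpha> \<beta> \<mu> L (\<lambda>\<tau>. \<phi> s (x \<tau>)) t)
          (curveD a b \<alpha> \<beta> \<mu> (flow_velocity \<phi> x s) t)"

end

theory Submission
  imports Defs
begin

text \<open>
  Write \<open>X\<close> for the generator of the group, \<open>p\<close> and \<open>v\<close> for the values at \<open>t\<close> of \<open>x\<close> and of its
  fractional velocity, and \<open>\<xi>\<close> for \<open>dL/dv\<close> at \<open>(t, p, v)\<close>. By the Euler--Lagrange equation the claim
  is \<open>dL/dx (t, p, v) X(p) + \<xi> \<cdot> V(X \<circ> x) = 0\<close>, where \<open>V\<close> is the fractional velocity at \<open>t\<close>. Formally this is the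
  derivative at \<open>s = 0\<close> of the invariance identity along \<open>x\<close>, but three obstacles prevent this
  computation: \<open>L\<close> is differentiable only separately in its arguments; the curve
  \<open>\<phi>\<^sub>s \<circ> x\<close> may fail to possess fractional derivatives even though \<open>X \<circ> x\<close> does;
  and the derivative in \<open>s\<close> need not commute with the fractional operators on \<open>x\<close>.

  Smooth curves. Every smooth curve \<open>y\<close> stays a curve under the flow, and by integrations by parts
  its fractional derivatives at \<open>t\<close> are given by integrals with continuous kernels, so that they may
  be differentiated in a parameter (\<open>left_RL_parameter_derivative\<close>). If \<open>y\<close> has the position \<open>p\<close>
  and the velocity \<open>v\<close> at \<open>t\<close>, change its position at \<open>t\<close> into
  \<open>\<phi>\<^sub>s(p)\<close> without changing its velocity and apply invariance to the result, pulled back by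
  \<open>\<phi>\<^sub>-\<^sub>s\<close>. This gives \<open>L(t, \<phi>\<^sub>s(p), v) = L(t, p, w\<^sub>s)\<close> for some velocities \<open>w\<^sub>s\<close> with
  \<open>w' = - V(X \<circ> y)\<close> at \<open>s = 0\<close>. Here only one argument of \<open>L\<close> varies on each side, so
  the derivative at \<open>s = 0\<close> is legitimate and yields the claim for \<open>y\<close>
  (\<open>noether_smooth_curve\<close>).

  Rough curves. It remains to find a smooth \<open>y\<close> with the position and velocity of \<open>x\<close> at \<open>t\<close> and with
  \<open>\<xi> \<cdot> V(X \<circ> y) = \<xi> \<cdot> V(X \<circ> x)\<close>. The left and the right derivative are treated separately.
  For an integer order the derivative depends on the jet at \<open>t\<close> only, and it suffices
  that \<open>y\<close> osculates \<open>x\<close>. For a non-integer order the derivative has a memory: the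
  curve \<open>y\<close> can be modified far away from \<open>t\<close>. Since \<open>\<xi> \<cdot> V(X \<circ> y)\<close> takes the same value for all smooth
  \<open>y\<close> with given position and one-sided derivatives at \<open>t\<close>, its first variation forces the function \<open>q \<mapsto> \<xi> \<cdot> X(q)\<close>,
  multiplied by the coefficient of that one-sided derivative in \<open>V\<close>, to be affine
  (\<open>derivative_rigidity\<close>); for an affine function the equality is linearity
  (\<open>functional_of_composition_eq\<close>).

  Both one-sided derivatives are handled at once through the locale \<open>one_sided_functional\<close>, which
  collects the properties used above, and the right derivative is the left one in reversed time.
\<close>



section \<open>Calculus of smooth maps\<close>

text \<open>Iterated differentiability can be verified with any candidate for the derivative, which avoids
  computing with the choice operator behind \<^const>\<open>frechet_derivative\<close>.\<close>

lemma Ck_SucI: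
  assumes "\<And>x. (f has_derivative f' x) (at x)"
    and "\<And>e. e \<in> Basis \<Longrightarrow> Ck k (\<lambda>x. f' x e)"
  shows "Ck (Suc k) f"
proof -
  have "frechet_derivative f (at x) = f' x" for x
    using frechet_derivative_at[OF assms(1)] by metis
  then show ?thesis
    using assms by (auto simp: differentiable_def)
qed

lemma Ck_Suc_has_derivative:
  assumes "Ck (Suc k) f"
  shows "(f has_derivative frechet_derivative f (at x)) (at x)"
  using assms by (auto simp: frechet_derivative_works)

lemma Ck_Suc_imp_Ck: "Ck (Suc k) f \<Longrightarrow> Ck k f"
proof (induction k arbitrary: f)
  case 0
  then show ?case
    by (auto intro!: differentiable_imp_continuous_on simp: differentiable_on_def
        intro: differentiable_at_withinI)
next
  case (Suc k)
  then show ?case by (metis Ck.simps(2))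
qed

lemma Ck_const: "Ck k (\<lambda>x. c)"
proof (induction k arbitrary: c)
  case (Suc k)
  show ?case by (rule Ck_SucI[where f' = "\<lambda>x h. 0"]) (auto intro: Suc)
qed auto

lemma Ck_add: "Ck k f \<Longrightarrow> Ck k g \<Longrightarrow> Ck k (\<lambda>x. f x + g x)"
proof (induction k arbitrary: f g)
  case 0
  then show ?case by (auto intro: continuous_intros)
next
  case (Suc k)
  show ?case
    by (rule Ck_SucI[OF has_derivative_add[OF Ck_Suc_has_derivative Ck_Suc_has_derivative]])
      (use Suc in auto)
qed

lemma Ck_bounded_linear: "bounded_linear T \<Longrightarrow> Ck k f \<Longrightarrow> Ck k (\<lambda>x. T (f x))"
proof (induction k arbitrary: f)
  case 0
  then show ?case by (auto intro: bounded_linear.continuous_on)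
next
  case (Suc k)
  show ?case
    by (rule Ck_SucI[OF bounded_linear.has_derivative[OF Suc.prems(1) Ck_Suc_has_derivative]])
      (use Suc in auto)
qed

lemma Ck_scaleR: "Ck k f \<Longrightarrow> Ck k g \<Longrightarrow> Ck k (\<lambda>x. f x *\<^sub>R g x)"
proof (induction k arbitrary: f g)
  case 0
  then show ?case by (auto intro: continuous_intros)
next
  case (Suc k)
  show ?case
    by (rule Ck_SucI[OF has_derivative_scaleR[OF Ck_Suc_has_derivative Ck_Suc_has_derivative]])
      (use Suc Suc.prems[THEN Ck_Suc_imp_Ck] in \<open>auto intro!: Ck_add\<close>)
qed

lemma Ck_sum: "(\<And>i. i \<in> I \<Longrightarrow> Ck k (f i)) \<Longrightarrow> Ck k (\<lambda>x. \<Sum>i\<in>I. f i x)"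
  by (induction I rule: infinite_finite_induct) (auto intro: Ck_const Ck_add)

text \<open>The chain rule expresses each partial derivative of a composition as a sum of products of
  partial derivatives of the outer map, composed with the inner one, and of partial derivatives of
  the inner map, so that the induction on the order closes.\<close>

lemma Ck_compose:
  fixes f :: "'b::euclidean_space \<Rightarrow> 'c::real_normed_vector" and g :: "'a::euclidean_space \<Rightarrow> 'b"
  shows "Ck k f \<Longrightarrow> Ck k g \<Longrightarrow> Ck k (\<lambda>x. f (g x))"
proof (induction k arbitrary: f)
  case 0
  then show ?case
    by (auto intro: continuous_on_compose2)
next
  case (Suc k)
  let ?f' = "\<lambda>y. frechet_derivative f (at y)" and ?g' = "\<lambda>x. frechet_derivative g (at x)"
  show ?case
  proof (rule Ck_SucI)
    show "((\<lambda>x. f (g x)) has_derivative (\<lambda>h. ?f' (g x) (?g' x h))) (at x)" for x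
      by (rule has_derivative_compose[OF Ck_Suc_has_derivative[OF Suc.prems(2)]
            Ck_Suc_has_derivative[OF Suc.prems(1)]])
  next
    fix e :: 'a assume e: "e \<in> Basis"
    have "?f' (g x) (?g' x e) = (\<Sum>b\<in>Basis. (?g' x e \<bullet> b) *\<^sub>R ?f' (g x) b)" for x
    proof -
      have lin: "linear (?f' (g x))"
        using Ck_Suc_has_derivative[OF Suc.prems(1)] has_derivative_linear by blast
      have "?f' (g x) (?g' x e) = ?f' (g x) (\<Sum>b\<in>Basis. (?g' x e \<bullet> b) *\<^sub>R b)"
        by (simp add: euclidean_representation)
      then show ?thesis
        by (simp add: linear_sum[OF lin] linear_cmul[OF lin])
    qed
    moreover have "Ck k (\<lambda>x. \<Sum>b\<in>Basis. (?g' x e \<bullet> b) *\<^sub>R ?f' (g x) b)"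
    proof (intro Ck_sum Ck_scaleR)
      fix b :: 'b assume b: "b \<in> Basis"
      show "Ck k (\<lambda>x. ?g' x e \<bullet> b)"
        by (rule Ck_bounded_linear[OF bounded_linear_inner_left]) (use Suc.prems e in auto)
      show "Ck k (\<lambda>x. ?f' (g x) b)"
        by (rule Suc.IH[where f = "\<lambda>y. ?f' y b"]) (use Suc.prems b Ck_Suc_imp_Ck in auto)
    qed
    ultimately show "Ck k (\<lambda>x. ?f' (g x) (?g' x e))" by simp
  qed
qed

lemma smoothI_derivative:
  assumes "\<And>x. (f has_derivative f' x) (at x)"
    and "\<And>e. e \<in> Basis \<Longrightarrow> smooth (\<lambda>x. f' x e)"
  shows "smooth f"
  unfolding smooth_def
proof
  fix k show "Ck k f"
    using Ck_Suc_imp_Ck[OF Ck_SucI[OF assms(1), of k]] assms(2) by (auto simp: smooth_def)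
qed

lemma smooth_const [intro]: "smooth (\<lambda>x. c)"
  by (simp add: smooth_def Ck_const)

lemma smooth_add [intro]: "smooth f \<Longrightarrow> smooth g \<Longrightarrow> smooth (\<lambda>x. f x + g x)"
  by (simp add: smooth_def Ck_add)

lemma smooth_bounded_linear: "bounded_linear T \<Longrightarrow> smooth f \<Longrightarrow> smooth (\<lambda>x. T (f x))"
  by (simp add: smooth_def Ck_bounded_linear)

lemma smooth_scaleR [intro]: "smooth f \<Longrightarrow> smooth g \<Longrightarrow> smooth (\<lambda>x. f x *\<^sub>R g x)"
  by (simp add: smooth_def Ck_scaleR)

lemma smooth_mult [intro]:
  fixes f g :: "'a::euclidean_space \<Rightarrow> real"
  shows "smooth f \<Longrightarrow> smooth g \<Longrightarrow> smooth (\<lambda>x. f x * g x)"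
  using smooth_scaleR[of f g] by simp

lemma smooth_compose:
  fixes f :: "'b::euclidean_space \<Rightarrow> 'c::real_normed_vector" and g :: "'a::euclidean_space \<Rightarrow> 'b"
  shows "smooth f \<Longrightarrow> smooth g \<Longrightarrow> smooth (\<lambda>x. f (g x))"
  by (simp add: smooth_def Ck_compose)

lemma smooth_ident: "smooth (\<lambda>x::'a::euclidean_space. x)"
  by (rule smoothI_derivative[where f' = "\<lambda>x h. h"]) auto

lemma smooth_fst [intro]: "smooth f \<Longrightarrow> smooth (\<lambda>x. fst (f x))"
  by (rule smooth_bounded_linear[OF bounded_linear_fst])

lemma smooth_snd [intro]: "smooth f \<Longrightarrow> smooth (\<lambda>x. snd (f x))"
  by (rule smooth_bounded_linear[OF bounded_linear_snd])

lemma smooth_nth [intro]: "smooth f \<Longrightarrow> smooth (\<lambda>x. f x $ j)"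
  by (rule smooth_bounded_linear[OF bounded_linear_vec_nth])

lemma smooth_minus [intro]: "smooth f \<Longrightarrow> smooth (\<lambda>x. - f x)"
  by (rule smooth_bounded_linear[OF bounded_linear_minus[OF bounded_linear_ident]])

lemma smooth_diff [intro]: "smooth f \<Longrightarrow> smooth g \<Longrightarrow> smooth (\<lambda>x. f x - g x)"
  using smooth_add[OF _ smooth_minus, of f g] by simp

lemma smooth_Pair [intro]:
  assumes "smooth f" "smooth g"
  shows "smooth (\<lambda>x. (f x, g x))"
proof -
  have 1: "bounded_linear (\<lambda>u. (u, 0))" and 2: "bounded_linear (\<lambda>u. (0, u))"
    by (intro bounded_linear_Pair bounded_linear_ident bounded_linear_zero)+
  show ?thesis
    using smooth_add[OF smooth_bounded_linear[OF 1 assms(1)] smooth_bounded_linear[OF 2 assms(2)]]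
    by simp
qed

lemma smooth_sum: "(\<And>i. i \<in> I \<Longrightarrow> smooth (f i)) \<Longrightarrow> smooth (\<lambda>x. \<Sum>i\<in>I. f i x)"
  by (simp add: smooth_def Ck_sum)

lemma smooth_power:
  fixes f :: "'a::euclidean_space \<Rightarrow> real"
  shows "smooth f \<Longrightarrow> smooth (\<lambda>x. f x ^ k)"
  by (induction k) auto

lemma smooth_vec:
  fixes f :: "'n::finite \<Rightarrow> 'a::euclidean_space \<Rightarrow> real"
  assumes "\<And>j. smooth (f j)"
  shows "smooth (\<lambda>x. \<chi> j. f j x)"
proof -
  have "(\<chi> j. f j x) = (\<Sum>j\<in>UNIV. f j x *\<^sub>R axis j 1)" for x
    by (simp add: vec_eq_iff axis_def if_distrib cong: if_cong)
  moreover have "smooth (\<lambda>x. \<Sum>j\<in>UNIV. f j x *\<^sub>R (axis j 1 :: real^'n))"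
    by (intro smooth_sum smooth_scaleR assms smooth_const)
  ultimately show ?thesis by simp
qed

lemma smooth_has_derivative:
  "smooth f \<Longrightarrow> (f has_derivative frechet_derivative f (at x)) (at x)"
  unfolding smooth_def using Ck_Suc_has_derivative by blast

lemma smooth_continuous_on: "smooth f \<Longrightarrow> continuous_on S f"
  using Ck.simps(1) continuous_on_subset unfolding smooth_def by blast

lemma smooth_partial:
  assumes "smooth f"
  shows "smooth (\<lambda>x. frechet_derivative f (at x) e)"
proof -
  have "frechet_derivative f (at x) e = (\<Sum>b\<in>Basis. (e \<bullet> b) *\<^sub>R frechet_derivative f (at x) b)" for x
  proof -
    have lin: "linear (frechet_derivative f (at x))"
      using smooth_has_derivative[OF assms] has_derivative_linear by blast
    have "frechet_derivative f (at x) e = frechet_derivative f (at x) (\<Sum>b\<in>Basis. (e \<bullet> b) *\<^sub>R b)"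
      by (simp add: euclidean_representation)
    then show ?thesis
      by (simp add: linear_sum[OF lin] linear_cmul[OF lin])
  qed
  moreover have "smooth (\<lambda>x. \<Sum>b\<in>Basis. (e \<bullet> b) *\<^sub>R frechet_derivative f (at x) b)"
    using assms unfolding smooth_def
    by (intro allI Ck_sum Ck_scaleR Ck_const) (metis Ck.simps(2))
  ultimately show ?thesis by simp
qed

lemma smooth_Dt:
  fixes f :: "real \<Rightarrow> 'b::real_normed_vector"
  assumes "smooth f"
  shows smooth_has_Dt: "(f has_vector_derivative Dt f x) (at x)"
    and smooth_Dt_smooth: "smooth (Dt f)"
proof -
  have D: "(f has_vector_derivative frechet_derivative f (at x) 1) (at x)" for x
  proof -
    have "frechet_derivative f (at x) h = h *\<^sub>R frechet_derivative f (at x) 1" for h :: real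
      using linear_cmul[OF has_derivative_linear[OF smooth_has_derivative[OF assms]], of x h 1] by simp
    then have "frechet_derivative f (at x) = (\<lambda>h. h *\<^sub>R frechet_derivative f (at x) 1)" by blast
    then show ?thesis
      using smooth_has_derivative[OF assms, of x] by (simp add: has_vector_derivative_def)
  qed
  have eq: "Dt f = (\<lambda>x. frechet_derivative f (at x) 1)"
    using vector_derivative_at[OF D] by (auto simp: Dt_def)
  show "(f has_vector_derivative Dt f x) (at x)" "smooth (Dt f)"
    using D smooth_partial[OF assms] by (auto simp: eq)
qed

lemma smooth_Dt_funpow: "smooth f \<Longrightarrow> smooth ((Dt ^^ k) f)"
  by (induction k) (auto intro: smooth_Dt_smooth)

subsection \<open>Partial derivatives of functions of two real variables\<close>

definition pd1 :: "(real \<times> real \<Rightarrow> real) \<Rightarrow> real \<times> real \<Rightarrow> real" where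
  "pd1 F z = frechet_derivative F (at z) (1, 0)"

definition pd2 :: "(real \<times> real \<Rightarrow> real) \<Rightarrow> real \<times> real \<Rightarrow> real" where
  "pd2 F z = frechet_derivative F (at z) (0, 1)"

lemma smooth_pd1: "smooth F \<Longrightarrow> smooth (pd1 F)"
  and smooth_pd2: "smooth F \<Longrightarrow> smooth (pd2 F)"
  using smooth_partial unfolding pd1_def[abs_def] pd2_def[abs_def] by blast+

lemma has_pd1:
  assumes "smooth F"
  shows "((\<lambda>s. F (s, \<tau>)) has_real_derivative pd1 F (s, \<tau>)) (at s)"
proof -
  have "((\<lambda>s. F (s, \<tau>)) has_derivative (\<lambda>h. frechet_derivative F (at (s, \<tau>)) (h, 0))) (at s)"
    by (rule has_derivative_compose[OF _ smooth_has_derivative[OF assms]])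
      (auto intro!: derivative_eq_intros)
  moreover have "frechet_derivative F (at (s, \<tau>)) (h, 0) = h * pd1 F (s, \<tau>)" for h
    using linear_cmul[OF has_derivative_linear[OF smooth_has_derivative[OF assms]], of _ h "(1,0)"]
    by (simp add: pd1_def)
  ultimately show ?thesis
    by (simp add: has_field_derivative_def mult_commute_abs)
qed

lemma has_pd2:
  assumes "smooth F"
  shows "((\<lambda>\<tau>. F (s, \<tau>)) has_real_derivative pd2 F (s, \<tau>)) (at \<tau>)"
proof -
  have "((\<lambda>\<tau>. F (s, \<tau>)) has_derivative (\<lambda>h. frechet_derivative F (at (s, \<tau>)) (0, h))) (at \<tau>)"
    by (rule has_derivative_compose[OF _ smooth_has_derivative[OF assms]])
      (auto intro!: derivative_eq_intros)
  moreover have "frechet_derivative F (at (s, \<tau>)) (0, h) = h * pd2 F (s, \<tau>)" for h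
    using linear_cmul[OF has_derivative_linear[OF smooth_has_derivative[OF assms]], of _ h "(0,1)"]
    by (simp add: pd2_def)
  ultimately show ?thesis
    by (simp add: has_field_derivative_def mult_commute_abs)
qed

lemma smooth_slice: "smooth F \<Longrightarrow> smooth (\<lambda>\<tau>. F (s, \<tau>))"
  by (rule smooth_compose[of F]) (auto intro: smooth_ident)

lemma Dt_slice: "smooth F \<Longrightarrow> Dt (\<lambda>\<tau>. F (s, \<tau>)) = (\<lambda>\<tau>. pd2 F (s, \<tau>))"
  using has_pd2 by (auto simp: Dt_def fun_eq_iff has_real_derivative_iff_has_vector_derivative
      intro!: vector_derivative_at)

lemma smooth_pd2_funpow: "smooth F \<Longrightarrow> smooth ((pd2 ^^ k) F)"
  by (induction k) (auto intro: smooth_pd2)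

lemma Dt_funpow_slice: "smooth F \<Longrightarrow> (Dt ^^ k) (\<lambda>\<tau>. F (s, \<tau>)) = (\<lambda>\<tau>. (pd2 ^^ k) F (s, \<tau>))"
  by (induction k) (auto simp: Dt_slice smooth_pd2_funpow)

text \<open>Symmetry of second derivatives: differentiating
  \<open>F (u, \<tau>) = F (0, \<tau>) + (\<integral> s from 0 to u. pd1 F (s, \<tau>))\<close> in \<open>\<tau>\<close> under the integral sign exhibits
  \<open>pd2 F\<close> as a primitive, in its first variable, of the continuous function \<open>pd2 (pd1 F)\<close>.\<close>

lemma pd1_pd2_commute:
  assumes F: "smooth F"
  shows "pd1 (pd2 F) = pd2 (pd1 F)"
proof -
  have "pd1 (pd2 F) (s, \<tau>) = pd2 (pd1 F) (s, \<tau>)" for s \<tau>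
  proof -
    let ?a = "s - 1"
    have int: "pd2 F (u, \<tau>) - pd2 F (?a, \<tau>) = integral {?a..u} (\<lambda>\<sigma>. pd2 (pd1 F) (\<sigma>, \<tau>))"
      if "u \<ge> ?a" for u
    proof -
      have 1: "F (u, r) - F (?a, r) = integral {?a..u} (\<lambda>\<sigma>. pd1 F (\<sigma>, r))" for r
        using fundamental_theorem_of_calculus[OF that, of "\<lambda>\<sigma>. F (\<sigma>, r)"] has_pd1[OF F]
        by (metis (no_types, lifting) has_real_derivative_iff_has_vector_derivative
            has_vector_derivative_at_within integral_unique)
      have "((\<lambda>r. integral (cbox ?a u) (\<lambda>\<sigma>. pd1 F (\<sigma>, r))) has_real_derivative
             integral (cbox ?a u) (\<lambda>\<sigma>. pd2 (pd1 F) (\<sigma>, \<tau>))) (at \<tau> within UNIV)"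
      proof (rule leibniz_rule_field_derivative)
        show "((\<lambda>r. pd1 F (\<sigma>, r)) has_real_derivative pd2 (pd1 F) (\<sigma>, r)) (at r within UNIV)" for r \<sigma>
          using has_pd2[OF smooth_pd1[OF F]] by simp
        show "(\<lambda>\<sigma>. pd1 F (\<sigma>, r)) integrable_on cbox ?a u" for r
          by (intro integrable_continuous continuous_on_compose2[OF smooth_continuous_on[OF smooth_pd1[OF F]]]
              continuous_intros) auto
        show "continuous_on (UNIV \<times> cbox ?a u) (\<lambda>(r, \<sigma>). pd2 (pd1 F) (\<sigma>, r))"
          unfolding split_beta
          by (intro continuous_on_compose2[OF smooth_continuous_on[OF smooth_pd2[OF smooth_pd1[OF F]]]]
              continuous_intros) auto
      qed auto
      then have "((\<lambda>r. F (u, r) - F (?a, r)) has_real_derivative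
             integral {?a..u} (\<lambda>\<sigma>. pd2 (pd1 F) (\<sigma>, \<tau>))) (at \<tau>)"
        by (simp add: 1)
      moreover have "((\<lambda>r. F (u, r) - F (?a, r)) has_real_derivative
             pd2 F (u, \<tau>) - pd2 F (?a, \<tau>)) (at \<tau>)"
        by (intro derivative_intros has_pd2 F)
      ultimately show ?thesis by (rule DERIV_unique[symmetric])
    qed
    have "((\<lambda>u. integral {?a..u} (\<lambda>\<sigma>. pd2 (pd1 F) (\<sigma>, \<tau>))) has_real_derivative pd2 (pd1 F) (s, \<tau>))
        (at s within {?a..s+1})"
      by (intro integral_has_real_derivative
          continuous_on_compose2[OF smooth_continuous_on[OF smooth_pd2[OF smooth_pd1[OF F]]]]
          continuous_intros) auto
    moreover have "((\<lambda>u. pd2 F (u, \<tau>) - pd2 F (?a, \<tau>)) has_real_derivative pd1 (pd2 F) (s, \<tau>))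
        (at s within {?a..s+1})"
      by (rule has_field_derivative_at_within)
        (use DERIV_diff[OF has_pd1[OF smooth_pd2[OF F]] DERIV_const] in auto)
    then have "((\<lambda>u. integral {?a..u} (\<lambda>\<sigma>. pd2 (pd1 F) (\<sigma>, \<tau>))) has_real_derivative pd1 (pd2 F) (s, \<tau>))
        (at s within {?a..s+1})"
      unfolding has_field_derivative_def
      by (rule has_derivative_transform[rotated 2]) (use int in auto)
    ultimately have "((\<lambda>u. integral {?a..u} (\<lambda>\<sigma>. pd2 (pd1 F) (\<sigma>, \<tau>))) has_real_derivative pd2 (pd1 F) (s, \<tau>)) (at s)"
      "((\<lambda>u. integral {?a..u} (\<lambda>\<sigma>. pd2 (pd1 F) (\<sigma>, \<tau>))) has_real_derivative pd1 (pd2 F) (s, \<tau>)) (at s)"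
      by (auto simp: at_within_Icc_at)
    then show ?thesis by (metis DERIV_unique)
  qed
  then show ?thesis by auto
qed

lemma pd1_pd2_funpow_commute: "smooth F \<Longrightarrow> pd1 ((pd2 ^^ k) F) = (pd2 ^^ k) (pd1 F)"
  by (induction k) (auto simp: pd1_pd2_commute smooth_pd2_funpow)


section \<open>Formal properties of the Riemann--Liouville derivatives\<close>

lemma Dt_cong_open:
  assumes "open S" "\<And>t. t \<in> S \<Longrightarrow> f t = g t" "t \<in> S"
  shows "Dt f t = Dt g t"
proof -
  have "(f has_vector_derivative D) (at t) \<longleftrightarrow> (g has_vector_derivative D) (at t)" for D
    using has_vector_derivative_transform_within_open[of _ D t S] assms by metis
  then show ?thesis by (simp add: Dt_def vector_derivative_def)
qed

lemma Dt_funpow_cong_open: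
  assumes "open S" "\<And>t. t \<in> S \<Longrightarrow> f t = g t"
  shows "t \<in> S \<Longrightarrow> (Dt ^^ k) f t = (Dt ^^ k) g t"
proof (induction k arbitrary: t)
  case (Suc k)
  show ?case
    using Dt_cong_open[OF assms(1) Suc.IH Suc.prems] by simp
qed (use assms in auto)

lemma differentiable_cong_open:
  assumes "open S" "\<And>t. t \<in> S \<Longrightarrow> f t = g t" "t \<in> S" "f differentiable (at t)"
  shows "g differentiable (at t)"
  using assms has_derivative_transform_within_open unfolding differentiable_def by metis

lemma n_times_differentiable_cong:
  assumes "\<And>t. t \<in> {a<..<b} \<Longrightarrow> f t = g t" "n_times_differentiable_on_interval N f a b"
  shows "n_times_differentiable_on_interval N g a b"
  unfolding n_times_differentiable_on_interval_def
proof (intro allI impI ballI)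
  fix k t assume k: "k < N" and t: "t \<in> {a<..<b}"
  show "(Dt ^^ k) g differentiable (at t)"
  proof (rule differentiable_cong_open[OF open_greaterThanLessThan _ t])
    show "(Dt ^^ k) f \<tau> = (Dt ^^ k) g \<tau>" if "\<tau> \<in> {a<..<b}" for \<tau>
      by (rule Dt_funpow_cong_open[OF open_greaterThanLessThan assms(1) that])
    show "(Dt ^^ k) f differentiable (at t)"
      using assms(2) k t by (auto simp: n_times_differentiable_on_interval_def)
  qed
qed

lemma n_times_differentiable_Dt:
  assumes "n_times_differentiable_on_interval N f a b" "k < N" "t \<in> {a<..<b}"
  shows "((Dt ^^ k) f has_vector_derivative (Dt ^^ Suc k) f t) (at t)"
  using assms unfolding n_times_differentiable_on_interval_def funpow.simps(2) comp_def Dt_def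
  by (metis vector_derivative_works)

text \<open>A criterion in terms of a sequence \<open>G\<close> of candidates for the successive derivatives. It reduces the
  behaviour of iterated derivatives under linear maps, sums and reflections, and the existence of the
  Riemann--Liouville derivatives of smooth functions, to a single differentiation.\<close>

lemma n_times_differentiableI:
  assumes "\<And>k t. k < N \<Longrightarrow> t \<in> {a<..<b} \<Longrightarrow> (G k has_vector_derivative G (Suc k) t) (at t)"
    and "\<And>t. t \<in> {a<..<b} \<Longrightarrow> f t = G 0 t"
  shows "n_times_differentiable_on_interval N f a b"
    and "k \<le> N \<Longrightarrow> t \<in> {a<..<b} \<Longrightarrow> (Dt ^^ k) f t = G k t"
proof -
  have *: "(Dt ^^ k) f t = G k t" if "k \<le> N" "t \<in> {a<..<b}" for k t
    using that
  proof (induction k arbitrary: t)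
    case (Suc k)
    have "Dt ((Dt ^^ k) f) t = Dt (G k) t"
      by (rule Dt_cong_open[OF open_greaterThanLessThan _ Suc.prems(2)]) (use Suc in auto)
    also have "\<dots> = G (Suc k) t"
      using assms(1)[of k t] Suc.prems by (auto simp: Dt_def intro: vector_derivative_at)
    finally show ?case by simp
  qed (use assms in auto)
  then show "k \<le> N \<Longrightarrow> t \<in> {a<..<b} \<Longrightarrow> (Dt ^^ k) f t = G k t" by blast
  show "n_times_differentiable_on_interval N f a b"
    unfolding n_times_differentiable_on_interval_def
  proof (intro allI impI ballI)
    fix k t assume k: "k < N" and t: "t \<in> {a<..<b}"
    show "(Dt ^^ k) f differentiable (at t)"
      by (rule differentiable_cong_open[OF open_greaterThanLessThan, of a b "G k"])
        (use * assms(1)[OF k t] k t in \<open>auto intro: differentiableI_vector\<close>)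
  qed
qed

lemma n_times_differentiable_linear:
  assumes "bounded_linear T" "n_times_differentiable_on_interval N f a b"
  shows "n_times_differentiable_on_interval N (\<lambda>t. T (f t)) a b"
    and "k \<le> N \<Longrightarrow> t \<in> {a<..<b} \<Longrightarrow> (Dt ^^ k) (\<lambda>t. T (f t)) t = T ((Dt ^^ k) f t)"
proof -
  have D: "((\<lambda>t. T ((Dt ^^ k) f t)) has_vector_derivative T ((Dt ^^ Suc k) f t)) (at t)"
    if "k < N" "t \<in> {a<..<b}" for k t
    by (rule bounded_linear.has_vector_derivative[OF assms(1) n_times_differentiable_Dt[OF assms(2) that]])
  note * = n_times_differentiableI[where G = "\<lambda>k t. T ((Dt ^^ k) f t)" and f = "\<lambda>t. T (f t)", OF D]
  show "n_times_differentiable_on_interval N (\<lambda>t. T (f t)) a b"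
    by (rule *(1)) auto
  show "k \<le> N \<Longrightarrow> t \<in> {a<..<b} \<Longrightarrow> (Dt ^^ k) (\<lambda>t. T (f t)) t = T ((Dt ^^ k) f t)"
    by (rule *(2)) auto
qed

lemma n_times_differentiable_add:
  assumes "n_times_differentiable_on_interval N f a b" "n_times_differentiable_on_interval N g a b"
  shows "n_times_differentiable_on_interval N (\<lambda>t. f t + g t) a b"
    and "k \<le> N \<Longrightarrow> t \<in> {a<..<b} \<Longrightarrow>
      (Dt ^^ k) (\<lambda>t. f t + g t) t = (Dt ^^ k) f t + (Dt ^^ k) g t"
proof -
  have D: "((\<lambda>t. (Dt ^^ k) f t + (Dt ^^ k) g t) has_vector_derivative
      (Dt ^^ Suc k) f t + (Dt ^^ Suc k) g t) (at t)" if "k < N" "t \<in> {a<..<b}" for k t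
    by (intro has_vector_derivative_add n_times_differentiable_Dt[OF assms(1) that]
        n_times_differentiable_Dt[OF assms(2) that])
  note * = n_times_differentiableI[where G = "\<lambda>k t. (Dt ^^ k) f t + (Dt ^^ k) g t"
      and f = "\<lambda>t. f t + g t", OF D]
  show "n_times_differentiable_on_interval N (\<lambda>t. f t + g t) a b"
    by (rule *(1)) auto
  show "k \<le> N \<Longrightarrow> t \<in> {a<..<b} \<Longrightarrow>
      (Dt ^^ k) (\<lambda>t. f t + g t) t = (Dt ^^ k) f t + (Dt ^^ k) g t"
    by (rule *(2)) auto
qed

lemma has_vector_derivative_reflect:
  assumes "(f has_vector_derivative D) (at (- t))"
  shows "((\<lambda>t. f (- t)) has_vector_derivative - D) (at (t::real))"
proof -
  have "((\<lambda>t. - t) has_vector_derivative - 1) (at t)"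
    by (auto intro!: derivative_eq_intros simp: has_real_derivative_iff_has_vector_derivative[symmetric])
  from vector_diff_chain_at[OF this assms] show ?thesis by (simp add: o_def)
qed

lemma n_times_differentiable_reflect:
  assumes "n_times_differentiable_on_interval N f (- b) (- a)"
  shows "n_times_differentiable_on_interval N (\<lambda>t. f (- t)) a b"
    and "k \<le> N \<Longrightarrow> t \<in> {a<..<b} \<Longrightarrow>
      ((\<lambda>f \<tau>. - Dt f \<tau>) ^^ k) (\<lambda>t. f (- t)) t = (Dt ^^ k) f (- t)"
proof -
  have D: "((\<lambda>t. (-1) ^ k *\<^sub>R (Dt ^^ k) f (- t)) has_vector_derivative
      (-1) ^ Suc k *\<^sub>R (Dt ^^ Suc k) f (- t)) (at t)" if "k < N" "t \<in> {a<..<b}" for k t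
  proof -
    have "((\<lambda>t. (Dt ^^ k) f (- t)) has_vector_derivative - (Dt ^^ Suc k) f (- t)) (at t)"
      by (rule has_vector_derivative_reflect, rule n_times_differentiable_Dt[OF assms])
        (use that in auto)
    from bounded_linear.has_vector_derivative[OF bounded_linear_scaleR_right this, of "(-1)^k"]
    show ?thesis by simp
  qed
  show "n_times_differentiable_on_interval N (\<lambda>t. f (- t)) a b"
    by (rule n_times_differentiableI(1)[where G = "\<lambda>k t. (-1) ^ k *\<^sub>R (Dt ^^ k) f (- t)", OF D]) auto
  have D': "((\<lambda>t. (Dt ^^ k) f (- t)) has_vector_derivative - (Dt ^^ Suc k) f (- t)) (at t)"
    if "k < N" "t \<in> {a<..<b}" for k t
    by (rule has_vector_derivative_reflect, rule n_times_differentiable_Dt[OF assms])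
      (use that in auto)
  show "k \<le> N \<Longrightarrow> t \<in> {a<..<b} \<Longrightarrow>
      ((\<lambda>f \<tau>. - Dt f \<tau>) ^^ k) (\<lambda>t. f (- t)) t = (Dt ^^ k) f (- t)"
  proof (induction k arbitrary: t)
    case (Suc k)
    have "Dt (((\<lambda>f \<tau>. - Dt f \<tau>) ^^ k) (\<lambda>t. f (- t))) t = Dt (\<lambda>t. (Dt ^^ k) f (- t)) t"
      by (rule Dt_cong_open[OF open_greaterThanLessThan _ Suc.prems(2)]) (use Suc in auto)
    also have "\<dots> = - (Dt ^^ Suc k) f (- t)"
      using D'[of k t] Suc.prems by (auto simp: Dt_def intro: vector_derivative_at)
    finally show ?case by simp
  qed auto
qed

lemma left_RL_linear:
  assumes "bounded_linear T" "left_RL_exists a b \<alpha> x"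
  shows "left_RL_exists a b \<alpha> (\<lambda>t. T (x t))"
    and "t \<in> {a<..<b} \<Longrightarrow> left_RL a \<alpha> (\<lambda>t. T (x t)) t = T (left_RL a \<alpha> x t)"
proof -
  have k: "left_kernel_integrand \<alpha> (\<lambda>t. T (x t)) t = T \<circ> left_kernel_integrand \<alpha> x t" for t
    using bounded_linear.linear[OF assms(1)]
    by (auto simp: left_kernel_integrand_def linear_cmul)
  have I: "left_integral a \<alpha> (\<lambda>t. T (x t)) t = T (left_integral a \<alpha> x t)" if "t \<in> {a<..<b}" for t
    using assms that by (simp add: left_integral_def k integral_linear left_RL_exists_def)
  have n: "n_times_differentiable_on_interval (frac_order \<alpha>) (left_integral a \<alpha> x) a b"
    using assms by (simp add: left_RL_exists_def)
  note N = n_times_differentiable_linear[OF assms(1) n]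
  show "left_RL_exists a b \<alpha> (\<lambda>t. T (x t))"
    unfolding left_RL_exists_def
  proof (intro conjI ballI)
    show "left_kernel_integrand \<alpha> (\<lambda>t. T (x t)) t integrable_on {a..t}" if "t \<in> {a<..<b}" for t
      using assms that by (auto simp: k left_RL_exists_def intro: integrable_linear)
    show "n_times_differentiable_on_interval (frac_order \<alpha>) (left_integral a \<alpha> (\<lambda>t. T (x t))) a b"
      by (rule n_times_differentiable_cong[OF _ N(1)]) (simp add: I)
  qed
  assume t: "t \<in> {a<..<b}"
  have "(Dt ^^ frac_order \<alpha>) (left_integral a \<alpha> (\<lambda>t. T (x t))) t
      = (Dt ^^ frac_order \<alpha>) (\<lambda>t. T (left_integral a \<alpha> x t)) t"
    by (rule Dt_funpow_cong_open[OF open_greaterThanLessThan _ t]) (simp add: I)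
  then show "left_RL a \<alpha> (\<lambda>t. T (x t)) t = T (left_RL a \<alpha> x t)"
    using bounded_linear.linear[OF assms(1)] N(2)[OF order_refl t]
    by (simp add: left_RL_def linear_cmul)
qed

lemma left_RL_add:
  assumes "left_RL_exists a b \<alpha> x" "left_RL_exists a b \<alpha> y"
  shows "left_RL_exists a b \<alpha> (\<lambda>t. x t + y t)"
    and "t \<in> {a<..<b} \<Longrightarrow> left_RL a \<alpha> (\<lambda>t. x t + y t) t = left_RL a \<alpha> x t + left_RL a \<alpha> y t"
proof -
  have k: "left_kernel_integrand \<alpha> (\<lambda>t. x t + y t) t =
    (\<lambda>s. left_kernel_integrand \<alpha> x t s + left_kernel_integrand \<alpha> y t s)" for t
    by (auto simp: left_kernel_integrand_def scaleR_add_right)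
  have I: "left_integral a \<alpha> (\<lambda>t. x t + y t) t = left_integral a \<alpha> x t + left_integral a \<alpha> y t"
    if "t \<in> {a<..<b}" for t
    using assms that by (simp add: left_integral_def k integral_add left_RL_exists_def)
  have n: "n_times_differentiable_on_interval (frac_order \<alpha>) (left_integral a \<alpha> x) a b"
    "n_times_differentiable_on_interval (frac_order \<alpha>) (left_integral a \<alpha> y) a b"
    using assms by (simp_all add: left_RL_exists_def)
  note N = n_times_differentiable_add[OF n]
  show "left_RL_exists a b \<alpha> (\<lambda>t. x t + y t)"
    unfolding left_RL_exists_def
  proof (intro conjI ballI)
    show "left_kernel_integrand \<alpha> (\<lambda>t. x t + y t) t integrable_on {a..t}" if "t \<in> {a<..<b}" for t
      using assms that by (auto simp: k left_RL_exists_def intro: integrable_add)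
    show "n_times_differentiable_on_interval (frac_order \<alpha>) (left_integral a \<alpha> (\<lambda>t. x t + y t)) a b"
      by (rule n_times_differentiable_cong[OF _ N(1)]) (simp add: I)
  qed
  assume t: "t \<in> {a<..<b}"
  have "(Dt ^^ frac_order \<alpha>) (left_integral a \<alpha> (\<lambda>t. x t + y t)) t
      = (Dt ^^ frac_order \<alpha>) (\<lambda>t. left_integral a \<alpha> x t + left_integral a \<alpha> y t) t"
    by (rule Dt_funpow_cong_open[OF open_greaterThanLessThan _ t]) (simp add: I)
  then show "left_RL a \<alpha> (\<lambda>t. x t + y t) t = left_RL a \<alpha> x t + left_RL a \<alpha> y t"
    using N(2)[OF order_refl t] by (simp add: left_RL_def scaleR_add_right)
qed

text \<open>Time reversal exchanges the left and the right derivatives; every property of right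
  derivatives below is obtained in this way.\<close>

lemma right_integral_reflect:
  "right_integral b \<alpha> x = (\<lambda>t. left_integral (- b) \<alpha> (\<lambda>s. x (- s)) (- t))"
proof
  fix t
  have "left_integral (- b) \<alpha> (\<lambda>s. x (- s)) (- t) =
      integral {- b..- t} (\<lambda>s. right_kernel_integrand \<alpha> x t (- s))"
    unfolding left_integral_def
    by (rule arg_cong[where f = "integral _"])
      (auto simp: left_kernel_integrand_def right_kernel_integrand_def fun_eq_iff minus_diff_commute)
  then show "right_integral b \<alpha> x t = left_integral (- b) \<alpha> (\<lambda>s. x (- s)) (- t)"
    by (simp add: right_integral_def)
qed

lemma right_kernel_integrable_reflect:
  "right_kernel_integrand \<alpha> x t integrable_on {t..b} \<longleftrightarrow>
   left_kernel_integrand \<alpha> (\<lambda>s. x (- s)) (- t) integrable_on {- b..- t}"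
proof -
  have "left_kernel_integrand \<alpha> (\<lambda>s. x (- s)) (- t) = (\<lambda>s. right_kernel_integrand \<alpha> x t (- s))"
    by (auto simp: left_kernel_integrand_def right_kernel_integrand_def fun_eq_iff minus_diff_commute)
  then show ?thesis by simp
qed

lemma right_RL_exists_reflect:
  "right_RL_exists a b \<alpha> x \<longleftrightarrow> left_RL_exists (- b) (- a) \<alpha> (\<lambda>s. x (- s))"
proof -
  have "(\<forall>t\<in>{a<..<b}. right_kernel_integrand \<alpha> x t integrable_on {t..b}) \<longleftrightarrow>
    (\<forall>t\<in>{-b<..<-a}. left_kernel_integrand \<alpha> (\<lambda>s. x (- s)) t integrable_on {-b..t})"
    (is "?l \<longleftrightarrow> ?r")
  proof
    assume ?l
    show ?r
    proof
      fix t assume "t \<in> {-b<..<-a}"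
      then have "- t \<in> {a<..<b}" by auto
      with \<open>?l\<close> show "left_kernel_integrand \<alpha> (\<lambda>s. x (- s)) t integrable_on {-b..t}"
        using right_kernel_integrable_reflect[of \<alpha> x "- t" b] by auto
    qed
  next
    assume ?r
    show ?l
    proof
      fix t assume "t \<in> {a<..<b}"
      then have "- t \<in> {-b<..<-a}" by auto
      with \<open>?r\<close> show "right_kernel_integrand \<alpha> x t integrable_on {t..b}"
        using right_kernel_integrable_reflect[of \<alpha> x t b] by auto
    qed
  qed
  moreover have "n_times_differentiable_on_interval n (right_integral b \<alpha> x) a b \<longleftrightarrow>
    n_times_differentiable_on_interval n (left_integral (-b) \<alpha> (\<lambda>s. x (- s))) (-b) (-a)" for n
    using n_times_differentiable_reflect(1)[of n "left_integral (-b) \<alpha> (\<lambda>s. x (- s))" b a]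
      n_times_differentiable_reflect(1)[of n "right_integral b \<alpha> x" "-a" "-b"]
    by (auto simp: right_integral_reflect)
  ultimately show ?thesis
    by (simp add: left_RL_exists_def right_RL_exists_def)
qed

lemma right_RL_reflect:
  assumes "right_RL_exists a b \<alpha> x" "t \<in> {a<..<b}"
  shows "right_RL b \<alpha> x t = left_RL (- b) \<alpha> (\<lambda>s. x (- s)) (- t)"
  using n_times_differentiable_reflect(2)[of "frac_order \<alpha>" "left_integral (-b) \<alpha> (\<lambda>s. x (- s))" b a
      "frac_order \<alpha>" t] assms
  by (simp add: right_RL_def left_RL_def right_integral_reflect right_RL_exists_reflect left_RL_exists_def)


section \<open>Riemann--Liouville derivatives of smooth functions\<close>

definition frac_int :: "real \<Rightarrow> real \<Rightarrow> (real \<Rightarrow> real) \<Rightarrow> real \<Rightarrow> real" where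
  "frac_int \<rho> a f t = integral {a..t} (\<lambda>s. (t - s) powr \<rho> * f s)"

text \<open>The primitive of the kernel is continuous up to \<open>s = t\<close> and vanishes there, so that the
  fundamental theorem of calculus on the open interval gives both the integrability of the singular
  integrand and the value of its integral.\<close>

lemma frac_int_parts:
  assumes f: "smooth f" and \<rho>: "\<rho> > -1" and t: "a \<le> t"
  shows "(\<lambda>s. (t - s) powr \<rho> * f s) integrable_on {a..t}"
    and "frac_int \<rho> a f t =
      (t - a) powr (\<rho> + 1) / (\<rho> + 1) * f a + frac_int (\<rho> + 1) a (Dt f) t / (\<rho> + 1)"
proof -
  let ?G = "\<lambda>s. - ((t - s) powr (\<rho> + 1) / (\<rho> + 1) * f s)"
  let ?G1 = "\<lambda>s. (t - s) powr (\<rho> + 1) / (\<rho> + 1) * Dt f s"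
  have "((\<lambda>s. (t - s) powr \<rho> * f s - ?G1 s) has_integral (?G t - ?G a)) {a..t}"
  proof (rule fundamental_theorem_of_calculus_interior[OF t])
    show "continuous_on {a..t} ?G"
      using \<rho> by (intro continuous_intros continuous_on_powr' smooth_continuous_on[OF f]) auto
    fix s assume s: "s \<in> {a<..<t}"
    have Df: "(f has_real_derivative Dt f s) (at s)"
      using smooth_has_Dt[OF f] by (simp add: has_real_derivative_iff_has_vector_derivative)
    have "(?G has_real_derivative (t - s) powr \<rho> * f s - ?G1 s) (at s)"
      using s \<rho> by (auto intro!: derivative_eq_intros Df simp: divide_simps)
    then show "(?G has_vector_derivative (t - s) powr \<rho> * f s - ?G1 s) (at s)"
      by (simp add: has_real_derivative_iff_has_vector_derivative)
  qed
  then have 1: "((\<lambda>s. (t - s) powr \<rho> * f s - ?G1 s) has_integral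
      (t - a) powr (\<rho> + 1) / (\<rho> + 1) * f a) {a..t}" by simp
  have "?G1 integrable_on {a..t}"
    using \<rho> by (intro integrable_continuous_interval continuous_intros continuous_on_powr'
        smooth_continuous_on[OF smooth_Dt_smooth[OF f]]) auto
  then have 2: "(?G1 has_integral integral {a..t} ?G1) {a..t}" by blast
  have "?G1 = (\<lambda>s. (1 / (\<rho> + 1)) *\<^sub>R ((t - s) powr (\<rho> + 1) * Dt f s))" by auto
  then have 3: "integral {a..t} ?G1 = frac_int (\<rho> + 1) a (Dt f) t / (\<rho> + 1)"
    by (simp only: integral_cmul frac_int_def) simp
  have 4: "((\<lambda>s. (t - s) powr \<rho> * f s) has_integral
      (t - a) powr (\<rho> + 1) / (\<rho> + 1) * f a + integral {a..t} ?G1) {a..t}"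
    using has_integral_add[OF 1 2] by simp
  then show "(\<lambda>s. (t - s) powr \<rho> * f s) integrable_on {a..t}" by blast
  show "frac_int \<rho> a f t =
      (t - a) powr (\<rho> + 1) / (\<rho> + 1) * f a + frac_int (\<rho> + 1) a (Dt f) t / (\<rho> + 1)"
    using 4 3 by (simp add: frac_int_def integral_unique)
qed

lemma has_derivative_max_powr:
  assumes "\<sigma> > 1"
  shows "((\<lambda>u. max 0 u powr \<sigma>) has_real_derivative \<sigma> * max 0 u powr (\<sigma> - 1)) (at u)"
proof -
  consider "u > 0" | "u < 0" | "u = 0" by linarith
  then show ?thesis
  proof cases
    case 1
    have "((\<lambda>u. u powr \<sigma>) has_real_derivative \<sigma> * u powr (\<sigma> - 1)) (at u)"
      by (rule has_real_derivative_powr[OF 1])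
    then have "((\<lambda>u. max 0 u powr \<sigma>) has_real_derivative \<sigma> * u powr (\<sigma> - 1)) (at u)"
      by (rule has_field_derivative_transform_within_open[where S = "{0<..}"]) (use 1 in auto)
    with 1 show ?thesis by simp
  next
    case 2
    have "((\<lambda>u. max 0 u powr \<sigma>) has_real_derivative 0) (at u)"
      by (rule has_field_derivative_transform_within_open[where S = "{..<0}" and f = "\<lambda>_. 0"])
        (use 2 in auto)
    with 2 show ?thesis by simp
  next
    case 3
    have "((\<lambda>h. max 0 h powr \<sigma> / h) \<longlongrightarrow> 0) (at (0::real))"
    proof (rule Lim_null_comparison)
      show "\<forall>\<^sub>F h in at (0::real). norm (max 0 h powr \<sigma> / h) \<le> \<bar>h\<bar> powr (\<sigma> - 1)"
        unfolding eventually_at_filter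
      proof (rule always_eventually, intro allI impI)
        fix h :: real
        show "norm (max 0 h powr \<sigma> / h) \<le> \<bar>h\<bar> powr (\<sigma> - 1)"
        proof (cases "h > 0")
          case True
          then show ?thesis by (simp add: powr_diff max_absorb2)
        next
          case False
          then show ?thesis by (simp add: max_absorb1)
        qed
      qed
      have "continuous (at 0) (\<lambda>h::real. \<bar>h\<bar> powr (\<sigma> - 1))"
        using continuous_on_powr'[of UNIV "\<lambda>h::real. \<bar>h\<bar>" "\<lambda>h. \<sigma> - 1"] assms
        by (auto simp: continuous_on_eq_continuous_at intro!: continuous_intros)
      then show "((\<lambda>h::real. \<bar>h\<bar> powr (\<sigma> - 1)) \<longlongrightarrow> 0) (at 0)"
        using assms by (simp add: continuous_at)
    qed
    with 3 assms show ?thesis by (simp add: DERIV_def)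
  qed
qed

text \<open>For \<open>\<sigma> > 1\<close> the kernel, extended by 0 to \<open>s > t\<close>, is continuously differentiable in \<open>t\<close>. The extension
  moves the variable bound of the integral into the integrand, where Leibniz' rule applies.\<close>

lemma frac_int_has_derivative:
  assumes \<sigma>: "\<sigma> > 1" and g: "continuous_on UNIV g" and t: "a < t"
  shows "(frac_int \<sigma> a g has_real_derivative \<sigma> * frac_int (\<sigma> - 1) a g t) (at t)"
proof -
  define T where "T = t + 1"
  have eq: "frac_int \<kappa> a g \<tau> = integral (cbox a T) (\<lambda>s. max 0 (\<tau> - s) powr \<kappa> * g s)"
    if "\<kappa> > 0" "\<tau> \<in> {a<..<T}" for \<kappa> \<tau>
  proof -
    let ?h = "\<lambda>s. max 0 (\<tau> - s) powr \<kappa> * g s"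
    have "?h integrable_on {a..T}"
      using that by (intro integrable_continuous_interval continuous_intros continuous_on_powr'
          continuous_on_subset[OF g]) auto
    then have "integral {a..\<tau>} ?h + integral {\<tau>..T} ?h = integral {a..T} ?h"
      using that by (intro Henstock_Kurzweil_Integration.integral_combine) auto
    moreover have "integral {\<tau>..T} ?h = integral {\<tau>..T} (\<lambda>s. 0)"
      by (rule integral_cong) auto
    moreover have "integral {a..\<tau>} ?h = frac_int \<kappa> a g \<tau>"
      unfolding frac_int_def by (rule integral_cong) (auto simp: max_def)
    ultimately show ?thesis by simp
  qed
  have "((\<lambda>\<tau>. integral (cbox a T) (\<lambda>s. max 0 (\<tau> - s) powr \<sigma> * g s)) has_real_derivative
      integral (cbox a T) (\<lambda>s. \<sigma> * max 0 (t - s) powr (\<sigma> - 1) * g s)) (at t within UNIV)"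
  proof (rule leibniz_rule_field_derivative)
    show "((\<lambda>\<tau>. max 0 (\<tau> - s) powr \<sigma> * g s) has_real_derivative
      \<sigma> * max 0 (\<tau> - s) powr (\<sigma> - 1) * g s) (at \<tau> within UNIV)" for \<tau> s
    proof -
      have "((\<lambda>\<tau>. \<tau> - s) has_real_derivative 1) (at \<tau>)"
        by (auto intro!: derivative_eq_intros)
      from DERIV_chain2[OF has_derivative_max_powr[OF \<sigma>] this] show ?thesis
        by (intro DERIV_cmult_right) simp
    qed
    show "(\<lambda>s. max 0 (\<tau> - s) powr \<sigma> * g s) integrable_on cbox a T" for \<tau>
      using \<sigma> by (intro integrable_continuous continuous_intros continuous_on_powr'
          continuous_on_subset[OF g]) auto
    show "continuous_on (UNIV \<times> cbox a T) (\<lambda>(\<tau>, s). \<sigma> * max 0 (\<tau> - s) powr (\<sigma> - 1) * g s)"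
      using \<sigma> unfolding split_beta
      by (intro continuous_intros continuous_on_powr' continuous_on_compose2[OF g]) auto
  qed auto
  also have "integral (cbox a T) (\<lambda>s. \<sigma> * max 0 (t - s) powr (\<sigma> - 1) * g s) =
      \<sigma> * frac_int (\<sigma> - 1) a g t"
    using eq[of "\<sigma> - 1" t] \<sigma> t by (simp add: T_def mult.assoc)
  finally show ?thesis
    by (rule has_field_derivative_transform_within_open[where S = "{a<..<T}"])
      (use eq \<sigma> t in \<open>auto simp: T_def\<close>)
qed

text \<open>For \<open>\<rho> \<le> 1\<close> the preceding lemma does not apply. Two integrations by
  parts raise the exponent above 1, and one integration by parts is undone after differentiating.\<close>

lemma frac_int_smooth_has_derivative:
  assumes f: "smooth f" and \<rho>: "\<rho> > -1" and t: "a < t"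
  shows "(frac_int \<rho> a f has_real_derivative (t - a) powr \<rho> * f a + frac_int \<rho> a (Dt f) t) (at t)"
proof -
  let ?f1 = "Dt f" and ?f2 = "Dt (Dt f)"
  have s1: "smooth ?f1" and s2: "smooth ?f2" using f smooth_Dt_smooth by blast+
  let ?H = "\<lambda>\<tau>. (\<tau> - a) powr (\<rho> + 1) / (\<rho> + 1) * f a + ((\<tau> - a) powr (\<rho> + 2) / (\<rho> + 2) * ?f1 a +
    frac_int (\<rho> + 2) a ?f2 \<tau> / (\<rho> + 2)) / (\<rho> + 1)"
  have eq: "frac_int \<rho> a f \<tau> = ?H \<tau>" if "a < \<tau>" for \<tau>
    using frac_int_parts(2)[OF f \<rho>, of a \<tau>] frac_int_parts(2)[OF s1, of "\<rho> + 1" a \<tau>] \<rho> that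
    by (simp add: algebra_simps)
  have eq1: "frac_int \<rho> a ?f1 t =
      (t - a) powr (\<rho> + 1) / (\<rho> + 1) * ?f1 a + frac_int (\<rho> + 1) a ?f2 t / (\<rho> + 1)"
    using frac_int_parts(2)[OF s1 \<rho>, of a t] t by simp
  have "(frac_int (\<rho> + 2) a ?f2 has_real_derivative (\<rho> + 2) * frac_int (\<rho> + 2 - 1) a ?f2 t) (at t)"
    by (rule frac_int_has_derivative) (use \<rho> t smooth_continuous_on[OF s2] in auto)
  then have D: "(frac_int (\<rho> + 2) a ?f2 has_real_derivative (\<rho> + 2) * frac_int (\<rho> + 1) a ?f2 t) (at t)"
    by (simp add: algebra_simps)
  have P: "((\<lambda>\<tau>. (\<tau> - a) powr r) has_real_derivative r * (t - a) powr (r - 1)) (at t)" for r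
    using t by (auto intro!: derivative_eq_intros)
  have "(?H has_real_derivative (\<rho> + 1) * (t - a) powr (\<rho> + 1 - 1) / (\<rho> + 1) * f a +
      ((\<rho> + 2) * (t - a) powr (\<rho> + 2 - 1) / (\<rho> + 2) * ?f1 a +
        (\<rho> + 2) * frac_int (\<rho> + 1) a ?f2 t / (\<rho> + 2)) / (\<rho> + 1)) (at t)"
    by (intro DERIV_add DERIV_cdivide DERIV_cmult_right P D)
  also have "(\<rho> + 1) * (t - a) powr (\<rho> + 1 - 1) / (\<rho> + 1) * f a +
      ((\<rho> + 2) * (t - a) powr (\<rho> + 2 - 1) / (\<rho> + 2) * ?f1 a +
        (\<rho> + 2) * frac_int (\<rho> + 1) a ?f2 t / (\<rho> + 2)) / (\<rho> + 1)
      = (t - a) powr \<rho> * f a + frac_int \<rho> a ?f1 t"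
  proof -
    have "\<rho> + 1 \<noteq> 0" "\<rho> + 2 \<noteq> 0" "\<rho> + 2 - 1 = \<rho> + 1" using \<rho> by auto
    then show ?thesis by (simp add: eq1 add_divide_distrib add.commute)
  qed
  finally show ?thesis
    by (rule has_field_derivative_transform_within_open[where S = "{a<..}"]) (use eq t in auto)
qed

definition powr_deriv :: "real \<Rightarrow> real \<Rightarrow> nat \<Rightarrow> real \<Rightarrow> real" where
  "powr_deriv \<rho> a j t = (\<Prod>i<j. \<rho> - real i) * (t - a) powr (\<rho> - real j)"

lemma powr_deriv_has_derivative:
  assumes "a < t"
  shows "(powr_deriv \<rho> a j has_real_derivative powr_deriv \<rho> a (Suc j) t) (at t)"
  unfolding powr_deriv_def using assms
  by (auto intro!: derivative_eq_intros simp: algebra_simps)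

text \<open>The \<open>k\<close>-th derivative of \<^const>\<open>frac_int\<close>: all derivatives fall on \<open>f\<close>, at the price of boundary
  terms at \<open>a\<close>.\<close>

definition frac_int_deriv :: "real \<Rightarrow> real \<Rightarrow> (real \<Rightarrow> real) \<Rightarrow> nat \<Rightarrow> real \<Rightarrow> real" where
  "frac_int_deriv \<rho> a f k t =
     frac_int \<rho> a ((Dt ^^ k) f) t + (\<Sum>i<k. powr_deriv \<rho> a (k - 1 - i) t * (Dt ^^ i) f a)"

lemma frac_int_deriv_has_derivative:
  assumes f: "smooth f" and \<rho>: "\<rho> > -1" and t: "a < t"
  shows "(frac_int_deriv \<rho> a f k has_real_derivative frac_int_deriv \<rho> a f (Suc k) t) (at t)"
proof -
  have "((\<lambda>t. \<Sum>i<k. powr_deriv \<rho> a (k - 1 - i) t * (Dt ^^ i) f a) has_real_derivative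
     (\<Sum>i<k. powr_deriv \<rho> a (Suc (k - 1 - i)) t * (Dt ^^ i) f a)) (at t)"
    by (intro DERIV_sum DERIV_cmult_right powr_deriv_has_derivative t)
  from DERIV_add[OF frac_int_smooth_has_derivative[OF smooth_Dt_funpow[OF f, of k] \<rho> t] this]
  have "(frac_int_deriv \<rho> a f k has_real_derivative
    (t - a) powr \<rho> * (Dt ^^ k) f a + frac_int \<rho> a (Dt ((Dt ^^ k) f)) t +
     (\<Sum>i<k. powr_deriv \<rho> a (Suc (k - 1 - i)) t * (Dt ^^ i) f a)) (at t)"
    by (simp add: frac_int_deriv_def[abs_def])
  moreover have "(\<Sum>i<k. powr_deriv \<rho> a (Suc (k - 1 - i)) t * (Dt ^^ i) f a) =
      (\<Sum>i<k. powr_deriv \<rho> a (k - i) t * (Dt ^^ i) f a)"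
    by (intro sum.cong) (auto simp: Suc_diff_Suc)
  ultimately show ?thesis
    by (simp add: frac_int_deriv_def powr_deriv_def algebra_simps)
qed

lemma left_integral_eq_frac_int:
  "left_integral a \<alpha> f = frac_int (real (frac_order \<alpha>) - \<alpha> - 1) a f"
  by (auto simp: left_integral_def frac_int_def left_kernel_integrand_def[abs_def])

lemma frac_order_gt: "\<alpha> > 0 \<Longrightarrow> real (frac_order \<alpha>) - \<alpha> - 1 > -1"
  using frac_order_iff[of \<alpha> "frac_order \<alpha>"] by simp

lemma left_RL_smooth:
  fixes f :: "real \<Rightarrow> real"
  assumes f: "smooth f" and \<alpha>: "\<alpha> > 0"
  shows "left_RL_exists a b \<alpha> f"
    and "t \<in> {a<..<b} \<Longrightarrow> left_RL a \<alpha> f t = 1 / Gamma (real (frac_order \<alpha>) - \<alpha>) *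
        frac_int_deriv (real (frac_order \<alpha>) - \<alpha> - 1) a f (frac_order \<alpha>) t"
proof -
  let ?\<rho> = "real (frac_order \<alpha>) - \<alpha> - 1"
  have \<rho>: "?\<rho> > -1" by (rule frac_order_gt[OF \<alpha>])
  have D: "(frac_int_deriv ?\<rho> a f k has_vector_derivative frac_int_deriv ?\<rho> a f (Suc k) t) (at t)"
    if "k < frac_order \<alpha>" "t \<in> {a<..<b}" for k t
    using frac_int_deriv_has_derivative[OF f \<rho>] that
    by (simp add: has_real_derivative_iff_has_vector_derivative)
  note * = n_times_differentiableI[where G = "frac_int_deriv ?\<rho> a f" and f = "left_integral a \<alpha> f", OF D]
  show "left_RL_exists a b \<alpha> f"
    unfolding left_RL_exists_def
  proof (intro conjI ballI)
    show "left_kernel_integrand \<alpha> f t integrable_on {a..t}" if "t \<in> {a<..<b}" for t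
      using frac_int_parts(1)[OF f \<rho>, of a t] that by (auto simp: left_kernel_integrand_def[abs_def])
    show "n_times_differentiable_on_interval (frac_order \<alpha>) (left_integral a \<alpha> f) a b"
      by (rule *(1)) (auto simp: left_integral_eq_frac_int frac_int_deriv_def)
  qed
  assume t: "t \<in> {a<..<b}"
  have "(Dt ^^ frac_order \<alpha>) (left_integral a \<alpha> f) t = frac_int_deriv ?\<rho> a f (frac_order \<alpha>) t"
    by (rule *(2)[OF _ _ _ order_refl t]) (auto simp: left_integral_eq_frac_int frac_int_deriv_def)
  then show "left_RL a \<alpha> f t = 1 / Gamma (real (frac_order \<alpha>) - \<alpha>) *
        frac_int_deriv ?\<rho> a f (frac_order \<alpha>) t"
    by (simp add: left_RL_def)
qed

text \<open>One integration by parts makes the kernel continuous; differentiation under the integral sign and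
  the symmetry of second derivatives do the rest.\<close>

lemma frac_int_parameter_derivative:
  assumes F: "smooth F" and \<rho>: "\<rho> > -1" and t: "a \<le> t"
  shows "((\<lambda>s. frac_int \<rho> a (\<lambda>\<tau>. F (s, \<tau>)) t) has_real_derivative
      frac_int \<rho> a (\<lambda>\<tau>. pd1 F (s, \<tau>)) t) (at s)"
proof -
  have eq: "frac_int \<rho> a (\<lambda>\<tau>. G (s, \<tau>)) t = (t - a) powr (\<rho> + 1) / (\<rho> + 1) * G (s, a) +
      frac_int (\<rho> + 1) a (\<lambda>\<tau>. pd2 G (s, \<tau>)) t / (\<rho> + 1)" if "smooth G" for G s
    using frac_int_parts(2)[OF smooth_slice[OF that] \<rho> t] by (simp add: Dt_slice[OF that])
  have "((\<lambda>s. integral (cbox a t) (\<lambda>\<tau>. (t - \<tau>) powr (\<rho> + 1) * pd2 F (s, \<tau>))) has_real_derivative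
      integral (cbox a t) (\<lambda>\<tau>. (t - \<tau>) powr (\<rho> + 1) * pd1 (pd2 F) (s, \<tau>))) (at s within UNIV)"
  proof (rule leibniz_rule_field_derivative)
    show "((\<lambda>s. (t - \<tau>) powr (\<rho> + 1) * pd2 F (s, \<tau>)) has_real_derivative
        (t - \<tau>) powr (\<rho> + 1) * pd1 (pd2 F) (s, \<tau>)) (at s within UNIV)" for s \<tau>
      using has_pd1[OF smooth_pd2[OF F]] by (intro DERIV_cmult) auto
    show "(\<lambda>\<tau>. (t - \<tau>) powr (\<rho> + 1) * pd2 F (s, \<tau>)) integrable_on cbox a t" for s
      using \<rho> by (intro integrable_continuous continuous_intros continuous_on_powr'
          continuous_on_compose2[OF smooth_continuous_on[OF smooth_pd2[OF F]]]) auto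
    show "continuous_on (UNIV \<times> cbox a t) (\<lambda>(s, \<tau>). (t - \<tau>) powr (\<rho> + 1) * pd1 (pd2 F) (s, \<tau>))"
      using \<rho> unfolding split_beta
      by (intro continuous_intros continuous_on_powr'
          continuous_on_compose2[OF smooth_continuous_on[OF smooth_pd1[OF smooth_pd2[OF F]]]]) auto
  qed auto
  then have "((\<lambda>s. frac_int (\<rho> + 1) a (\<lambda>\<tau>. pd2 F (s, \<tau>)) t) has_real_derivative
      frac_int (\<rho> + 1) a (\<lambda>\<tau>. pd2 (pd1 F) (s, \<tau>)) t) (at s)"
    by (simp add: frac_int_def pd1_pd2_commute[OF F])
  then have "((\<lambda>s. (t - a) powr (\<rho> + 1) / (\<rho> + 1) * F (s, a) +
      frac_int (\<rho> + 1) a (\<lambda>\<tau>. pd2 F (s, \<tau>)) t / (\<rho> + 1)) has_real_derivative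
      (t - a) powr (\<rho> + 1) / (\<rho> + 1) * pd1 F (s, a) +
      frac_int (\<rho> + 1) a (\<lambda>\<tau>. pd2 (pd1 F) (s, \<tau>)) t / (\<rho> + 1)) (at s)"
    by (intro DERIV_add DERIV_cdivide DERIV_cmult has_pd1 F)
  then show ?thesis by (simp add: eq[OF F] eq[OF smooth_pd1[OF F]])
qed

text \<open>The exchange of \<open>d/ds\<close> with the fractional derivative, for families of curves that are jointly smooth.\<close>

lemma left_RL_parameter_derivative:
  assumes F: "smooth F" and \<alpha>: "\<alpha> > 0" and t: "a < t"
  shows "((\<lambda>s. left_RL a \<alpha> (\<lambda>\<tau>. F (s, \<tau>)) t) has_real_derivative
      left_RL a \<alpha> (\<lambda>\<tau>. pd1 F (s, \<tau>)) t) (at s)"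
proof -
  let ?\<rho> = "real (frac_order \<alpha>) - \<alpha> - 1" and ?n = "frac_order \<alpha>"
  have eq: "left_RL a \<alpha> (\<lambda>\<tau>. G (s, \<tau>)) t = 1 / Gamma (real ?n - \<alpha>) *
      (frac_int ?\<rho> a (\<lambda>\<tau>. (pd2 ^^ ?n) G (s, \<tau>)) t +
      (\<Sum>i<?n. powr_deriv ?\<rho> a (?n - 1 - i) t * (pd2 ^^ i) G (s, a)))" if "smooth G" for G s
    using left_RL_smooth(2)[OF smooth_slice[OF that] \<alpha>, of t a "t + 1"] t
    by (simp add: frac_int_deriv_def Dt_funpow_slice[OF that])
  have "((\<lambda>s. 1 / Gamma (real ?n - \<alpha>) *
      (frac_int ?\<rho> a (\<lambda>\<tau>. (pd2 ^^ ?n) F (s, \<tau>)) t +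
      (\<Sum>i<?n. powr_deriv ?\<rho> a (?n - 1 - i) t * (pd2 ^^ i) F (s, a)))) has_real_derivative
      1 / Gamma (real ?n - \<alpha>) *
      (frac_int ?\<rho> a (\<lambda>\<tau>. pd1 ((pd2 ^^ ?n) F) (s, \<tau>)) t +
      (\<Sum>i<?n. powr_deriv ?\<rho> a (?n - 1 - i) t * pd1 ((pd2 ^^ i) F) (s, a)))) (at s)"
    by (intro DERIV_cmult DERIV_add DERIV_sum has_pd1 smooth_pd2_funpow[OF F]
        frac_int_parameter_derivative frac_order_gt[OF \<alpha>] less_imp_le[OF t])
  then show ?thesis
    by (simp only: eq[OF F] eq[OF smooth_pd1[OF F]] pd1_pd2_funpow_commute[OF F])
qed


section \<open>Bump functions\<close>

text \<open>The powers of \<open>x\<close> in the denominator make this family closed under differentiation, up to linear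
  combinations, so that all its members are proved smooth in one induction.\<close>

definition flat :: "nat \<Rightarrow> real \<Rightarrow> real" where
  "flat j x = (if x \<le> 0 then 0 else exp (- 1 / x) / x ^ j)"

lemma flat_tendsto_0: "(flat j \<longlongrightarrow> 0) (at 0)"
proof -
  have "((\<lambda>x. inverse x ^ j / exp (inverse x)) \<longlongrightarrow> 0) (at_right (0::real))"
    by (rule filterlim_compose[OF tendsto_power_div_exp_0 filterlim_inverse_at_top_right])
  moreover have "\<forall>\<^sub>F x in at_right 0. inverse x ^ j / exp (inverse x) = flat j x"
    by (rule eventually_mono[OF eventually_at_right_less[of 0]])
      (auto simp: flat_def field_simps exp_minus)
  ultimately have r: "(flat j \<longlongrightarrow> 0) (at_right 0)"
    using tendsto_cong by fast
  have "\<forall>\<^sub>F x in at_left 0. 0 = flat j x"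
    by (simp add: eventually_at_filter flat_def)
  then have "(flat j \<longlongrightarrow> 0) (at_left 0)"
    using tendsto_cong tendsto_const by fast
  with r show ?thesis using filterlim_split_at by blast
qed

lemma flat_has_derivative:
  "(flat j has_real_derivative flat (j + 2) x - real j * flat (j + 1) x) (at x)"
proof -
  consider "x > 0" | "x < 0" | "x = 0" by linarith
  then show ?thesis
  proof cases
    case 1
    have "((\<lambda>x. exp (- 1 / x) / x ^ j) has_real_derivative
        exp (- 1 / x) / x ^ (j + 2) - real j * (exp (- 1 / x) / x ^ (j + 1))) (at x)"
    proof (rule DERIV_cong[OF DERIV_divide])
      show "((\<lambda>x. exp (- 1 / x)) has_real_derivative exp (- 1 / x) / x ^ 2) (at x)"
        using 1 by (auto intro!: derivative_eq_intros simp: power2_eq_square)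
      show "((\<lambda>x. x ^ j) has_real_derivative real j * x ^ j / x) (at x)"
        using DERIV_pow[of j x] 1 by (cases j) auto
    qed (use 1 in \<open>auto simp: field_simps power2_eq_square\<close>)
    then have "(flat j has_real_derivative
        exp (- 1 / x) / x ^ (j + 2) - real j * (exp (- 1 / x) / x ^ (j + 1))) (at x)"
      by (rule has_field_derivative_transform_within_open[where S = "{0<..}"])
        (use 1 in \<open>auto simp: flat_def\<close>)
    with 1 show ?thesis by (simp add: flat_def)
  next
    case 2
    have "(flat j has_real_derivative 0) (at x)"
      by (rule has_field_derivative_transform_within_open[where S = "{..<0}" and f = "\<lambda>_. 0"])
        (use 2 in \<open>auto simp: flat_def\<close>)
    with 2 show ?thesis by (simp add: flat_def)
  next
    case 3
    have "(\<lambda>h. (flat j (0 + h) - flat j 0) / h) = flat (j + 1)"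
      by (auto simp: flat_def)
    with 3 flat_tendsto_0[of "j + 1"] show ?thesis
      by (simp add: DERIV_def flat_def)
  qed
qed

lemma smooth_flat: "smooth (flat j)"
proof -
  have "Ck k (flat j)" for k
  proof (induction k arbitrary: j)
    case 0
    show ?case
      using flat_has_derivative by (auto simp: continuous_on_eq_continuous_at intro: DERIV_isCont)
  next
    case (Suc k)
    show ?case
    proof (rule Ck_SucI)
      show "(flat j has_derivative (\<lambda>h. (flat (j + 2) x - real j * flat (j + 1) x) * h)) (at x)" for x
        using flat_has_derivative[of j x] by (simp add: has_field_derivative_def)
      show "Ck k (\<lambda>x. (flat (j + 2) x - real j * flat (j + 1) x) * e)" for e
        using Ck_add[OF Suc[of "j + 2"] Ck_scaleR[OF Ck_const[of k "- real j"] Suc[of "j + 1"]]]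
          Ck_bounded_linear[OF bounded_linear_mult_left[of e]] by fastforce
    qed
  qed
  then show ?thesis by (simp add: smooth_def)
qed

definition bump :: "real \<Rightarrow> real \<Rightarrow> real \<Rightarrow> real" where
  "bump c d x = flat 0 (x - c) * flat 0 (d - x)"

lemma smooth_bump: "smooth (bump c d)"
  unfolding bump_def[abs_def]
  by (intro smooth_mult smooth_compose[OF smooth_flat] smooth_diff smooth_ident smooth_const)

lemma bump_nonneg: "bump c d x \<ge> 0"
  by (simp add: bump_def flat_def)

lemma bump_eq_0_iff: "bump c d x = 0 \<longleftrightarrow> x \<le> c \<or> d \<le> x"
  by (simp add: bump_def flat_def)

lemma integral_bump_pos:
  assumes "c < d"
  shows "integral {c..d} (bump c d) > 0"
proof -
  have c: "continuous_on {c..d} (bump c d)" by (rule smooth_continuous_on[OF smooth_bump])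
  have "integral {c..d} (bump c d) \<ge> 0"
    by (intro integral_nonneg integrable_continuous_interval c bump_nonneg)
  moreover have "integral {c..d} (bump c d) \<noteq> 0"
  proof
    assume "integral {c..d} (bump c d) = 0"
    then have "(bump c d has_integral 0) (cbox c d)"
      using integrable_integral[OF integrable_continuous_interval[OF c]] by simp
    then have "bump c d ((c + d) / 2) = 0"
      using has_integral_0_cbox_imp_0[of c d "bump c d" "(c + d) / 2"] c bump_nonneg assms by auto
    then show False using assms by (simp add: bump_eq_0_iff)
  qed
  ultimately show ?thesis by simp
qed

text \<open>A smooth step, the normalised primitive of a bump.\<close>

lemma smooth_step:
  fixes c d :: real
  assumes "c < d"
  obtains S :: "real \<Rightarrow> real" where "smooth S" "\<And>x. x \<le> c \<Longrightarrow> S x = 0" "\<And>x. d \<le> x \<Longrightarrow> S x = 1"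
proof -
  define I where "I x = integral {c - 1..x} (bump c d)" for x
  have z: "I x = 0" if "x \<le> c" for x
  proof -
    have "I x = integral {c - 1..x} (\<lambda>_. 0)"
      unfolding I_def by (rule integral_cong) (use that in \<open>auto simp: bump_eq_0_iff\<close>)
    then show ?thesis by simp
  qed
  have D: "(I has_real_derivative bump c d x) (at x)" for x
  proof (cases "x < c")
    case True
    have "(I has_real_derivative 0) (at x)"
      by (rule has_field_derivative_transform_within_open[where S = "{..<c}" and f = "\<lambda>_. 0"])
        (use True z in auto)
    with True show ?thesis by (simp add: bump_eq_0_iff[THEN iffD2])
  next
    case False
    have "(I has_real_derivative bump c d x) (at x within {c - 1..x + 1})"
      unfolding I_def
      by (rule integral_has_real_derivative[OF smooth_continuous_on[OF smooth_bump]])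
        (use False in auto)
    with False show ?thesis by (simp add: at_within_Icc_at)
  qed
  have I: "smooth I"
  proof (rule smoothI_derivative)
    show "(I has_derivative (\<lambda>h. bump c d x * h)) (at x)" for x
      using D by (simp add: has_field_derivative_def)
    show "smooth (\<lambda>x. bump c d x * e)" for e
      by (intro smooth_mult smooth_bump smooth_const)
  qed
  have int: "bump c d integrable_on {u..v}" for u v
    by (intro integrable_continuous_interval smooth_continuous_on[OF smooth_bump])
  have one: "I x = integral {c..d} (bump c d)" if "d \<le> x" for x
  proof -
    have "I x = I c + integral {c..x} (bump c d)"
      unfolding I_def
      by (rule Henstock_Kurzweil_Integration.integral_combine[symmetric, OF _ _ int])
        (use that assms in auto)
    also have "integral {c..x} (bump c d) = integral {c..d} (bump c d) + integral {d..x} (bump c d)"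
      by (rule Henstock_Kurzweil_Integration.integral_combine[symmetric, OF _ _ int])
        (use that assms in auto)
    also have "integral {d..x} (bump c d) = integral {d..x} (\<lambda>_. 0)"
      by (rule integral_cong) (auto simp: bump_eq_0_iff)
    finally show ?thesis by (simp add: z)
  qed
  let ?S = "\<lambda>x. inverse (integral {c..d} (bump c d)) * I x"
  have "smooth ?S" by (intro smooth_mult smooth_const I)
  then show thesis
    using integral_bump_pos[OF assms] by (intro that[of ?S]) (auto simp: z one)
qed

text \<open>A bump \<open>h\<close> together with a cutoff \<open>p\<close> equal to 1 on the support of \<open>h\<close>: multiplication by \<open>p\<close> allows
  a curve to be given a constant value wherever \<open>h\<close> is active.\<close>

lemma smooth_plateau:
  fixes c d :: real
  assumes "c < d"
  obtains p h :: "real \<Rightarrow> real" where "smooth p" "smooth h" "\<And>x. p x * h x = h x"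
    "\<And>x. x \<notin> {c..d} \<Longrightarrow> p x = 0" "\<And>x. x \<notin> {c..d} \<Longrightarrow> h x = 0"
    "\<And>x. h x \<ge> 0" "\<exists>x. h x \<noteq> 0"
proof -
  define c' d' where "c' = (3 * c + d) / 4" and "d' = (c + 3 * d) / 4"
  have cd: "c < c'" "c' < d'" "d' < d" using assms by (auto simp: c'_def d'_def field_simps)
  obtain S where S: "smooth S" "\<And>x. x \<le> c \<Longrightarrow> S x = (0::real)" "\<And>x. c' \<le> x \<Longrightarrow> S x = 1"
    using smooth_step[OF cd(1)] by blast
  obtain T where T: "smooth T" "\<And>x. x \<le> d' \<Longrightarrow> T x = (0::real)" "\<And>x. d \<le> x \<Longrightarrow> T x = 1"
    using smooth_step[OF cd(3)] by blast
  let ?p = "\<lambda>x. S x * (1 - T x)" and ?h = "bump c' d'"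
  have "smooth ?p" by (intro smooth_mult smooth_diff smooth_const S T)
  moreover have "?p x * ?h x = ?h x" for x
  proof (cases "?h x = 0")
    case False
    then have "c' < x" "x < d'" by (auto simp: bump_eq_0_iff)
    then show ?thesis by (simp add: S T)
  qed simp
  moreover have "?p x = 0" if "x \<notin> {c..d}" for x
    using that S(2)[of x] T(3)[of x] by auto
  moreover have "?h x = 0" if "x \<notin> {c..d}" for x
    using that cd by (auto simp: bump_eq_0_iff)
  moreover have "?h ((c' + d') / 2) \<noteq> 0"
    using cd by (auto simp: bump_eq_0_iff)
  ultimately show thesis
    using smooth_bump bump_nonneg by (intro that[of ?p ?h]) blast+
qed


section \<open>Non-integer order: the memory of the derivative\<close>

lemma Dt_funpow_eq_0_open:
  assumes "open S" "\<And>x. x \<in> S \<Longrightarrow> f x = (0::real)" "x \<in> S"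
  shows "(Dt ^^ k) f x = 0"
proof -
  have "(Dt ^^ k) (\<lambda>_. 0::real) = (\<lambda>_. 0)"
    by (induction k) (auto simp: Dt_def[abs_def])
  moreover have "(Dt ^^ k) f x = (Dt ^^ k) (\<lambda>_. 0) x"
    by (rule Dt_funpow_cong_open[OF assms(1) _ assms(3)]) (use assms in auto)
  ultimately show ?thesis by simp
qed

text \<open>Away from the singularity of the kernel, integration by parts may lower the exponent to any real value.\<close>

lemma frac_int_derivative_of_bump:
  assumes g: "smooth g" and cd: "a < c" "d < t" and z: "\<And>x. x \<notin> {c..d} \<Longrightarrow> g x = (0::real)"
  shows "frac_int \<kappa> a (Dt g) t = \<kappa> * frac_int (\<kappa> - 1) a g t"
proof (cases "c \<le> d")
  case False
  then have "g = (\<lambda>_. 0)" using z by auto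
  then show ?thesis by (simp add: frac_int_def Dt_def[abs_def])
next
  case True
  define e where "e = (d + t) / 2"
  have e: "d < e" "e < t" using cd by (auto simp: e_def)
  have zD: "Dt g x = 0" if "x \<notin> {c..d}" for x
    using Dt_funpow_eq_0_open[of "- {c..d}" g x 1] z that by (auto simp: open_Compl)
  have eq: "integral {a..t} (\<lambda>s. (t - s) powr r * u s) = integral {a..e} (\<lambda>s. (t - s) powr r * u s)"
    if "smooth u" "\<And>x. x \<notin> {c..d} \<Longrightarrow> u x = 0" for u r
  proof -
    have "(\<lambda>s. (t - s) powr r * u s) integrable_on {a..e}"
      using e by (intro integrable_continuous_interval continuous_intros continuous_on_powr
          smooth_continuous_on[OF that(1)]) auto
    from integrable_integral[OF this]
    have "((\<lambda>s. (t - s) powr r * u s) has_integral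
        integral {a..e} (\<lambda>s. (t - s) powr r * u s)) {a..t}"
    proof (rule has_integral_on_superset)
      show "(t - x) powr r * u x = 0" if "x \<notin> {a..e}" for x
        using that e cd \<open>\<And>x. x \<notin> {c..d} \<Longrightarrow> u x = 0\<close>[of x] by auto
    qed (use e in auto)
    then show ?thesis by (rule integral_unique)
  qed
  have "((\<lambda>s. (t - s) powr \<kappa> * Dt g s - \<kappa> * ((t - s) powr (\<kappa> - 1) * g s)) has_integral
      (t - e) powr \<kappa> * g e - (t - a) powr \<kappa> * g a) {a..e}"
  proof (rule fundamental_theorem_of_calculus)
    show "a \<le> e" using cd True e by simp
    fix s assume s: "s \<in> {a..e}"
    have Dg: "(g has_real_derivative Dt g s) (at s)"
      using smooth_has_Dt[OF g] by (simp add: has_real_derivative_iff_has_vector_derivative)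
    have "((\<lambda>s. (t - s) powr \<kappa> * g s) has_real_derivative
        (t - s) powr \<kappa> * Dt g s - \<kappa> * ((t - s) powr (\<kappa> - 1) * g s)) (at s)"
      using s e by (auto intro!: derivative_eq_intros Dg)
    then show "((\<lambda>s. (t - s) powr \<kappa> * g s) has_vector_derivative
        (t - s) powr \<kappa> * Dt g s - \<kappa> * ((t - s) powr (\<kappa> - 1) * g s)) (at s within {a..e})"
      by (simp add: has_real_derivative_iff_has_vector_derivative has_vector_derivative_at_within)
  qed
  moreover have "g e = 0" "g a = 0" using z e cd by auto
  ultimately have "integral {a..e} (\<lambda>s. (t - s) powr \<kappa> * Dt g s - \<kappa> * ((t - s) powr (\<kappa> - 1) * g s)) = 0"
    by (simp add: integral_unique)
  moreover have "(\<lambda>s. (t - s) powr \<kappa> * Dt g s) integrable_on {a..e}"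
    "(\<lambda>s. (t - s) powr (\<kappa> - 1) * g s) integrable_on {a..e}"
    using e by (auto intro!: integrable_continuous_interval continuous_intros continuous_on_powr
        smooth_continuous_on[OF g] smooth_continuous_on[OF smooth_Dt_smooth[OF g]])
  ultimately have "integral {a..e} (\<lambda>s. (t - s) powr \<kappa> * Dt g s) =
      \<kappa> * integral {a..e} (\<lambda>s. (t - s) powr (\<kappa> - 1) * g s)"
    by (simp add: integral_diff integrable_on_mult_right)
  then show ?thesis
    using eq[of "Dt g" \<kappa>] eq[of g "\<kappa> - 1"] smooth_Dt_smooth[OF g] g zD z
    by (simp add: frac_int_def)
qed

lemma frac_int_iterated_derivative_of_bump:
  assumes g: "smooth g" and cd: "a < c" "d < t" and z: "\<And>x. x \<notin> {c..d} \<Longrightarrow> g x = (0::real)"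
  shows "frac_int \<kappa> a ((Dt ^^ n) g) t = (\<Prod>i<n. \<kappa> - real i) * frac_int (\<kappa> - real n) a g t"
proof (induction n arbitrary: \<kappa>)
  case (Suc n)
  have z': "(Dt ^^ n) g x = 0" if "x \<notin> {c..d}" for x
    by (rule Dt_funpow_eq_0_open[of "- {c..d}"]) (use that z in auto)
  have "frac_int \<kappa> a ((Dt ^^ Suc n) g) t = \<kappa> * frac_int (\<kappa> - 1) a ((Dt ^^ n) g) t"
    using frac_int_derivative_of_bump[OF smooth_Dt_funpow[OF g] cd z'] by simp
  also have "\<dots> = \<kappa> * ((\<Prod>i<n. \<kappa> - 1 - real i) * frac_int (\<kappa> - 1 - real n) a g t)"
    by (simp add: Suc)
  also have "\<dots> = (\<Prod>i<Suc n. \<kappa> - real i) * frac_int (\<kappa> - real (Suc n)) a g t"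
    by (subst prod.lessThan_Suc_shift) (simp add: algebra_simps)
  finally show ?case .
qed simp

text \<open>For \<open>\<alpha>\<close> not an integer, integration by parts turns the derivative at \<open>t\<close> of a function
  supported strictly before \<open>t\<close> into a non-zero multiple of its integral against the positive
  kernel \<open>(t - s) powr (- \<alpha> - 1)\<close>: the derivative at \<open>t\<close> sees the past.\<close>

lemma left_RL_bump_nonzero:
  assumes \<alpha>: "\<alpha> > 0" "\<nexists>m. \<alpha> = real m" and h: "smooth h" and cd: "a < c" "d < t"
    and z: "\<And>x. x \<notin> {c..d} \<Longrightarrow> h x = (0::real)" and pos: "\<And>x. h x \<ge> 0" "\<exists>x. h x \<noteq> 0"
  shows "left_RL a \<alpha> h t \<noteq> 0"
proof -
  let ?n = "frac_order \<alpha>"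
  let ?\<rho> = "real ?n - \<alpha> - 1"
  obtain x0 where x0: "h x0 \<noteq> 0" using pos by blast
  have x0cd: "x0 \<in> {c..d}" using z x0 by blast
  have at: "a < t" using x0cd cd by auto
  have "(Dt ^^ i) h a = 0" for i
    by (rule Dt_funpow_eq_0_open[of "- {c..d}"]) (use z cd in auto)
  moreover have "frac_int ?\<rho> a ((Dt ^^ ?n) h) t = (\<Prod>i<?n. ?\<rho> - real i) * frac_int (?\<rho> - real ?n) a h t"
    by (rule frac_int_iterated_derivative_of_bump[OF h cd z])
  ultimately have eq: "left_RL a \<alpha> h t = 1 / Gamma (real ?n - \<alpha>) *
      ((\<Prod>i<?n. ?\<rho> - real i) * frac_int (?\<rho> - real ?n) a h t)"
    using left_RL_smooth(2)[OF h \<alpha>(1), of t a "t + 1"] at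
    by (simp only: frac_int_deriv_def) simp
  have "Gamma (real ?n - \<alpha>) \<noteq> 0"
  proof -
    have "real ?n - \<alpha> > 0" using frac_order_gt[OF \<alpha>(1)] by simp
    from Gamma_real_pos[OF this] show ?thesis by linarith
  qed
  moreover have "(\<Prod>i<?n. ?\<rho> - real i) \<noteq> 0"
  proof -
    have "?\<rho> - real i \<noteq> 0" if "i < ?n" for i
    proof
      assume "?\<rho> - real i = 0"
      then have "\<alpha> = real (?n - 1 - i)" using that by (simp add: of_nat_diff)
      then show False using \<alpha>(2) by blast
    qed
    then show ?thesis by simp
  qed
  moreover have "frac_int (?\<rho> - real ?n) a h t \<noteq> 0"
  proof
    let ?r = "?\<rho> - real ?n"
    let ?k = "\<lambda>s. (t - s) powr ?r * h s"
    assume 0: "frac_int ?r a h t = 0"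
    have c: "continuous_on {a..d} ?k"
      using cd by (intro continuous_intros continuous_on_powr smooth_continuous_on[OF h]) auto
    have i: "(?k has_integral integral {a..d} ?k) {a..d}"
      by (intro integrable_integral integrable_continuous_interval c)
    then have "(?k has_integral integral {a..d} ?k) {a..t}"
      by (rule has_integral_on_superset) (use cd z in auto)
    with 0 have "integral {a..d} ?k = 0"
      by (simp add: frac_int_def integral_unique)
    with i have "(?k has_integral 0) (cbox a d)" by simp
    then have "?k x0 = 0"
      using has_integral_0_cbox_imp_0[of a d ?k x0] c pos(1) x0cd cd by auto
    with x0 x0cd cd show False by auto
  qed
  ultimately show ?thesis by (simp add: eq)
qed

lemma left_RL_eq_0:
  fixes f :: "real \<Rightarrow> real"
  assumes "a < t" "t < e" "\<And>s. s \<le> e \<Longrightarrow> f s = 0"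
  shows "left_RL a \<alpha> f t = 0"
proof -
  have "left_integral a \<alpha> f \<tau> = 0" if "\<tau> \<in> {..<e}" for \<tau>
  proof -
    have "left_integral a \<alpha> f \<tau> = integral {a..\<tau>} (\<lambda>_. 0)"
      unfolding left_integral_def left_kernel_integrand_def
      by (rule integral_cong) (use assms that in auto)
    then show ?thesis by simp
  qed
  then have "(Dt ^^ frac_order \<alpha>) (left_integral a \<alpha> f) t = 0"
    by (intro Dt_funpow_eq_0_open[of "{..<e}"]) (use assms in auto)
  then show ?thesis by (simp add: left_RL_def)
qed


section \<open>Integer order: jets\<close>

text \<open>The relation \<open>g(s) = o(|s - t|^m)\<close>, with the neighbourhood including \<open>t\<close>; for \<open>m > 0\<close> it thus
  forces \<open>g t = 0\<close>. It replaces jets in all arguments about compositions: a Lipschitz map preserves it,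
  whereas the jet of a composition would need the higher chain rule.\<close>

definition vanishes_to_order :: "nat \<Rightarrow> real \<Rightarrow> (real \<Rightarrow> 'v::real_normed_vector) \<Rightarrow> bool" where
  "vanishes_to_order m t g \<longleftrightarrow> (\<forall>\<epsilon>>0. \<forall>\<^sub>F s in nhds t. norm (g s) \<le> \<epsilon> * \<bar>s - t\<bar> ^ m)"

lemma vanishes_to_order_mono:
  assumes "vanishes_to_order m t g" "k \<le> m"
  shows "vanishes_to_order k t g"
  unfolding vanishes_to_order_def
proof (intro allI impI)
  fix \<epsilon> :: real assume \<epsilon>: "\<epsilon> > 0"
  have "\<forall>\<^sub>F s in nhds t. s \<in> ball t 1"
    by (intro eventually_nhds_in_open) auto
  moreover have "\<forall>\<^sub>F s in nhds t. norm (g s) \<le> \<epsilon> * \<bar>s - t\<bar> ^ m"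
    using assms \<epsilon> by (auto simp: vanishes_to_order_def)
  ultimately show "\<forall>\<^sub>F s in nhds t. norm (g s) \<le> \<epsilon> * \<bar>s - t\<bar> ^ k"
  proof eventually_elim
    case (elim s)
    have "\<bar>s - t\<bar> ^ m \<le> \<bar>s - t\<bar> ^ k"
      using elim(1) assms(2) by (intro power_decreasing) (auto simp: dist_real_def)
    from mult_left_mono[OF this, of \<epsilon>] show ?case using elim(2) \<epsilon> by linarith
  qed
qed

lemma vanishes_to_order_at:
  assumes "vanishes_to_order m t g" "m > 0"
  shows "g t = 0"
proof -
  have "\<forall>\<^sub>F s in nhds t. norm (g s) \<le> 1 * \<bar>s - t\<bar> ^ m"
    using assms(1) zero_less_one unfolding vanishes_to_order_def by blast
  then have "norm (g t) \<le> 1 * \<bar>t - t\<bar> ^ m" by (rule eventually_nhds_x_imp_x)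
  then show ?thesis using assms(2) by (simp add: zero_power)
qed

lemma vanishes_to_order_add:
  assumes "vanishes_to_order m t f" "vanishes_to_order m t g"
  shows "vanishes_to_order m t (\<lambda>s. f s + g s)"
  unfolding vanishes_to_order_def
proof (intro allI impI)
  fix \<epsilon> :: real assume "\<epsilon> > 0"
  then have "\<epsilon> / 2 > 0" by simp
  then have "\<forall>\<^sub>F s in nhds t. norm (f s) \<le> \<epsilon> / 2 * \<bar>s - t\<bar> ^ m"
    "\<forall>\<^sub>F s in nhds t. norm (g s) \<le> \<epsilon> / 2 * \<bar>s - t\<bar> ^ m"
    using assms unfolding vanishes_to_order_def by blast+
  then show "\<forall>\<^sub>F s in nhds t. norm (f s + g s) \<le> \<epsilon> * \<bar>s - t\<bar> ^ m"
  proof eventually_elim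
    case (elim s)
    then show ?case using norm_triangle_ineq[of "f s" "g s"] by simp
  qed
qed

lemma vanishes_to_order_bounded:
  assumes "vanishes_to_order m t g" "\<forall>\<^sub>F s in nhds t. norm (f s) \<le> B * norm (g s)"
  shows "vanishes_to_order m t f"
  unfolding vanishes_to_order_def
proof (intro allI impI)
  fix \<epsilon> :: real assume "\<epsilon> > 0"
  then have "\<epsilon> / (\<bar>B\<bar> + 1) > 0" by simp
  then have "\<forall>\<^sub>F s in nhds t. norm (g s) \<le> \<epsilon> / (\<bar>B\<bar> + 1) * \<bar>s - t\<bar> ^ m"
    using assms unfolding vanishes_to_order_def by blast
  with assms(2) show "\<forall>\<^sub>F s in nhds t. norm (f s) \<le> \<epsilon> * \<bar>s - t\<bar> ^ m"
  proof eventually_elim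
    case (elim s)
    have "norm (f s) \<le> (\<bar>B\<bar> + 1) * norm (g s)"
      by (rule order_trans[OF elim(1)]) (auto intro: mult_right_mono)
    also have "\<dots> \<le> (\<bar>B\<bar> + 1) * (\<epsilon> / (\<bar>B\<bar> + 1) * \<bar>s - t\<bar> ^ m)"
      by (intro mult_left_mono elim) auto
    finally show ?case by simp
  qed
qed

lemma vanishes_to_order_monomial:
  assumes "vanishes_to_order k t (\<lambda>s. c * (s - t) ^ k)"
  shows "c = (0::real)"
proof (rule ccontr)
  assume c: "c \<noteq> 0"
  then have "\<forall>\<^sub>F s in nhds t. norm (c * (s - t) ^ k) \<le> \<bar>c\<bar> / 2 * \<bar>s - t\<bar> ^ k"
    using assms unfolding vanishes_to_order_def by (meson half_gt_zero zero_less_abs_iff)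
  then obtain d where d: "d > 0" "\<And>s. dist s t < d \<Longrightarrow> norm (c * (s - t) ^ k) \<le> \<bar>c\<bar> / 2 * \<bar>s - t\<bar> ^ k"
    unfolding eventually_nhds_metric by blast
  have "\<bar>c\<bar> * (d / 2) ^ k \<le> \<bar>c\<bar> / 2 * (d / 2) ^ k"
    using d(2)[of "t + d / 2"] d(1) by (simp add: dist_real_def abs_mult power_abs)
  moreover have "\<bar>c\<bar> * (d / 2) ^ k > 0" using c d(1) by simp
  ultimately show False by simp
qed

text \<open>The Peano form of Taylor's formula, by the mean value inequality. The induction starts at order 1,
  where the assertion is the definition of the derivative, because \<open>(Dt ^^ m) g\<close> need not be continuous.\<close>

lemma vanishes_to_order_if_jet_0:
  fixes g :: "real \<Rightarrow> real"
  assumes "m \<ge> 1" "n_times_differentiable_on_interval m g a b" "t \<in> {a<..<b}"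
    "\<And>k. k \<le> m \<Longrightarrow> (Dt ^^ k) g t = 0"
  shows "vanishes_to_order m t g"
  using assms
proof (induction m arbitrary: g rule: nat_induct_at_least)
  case base
  have "(g has_derivative (\<lambda>h. 0)) (at t)"
    using n_times_differentiable_Dt[OF base(1), of 0 t] base(2) base(3)[of 1]
    by (simp add: has_vector_derivative_def)
  moreover have "g t = 0" using base(3)[of 0] by simp
  ultimately have *: "\<forall>e>0. \<exists>d>0. \<forall>y. norm (y - t) < d \<longrightarrow> norm (g y) \<le> e * norm (y - t)"
    by (simp add: has_derivative_at_alt)
  then show ?case
    by (simp add: vanishes_to_order_def eventually_nhds_metric dist_norm)
next
  case (Suc m)
  have "vanishes_to_order m t (Dt g)"
  proof (rule Suc.IH[OF _ Suc.prems(2)])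
    show "n_times_differentiable_on_interval m (Dt g) a b"
      using Suc.prems(1) unfolding n_times_differentiable_on_interval_def
      by (metis Suc_less_eq funpow_Suc_right o_apply)
    show "(Dt ^^ k) (Dt g) t = 0" if "k \<le> m" for k
      using Suc.prems(3)[of "Suc k"] that by (simp add: funpow_Suc_right del: funpow.simps)
  qed
  show ?case
    unfolding vanishes_to_order_def
  proof (intro allI impI)
    fix \<epsilon> :: real assume "\<epsilon> > 0"
    with \<open>vanishes_to_order m t (Dt g)\<close> have "\<forall>\<^sub>F s in nhds t. norm (Dt g s) \<le> \<epsilon> * \<bar>s - t\<bar> ^ m"
      by (simp add: vanishes_to_order_def)
    moreover have "\<forall>\<^sub>F s in nhds t. s \<in> {a<..<b}"
      by (intro eventually_nhds_in_open Suc.prems) auto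
    ultimately have "\<forall>\<^sub>F s in nhds t. norm (Dt g s) \<le> \<epsilon> * \<bar>s - t\<bar> ^ m \<and> s \<in> {a<..<b}"
      by eventually_elim auto
    then obtain d where d: "d > 0"
      "\<And>s. dist s t < d \<Longrightarrow> norm (Dt g s) \<le> \<epsilon> * \<bar>s - t\<bar> ^ m \<and> s \<in> {a<..<b}"
      unfolding eventually_nhds_metric by blast
    have "norm (g s) \<le> \<epsilon> * \<bar>s - t\<bar> ^ Suc m" if s: "dist s t < d" for s
    proof -
      let ?B = "\<epsilon> * \<bar>s - t\<bar> ^ m"
      have "norm (g s - g t) \<le> ?B * norm (s - t)"
      proof (rule field_differentiable_bound[of "cball t \<bar>s - t\<bar>"])
        fix u assume u: "u \<in> cball t \<bar>s - t\<bar>"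
        then have du: "dist u t < d" and le: "\<bar>u - t\<bar> \<le> \<bar>s - t\<bar>" using s by (auto simp: dist_real_def)
        have "(g has_real_derivative Dt g u) (at u)"
          using n_times_differentiable_Dt[OF Suc.prems(1), of 0 u] d(2)[OF du]
          by (simp add: has_real_derivative_iff_has_vector_derivative)
        then show "(g has_real_derivative Dt g u) (at u within cball t \<bar>s - t\<bar>)"
          by (rule has_field_derivative_at_within)
        have "\<epsilon> * \<bar>u - t\<bar> ^ m \<le> ?B"
          using le \<open>\<epsilon> > 0\<close> by (intro mult_left_mono power_mono) auto
        then show "norm (Dt g u) \<le> ?B" using d(2)[OF du] by linarith
      qed (auto simp: dist_real_def)
      then show ?thesis using Suc.prems(3)[of 0] by (simp add: mult_ac)
    qed
    then show "\<forall>\<^sub>F s in nhds t. norm (g s) \<le> \<epsilon> * \<bar>s - t\<bar> ^ Suc m"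
      unfolding eventually_nhds_metric using d(1) by blast
  qed
qed

lemma smooth_n_times_differentiable:
  "smooth f \<Longrightarrow> n_times_differentiable_on_interval N f a b"
  unfolding n_times_differentiable_on_interval_def
  using smooth_has_derivative[OF smooth_Dt_funpow] differentiableI by blast

lemma smooth_monomial: "smooth (\<lambda>s. c * (s - t) ^ k :: real)"
  by (intro smooth_mult smooth_power smooth_diff smooth_const smooth_ident)

lemma Dt_funpow_monomial:
  "(Dt ^^ j) (\<lambda>s. c * (s - t) ^ k) = (\<lambda>s. c * (\<Prod>i<j. real (k - i)) * (s - t) ^ (k - j))"
proof (induction j)
  case (Suc j)
  have "Dt (\<lambda>s. c * (\<Prod>i<j. real (k - i)) * (s - t) ^ (k - j)) s =
      c * (\<Prod>i<j. real (k - i)) * (real (k - j) * (s - t) ^ (k - j - 1))" for s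
    unfolding Dt_def
    by (rule vector_derivative_at)
      (auto intro!: derivative_eq_intros simp: has_real_derivative_iff_has_vector_derivative[symmetric])
  then show ?case by (simp add: Suc fun_eq_iff mult.assoc)
qed simp

lemma Dt_funpow_monomial_at:
  "j < k \<Longrightarrow> (Dt ^^ j) (\<lambda>s. c * (s - t) ^ k) t = 0"
  "(Dt ^^ k) (\<lambda>s. c * (s - t) ^ k) t = c * (\<Prod>i<k. real (k - i))"
  by (simp_all add: Dt_funpow_monomial)

text \<open>If the derivatives of order less than \<open>k\<close> vanish, subtracting the Taylor monomial of degree \<open>k\<close> leaves a
  function that vanishes to order \<open>k\<close>; the monomial then vanishes to order \<open>k\<close> itself, which is possible for
  the coefficient 0 only.\<close>

lemma jet_0_if_vanishes_to_order:
  fixes g :: "real \<Rightarrow> real"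
  assumes g: "n_times_differentiable_on_interval m g a b" "t \<in> {a<..<b}"
    and v: "vanishes_to_order m t g"
  shows "m \<ge> 1 \<Longrightarrow> k \<le> m \<Longrightarrow> (Dt ^^ k) g t = 0"
proof (induction k rule: less_induct)
  case (less k)
  show ?case
  proof (cases "k = 0")
    case True
    with vanishes_to_order_at[OF v] less show ?thesis by simp
  next
    case False
    define c where "c = - (Dt ^^ k) g t / (\<Prod>i<k. real (k - i))"
    let ?p = "\<lambda>s. c * (s - t) ^ k"
    have nz: "(\<Prod>i<k. real (k - i)) \<noteq> 0" by simp
    have gk: "n_times_differentiable_on_interval k g a b"
      using g(1) less.prems by (auto simp: n_times_differentiable_on_interval_def)
    have pk: "n_times_differentiable_on_interval k ?p a b"
      by (intro smooth_n_times_differentiable smooth_monomial)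
    have "vanishes_to_order k t (\<lambda>s. g s + ?p s)"
    proof (rule vanishes_to_order_if_jet_0[OF _ n_times_differentiable_add(1)[OF gk pk] g(2)])
      fix j assume j: "j \<le> k"
      have "(Dt ^^ j) (\<lambda>s. g s + ?p s) t = (Dt ^^ j) g t + (Dt ^^ j) ?p t"
        by (rule n_times_differentiable_add(2)[OF gk pk j g(2)])
      also have "\<dots> = 0"
      proof (cases "j = k")
        case True
        have "(Dt ^^ k) ?p t = c * (\<Prod>i<k. real (k - i))" by (rule Dt_funpow_monomial_at)
        also have "\<dots> = - (Dt ^^ k) g t" using nz by (simp add: c_def)
        finally show ?thesis using True by simp
      next
        case False
        then show ?thesis using less j by (simp add: Dt_funpow_monomial_at(1))
      qed
      finally show "(Dt ^^ j) (\<lambda>s. g s + ?p s) t = 0" .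
    qed (use False in auto)
    moreover have "vanishes_to_order k t (\<lambda>s. - g s)"
      by (rule vanishes_to_order_bounded[OF vanishes_to_order_mono[OF v less.prems(2)], where B = 1]) auto
    ultimately have "vanishes_to_order k t ?p"
      using vanishes_to_order_add[of k t "\<lambda>s. g s + ?p s" "\<lambda>s. - g s"] by simp
    then have "c = 0" by (rule vanishes_to_order_monomial)
    then show ?thesis using nz by (simp add: c_def)
  qed
qed

lemma exists_smooth_with_jet:
  "\<exists>P. smooth P \<and> (\<forall>k\<le>m. (Dt ^^ k) P t = (Dt ^^ k) (f :: real \<Rightarrow> real) t)"
proof (induction m)
  case 0
  show ?case by (intro exI[of _ "\<lambda>_. f t"]) auto
next
  case (Suc m)
  then obtain P where P: "smooth P" "\<And>k. k \<le> m \<Longrightarrow> (Dt ^^ k) P t = (Dt ^^ k) f t" by blast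
  define c where "c = ((Dt ^^ Suc m) f t - (Dt ^^ Suc m) P t) / (\<Prod>i<Suc m. real (Suc m - i))"
  let ?p = "\<lambda>s. c * (s - t) ^ Suc m"
  have nz: "(\<Prod>i<Suc m. real (Suc m - i)) \<noteq> 0" by simp
  have add: "(Dt ^^ k) (\<lambda>s. P s + ?p s) t = (Dt ^^ k) P t + (Dt ^^ k) ?p t" for k
    by (rule n_times_differentiable_add(2)[OF smooth_n_times_differentiable[OF P(1)]
          smooth_n_times_differentiable[OF smooth_monomial] order_refl, of t "t - 1" "t + 1"]) auto
  have "(Dt ^^ k) (\<lambda>s. P s + ?p s) t = (Dt ^^ k) f t" if "k \<le> Suc m" for k
  proof (cases "k = Suc m")
    case True
    have "(Dt ^^ Suc m) ?p t = (Dt ^^ Suc m) f t - (Dt ^^ Suc m) P t"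
      using nz unfolding Dt_funpow_monomial_at c_def by (metis nonzero_eq_divide_eq)
    then show ?thesis by (simp only: True add)
  next
    case False
    then show ?thesis using that P(2)[of k] Dt_funpow_monomial_at(1)[of k "Suc m" c t]
      by (simp only: add)
  qed
  moreover have "smooth (\<lambda>s. P s + ?p s)" by (intro smooth_add P smooth_monomial)
  ultimately show ?case by blast
qed

text \<open>For \<open>\<alpha> = m\<close> the kernel has the exponent 0 off the diagonal, so that \<^const>\<open>left_integral\<close> is the primitive of
  \<open>f\<close>; one of the \<open>m + 1\<close> derivatives undoes it.\<close>

lemma left_RL_integer_order:
  fixes f :: "real \<Rightarrow> real"
  assumes "continuous_on {a..b} f" "left_RL_exists a b (real m) f"
  shows "n_times_differentiable_on_interval m f a b"
    and "t \<in> {a<..<b} \<Longrightarrow> left_RL a (real m) f t = (Dt ^^ m) f t"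
proof -
  have n: "frac_order (real m) = Suc m" by (simp add: frac_order_def)
  let ?I = "left_integral a (real m) f"
  have I: "?I \<tau> = integral {a..\<tau>} f" for \<tau>
    unfolding left_integral_def left_kernel_integrand_def
    by (rule integral_spike[of "{\<tau>}"]) (auto simp: n)
  have D: "Dt ?I \<tau> = f \<tau>" if "\<tau> \<in> {a<..<b}" for \<tau>
  proof -
    have "((\<lambda>u. integral {a..u} f) has_vector_derivative f \<tau>) (at \<tau> within {a..b})"
      by (rule integral_has_vector_derivative[OF assms(1)]) (use that in auto)
    then show ?thesis
      using that by (auto simp: Dt_def I[abs_def] at_within_Icc_at intro: vector_derivative_at)
  qed
  have ex: "n_times_differentiable_on_interval (Suc m) ?I a b"
    using assms(2) by (simp add: left_RL_exists_def n)
  have "n_times_differentiable_on_interval m (Dt ?I) a b"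
    using ex unfolding n_times_differentiable_on_interval_def
    by (metis Suc_less_eq funpow_Suc_right o_apply)
  then show "n_times_differentiable_on_interval m f a b"
    by (rule n_times_differentiable_cong[rotated]) (rule D)
  assume t: "t \<in> {a<..<b}"
  have "(Dt ^^ Suc m) ?I t = (Dt ^^ m) (Dt ?I) t"
    by (simp add: funpow_Suc_right del: funpow.simps)
  also have "\<dots> = (Dt ^^ m) f t"
    by (rule Dt_funpow_cong_open[OF open_greaterThanLessThan D t])
  finally show "left_RL a (real m) f t = (Dt ^^ m) f t"
    by (simp add: left_RL_def n del: funpow.simps)
qed


section \<open>Abstract one-sided functionals\<close>

definition past_supported :: "real \<Rightarrow> (real \<Rightarrow> real) \<Rightarrow> bool" where
  "past_supported t f \<longleftrightarrow> smooth f \<and> (\<exists>e<t. \<forall>s\<ge>e. f s = 0)"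

definition future_supported :: "real \<Rightarrow> (real \<Rightarrow> real) \<Rightarrow> bool" where
  "future_supported t f \<longleftrightarrow> smooth f \<and> (\<exists>e>t. \<forall>s\<le>e. f s = 0)"

text \<open>A functional that only sees the jet of order \<open>m\<close> at \<open>t\<close>, on a domain of functions that have such a jet
  (that of a smooth function \<open>P\<close>); constants belong to its kernel.\<close>

definition jet_functional ::
    "real \<Rightarrow> ((real \<Rightarrow> real) \<Rightarrow> bool) \<Rightarrow> ((real \<Rightarrow> real) \<Rightarrow> real) \<Rightarrow> nat \<Rightarrow> bool" where
  "jet_functional t D \<Lambda> m \<longleftrightarrow>
     \<Lambda> (\<lambda>_. 1) = 0 \<and>
     (\<forall>f. D f \<longrightarrow> (\<exists>P. smooth P \<and> vanishes_to_order m t (\<lambda>s. f s - P s))) \<and>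
     (\<forall>f. D f \<longrightarrow> vanishes_to_order m t f \<longrightarrow> \<Lambda> f = 0)"

text \<open>The opposite case: the values of the functional can be changed, in three independent places, by bumps
  \<open>h1\<close>, \<open>h2\<close>, \<open>h3\<close> from a class \<open>Z\<close> of functions that vanish near \<open>t\<close>. The cutoffs \<open>p1\<close> and \<open>p2\<close> equal 1 where
  \<open>h1\<close> and \<open>h2\<close> do not vanish. Two bumps serve to compare two values of a vector field, the third one
  to restore the value of the functional.\<close>

definition steerable :: "((real \<Rightarrow> real) \<Rightarrow> bool) \<Rightarrow> ((real \<Rightarrow> real) \<Rightarrow> real) \<Rightarrow> bool" where
  "steerable Z \<Lambda> \<longleftrightarrow>
     (\<exists>p1 p2 h1 h2 h3. Z p1 \<and> Z p2 \<and> Z h1 \<and> Z h2 \<and> Z h3 \<and> \<Lambda> h1 = 1 \<and> \<Lambda> h2 = 1 \<and> \<Lambda> h3 = 1 \<and>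
       (\<forall>s. p1 s * h1 s = h1 s \<and> p2 s * h2 s = h2 s \<and> p1 s * h2 s = 0 \<and> p2 s * h1 s = 0 \<and>
            h3 s * h1 s = 0 \<and> h3 s * h2 s = 0))"

text \<open>An abstraction of the scalar functional \<open>f \<mapsto> left_RL a \<alpha> f t\<close> on the domain \<open>D\<close>. The class \<open>Z\<close> consists of
  functions supported strictly on the side of \<open>t\<close> that the functional sees, \<open>Z'\<close> of functions supported
  strictly on the other side. The number \<open>m\<close> is the order of the jet on which the functional depends, and 0
  encodes a functional with memory.\<close>

locale one_sided_functional =
  fixes t :: real
    and D :: "(real \<Rightarrow> real) \<Rightarrow> bool" and \<Lambda> :: "(real \<Rightarrow> real) \<Rightarrow> real"
    and Z Z' :: "(real \<Rightarrow> real) \<Rightarrow> bool" and m :: nat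
  assumes D_comb: "D f \<Longrightarrow> D g \<Longrightarrow> D (\<lambda>s. r * f s + g s)"
    and \<Lambda>_comb: "D f \<Longrightarrow> D g \<Longrightarrow> \<Lambda> (\<lambda>s. r * f s + g s) = r * \<Lambda> f + \<Lambda> g"
    and D_smooth: "smooth f \<Longrightarrow> D f"
    and \<Lambda>_parameter: "smooth F \<Longrightarrow>
      ((\<lambda>s. \<Lambda> (\<lambda>\<tau>. F (s, \<tau>))) has_real_derivative \<Lambda> (\<lambda>\<tau>. pd1 F (s, \<tau>))) (at s)"
    and Z_smooth: "Z f \<Longrightarrow> smooth f"
    and Z_mult: "Z f \<Longrightarrow> smooth g \<Longrightarrow> Z (\<lambda>s. g s * f s)"
    and Z_zero: "Z (\<lambda>_. 0)"
    and Z_near: "Z f \<Longrightarrow> \<forall>\<^sub>F s in nhds t. f s = 0"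
    and \<Lambda>_Z': "Z' f \<Longrightarrow> \<Lambda> f = 0"
    and jet: "m > 0 \<Longrightarrow> jet_functional t D \<Lambda> m"
    and steer: "m = 0 \<Longrightarrow> steerable Z \<Lambda>"
begin

lemma D_zero: "D (\<lambda>_. 0)" and D_const: "D (\<lambda>_. c)"
  by (auto intro: D_smooth)

lemma \<Lambda>_zero: "\<Lambda> (\<lambda>_. 0) = 0"
  using \<Lambda>_comb[OF D_zero D_zero, of 1] by simp

lemma D_cmult: "D f \<Longrightarrow> D (\<lambda>s. r * f s)"
  using D_comb[OF _ D_zero, of f r] by simp

lemma \<Lambda>_cmult: "D f \<Longrightarrow> \<Lambda> (\<lambda>s. r * f s) = r * \<Lambda> f"
  using \<Lambda>_comb[OF _ D_zero, of f r] by (simp add: \<Lambda>_zero)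

lemma D_add: "D f \<Longrightarrow> D g \<Longrightarrow> D (\<lambda>s. f s + g s)"
  using D_comb[of f g 1] by simp

lemma \<Lambda>_add: "D f \<Longrightarrow> D g \<Longrightarrow> \<Lambda> (\<lambda>s. f s + g s) = \<Lambda> f + \<Lambda> g"
  using \<Lambda>_comb[of f g 1] by simp

lemma D_diff: "D f \<Longrightarrow> D g \<Longrightarrow> D (\<lambda>s. f s - g s)"
  using D_comb[of g f "-1"] by simp

lemma \<Lambda>_diff: "D f \<Longrightarrow> D g \<Longrightarrow> \<Lambda> (\<lambda>s. f s - g s) = \<Lambda> f - \<Lambda> g"
  using \<Lambda>_comb[of g f "-1"] by simp

lemma D_sum: "(\<And>i. i \<in> I \<Longrightarrow> D (f i)) \<Longrightarrow> D (\<lambda>s. \<Sum>i\<in>I. f i s)"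
  by (induction I rule: infinite_finite_induct) (auto intro: D_zero D_add)

lemma \<Lambda>_sum: "(\<And>i. i \<in> I \<Longrightarrow> D (f i)) \<Longrightarrow> \<Lambda> (\<lambda>s. \<Sum>i\<in>I. f i s) = (\<Sum>i\<in>I. \<Lambda> (f i))"
  by (induction I rule: infinite_finite_induct) (auto simp: \<Lambda>_zero \<Lambda>_add D_sum)

lemma Z_at: "Z f \<Longrightarrow> f t = 0"
  using Z_near eventually_nhds_x_imp_x by fast

lemma Z_cmult: "Z f \<Longrightarrow> Z (\<lambda>s. r * f s)"
  by (rule Z_mult[OF _ smooth_const])

text \<open>A corrector: any prescribed value of the functional is attained on functions that vanish
  near \<open>t\<close>, unless the functional only sees the jet at \<open>t\<close>.\<close>

lemma exists_corrector:
  obtains k where "Z k" "m = 0 \<Longrightarrow> \<Lambda> k = r" "m > 0 \<Longrightarrow> k = (\<lambda>_. 0)"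
proof (cases "m = 0")
  case True
  then obtain h where "Z h" "\<Lambda> h = 1" using steer by (auto simp: steerable_def)
  then show thesis
    using True \<Lambda>_cmult[OF D_smooth[OF Z_smooth], of h r] Z_cmult[of h r]
    by (intro that[of "\<lambda>s. r * h s"]) auto
next
  case False
  then show thesis by (intro that[of "\<lambda>_. 0"]) (auto intro: Z_zero)
qed

end

locale functional_pair =
  L: one_sided_functional t D1 \<Lambda>1 Z1 Z2 m1 + R: one_sided_functional t D2 \<Lambda>2 Z2 Z1 m2
  for t D1 \<Lambda>1 Z1 m1 D2 \<Lambda>2 Z2 m2
begin

lemma swap: "functional_pair t D2 \<Lambda>2 Z2 m2 D1 \<Lambda>1 Z1 m1"
  by unfold_locales

text \<open>Adding multiples of \<open>\<eta>\<close> changes the position of a curve at \<open>t\<close> and keeps its one-sided derivatives.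
  The constant 1 is corrected on either side; the corrector of one side is invisible from the other side.\<close>

lemma exists_unit_with_null_derivatives:
  obtains \<eta> where "smooth \<eta>" "\<eta> t = 1" "\<Lambda>1 \<eta> = 0" "\<Lambda>2 \<eta> = 0"
proof -
  obtain k1 where k1: "Z1 k1" "m1 = 0 \<Longrightarrow> \<Lambda>1 k1 = \<Lambda>1 (\<lambda>_. 1)" "m1 > 0 \<Longrightarrow> k1 = (\<lambda>_. 0)"
    using L.exists_corrector by metis
  obtain k2 where k2: "Z2 k2" "m2 = 0 \<Longrightarrow> \<Lambda>2 k2 = \<Lambda>2 (\<lambda>_. 1)" "m2 > 0 \<Longrightarrow> k2 = (\<lambda>_. 0)"
    using R.exists_corrector by metis
  have 1: "\<Lambda>1 k1 = \<Lambda>1 (\<lambda>_. 1)"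
    using k1 L.jet by (cases "m1 = 0") (auto simp: jet_functional_def L.\<Lambda>_zero)
  have 2: "\<Lambda>2 k2 = \<Lambda>2 (\<lambda>_. 1)"
    using k2 R.jet by (cases "m2 = 0") (auto simp: jet_functional_def R.\<Lambda>_zero)
  have s: "smooth k1" "smooth k2" using L.Z_smooth R.Z_smooth k1 k2 by auto
  show thesis
  proof
    let ?\<eta> = "\<lambda>s. 1 - k1 s - k2 s"
    show "smooth ?\<eta>" by (intro smooth_diff smooth_const s)
    show "?\<eta> t = 1" using L.Z_at[OF k1(1)] R.Z_at[OF k2(1)] by simp
    show "\<Lambda>1 ?\<eta> = 0"
      by (simp add: L.\<Lambda>_diff L.D_diff L.D_smooth s smooth_const 1 L.\<Lambda>_Z'[OF k2(1)])
    show "\<Lambda>2 ?\<eta> = 0"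
      by (simp add: R.\<Lambda>_diff R.D_diff R.D_smooth s smooth_const 2 R.\<Lambda>_Z'[OF k1(1)])
  qed
qed

text \<open>A smooth function with the value and the one-sided derivatives of a rough one. On a side without memory
  it is osculating, and then the one-sided derivative agrees; on a side with memory a corrector adjusts it.
  If both sides have no memory, the osculation of the larger order serves both.\<close>

lemma exists_smooth_approximant:
  assumes f: "D1 f" "D2 f"
  obtains g where "smooth g" "g t = f t" "\<Lambda>1 g = \<Lambda>1 f" "\<Lambda>2 g = \<Lambda>2 f"
    "m1 > 0 \<Longrightarrow> vanishes_to_order m1 t (\<lambda>s. f s - g s)"
    "m2 > 0 \<Longrightarrow> vanishes_to_order m2 t (\<lambda>s. f s - g s)"
proof -
  obtain P where P: "smooth P" "P t = f t"
    "m1 > 0 \<Longrightarrow> vanishes_to_order m1 t (\<lambda>s. f s - P s)"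
    "m2 > 0 \<Longrightarrow> vanishes_to_order m2 t (\<lambda>s. f s - P s)"
  proof (cases "m1 = 0 \<and> m2 = 0")
    case True
    then show thesis by (intro that[of "\<lambda>_. f t"]) auto
  next
    case False
    have "\<exists>P. smooth P \<and> vanishes_to_order (max m1 m2) t (\<lambda>s. f s - P s)"
    proof (cases "m1 \<le> m2")
      case True
      then have "m2 > 0" using False by auto
      from R.jet[OF this] show ?thesis using True f unfolding jet_functional_def by (simp add: max_def)
    next
      case False
      then have "m1 > 0" by auto
      from L.jet[OF this] show ?thesis using False f unfolding jet_functional_def by (simp add: max_def)
    qed
    then obtain P where P: "smooth P" "vanishes_to_order (max m1 m2) t (\<lambda>s. f s - P s)" by blast
    have "f t - P t = 0" by (rule vanishes_to_order_at[OF P(2)]) (use False in auto)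
    then show thesis
      using P by (intro that[of P]) (auto intro: vanishes_to_order_mono)
  qed
  obtain k1 where k1: "Z1 k1" "m1 = 0 \<Longrightarrow> \<Lambda>1 k1 = \<Lambda>1 f - \<Lambda>1 P" "m1 > 0 \<Longrightarrow> k1 = (\<lambda>_. 0)"
    using L.exists_corrector by metis
  obtain k2 where k2: "Z2 k2" "m2 = 0 \<Longrightarrow> \<Lambda>2 k2 = \<Lambda>2 f - \<Lambda>2 P" "m2 > 0 \<Longrightarrow> k2 = (\<lambda>_. 0)"
    using R.exists_corrector by metis
  have s: "smooth k1" "smooth k2" using L.Z_smooth R.Z_smooth k1 k2 by auto
  have "\<Lambda>1 (\<lambda>s. f s - P s) = 0" if "m1 > 0"
    using that L.jet P(3) L.D_diff[OF f(1) L.D_smooth[OF P(1)]] unfolding jet_functional_def by blast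
  then have 1: "\<Lambda>1 k1 = \<Lambda>1 f - \<Lambda>1 P"
    using k1 L.\<Lambda>_diff[OF f(1) L.D_smooth[OF P(1)]] by (cases "m1 = 0") (auto simp: L.\<Lambda>_zero)
  have "\<Lambda>2 (\<lambda>s. f s - P s) = 0" if "m2 > 0"
    using that R.jet P(4) R.D_diff[OF f(2) R.D_smooth[OF P(1)]] unfolding jet_functional_def by blast
  then have 2: "\<Lambda>2 k2 = \<Lambda>2 f - \<Lambda>2 P"
    using k2 R.\<Lambda>_diff[OF f(2) R.D_smooth[OF P(1)]] by (cases "m2 = 0") (auto simp: R.\<Lambda>_zero)
  let ?g = "\<lambda>s. P s + k1 s + k2 s"
  have van: "vanishes_to_order m t (\<lambda>s. f s - ?g s)" if "vanishes_to_order m t (\<lambda>s. f s - P s)" for m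
  proof (rule vanishes_to_order_bounded[OF that, where B = 1])
    show "\<forall>\<^sub>F s in nhds t. norm (f s - ?g s) \<le> 1 * norm (f s - P s)"
      using L.Z_near[OF k1(1)] R.Z_near[OF k2(1)] by eventually_elim auto
  qed
  show thesis
  proof
    show "smooth ?g" by (intro smooth_add P s)
    show "?g t = f t" using L.Z_at[OF k1(1)] R.Z_at[OF k2(1)] P by simp
    show "\<Lambda>1 ?g = \<Lambda>1 f"
      by (simp add: L.\<Lambda>_add L.D_add L.D_smooth s P 1 L.\<Lambda>_Z'[OF k2(1)])
    show "\<Lambda>2 ?g = \<Lambda>2 f"
      by (simp add: R.\<Lambda>_add R.D_add R.D_smooth s P 2 R.\<Lambda>_Z'[OF k1(1)])
  qed (use P van in auto)
qed

end


section \<open>Rough curves can be replaced by smooth ones\<close>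

lemma smooth_locally_Lipschitz:
  fixes f :: "'a::euclidean_space \<Rightarrow> real"
  assumes "smooth f"
  obtains B where "\<And>u w. u \<in> cball q 1 \<Longrightarrow> w \<in> cball q 1 \<Longrightarrow> norm (f u - f w) \<le> B * norm (u - w)"
proof -
  let ?n = "\<lambda>u. \<Sum>b\<in>Basis. norm (frechet_derivative f (at u) b)"
  have "continuous_on (cball q 1) ?n"
    by (intro continuous_intros smooth_continuous_on[OF smooth_partial[OF assms]])
  then have "bounded (?n ` cball q 1)"
    by (intro compact_imp_bounded compact_continuous_image) auto
  then obtain B where B: "\<And>u. u \<in> cball q 1 \<Longrightarrow> norm (?n u) \<le> B"
    unfolding bounded_iff by blast
  show thesis
  proof
    fix u w assume uw: "u \<in> cball q 1" "w \<in> cball q 1"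
    show "norm (f u - f w) \<le> B * norm (u - w)"
    proof (rule differentiable_bound[of "cball q 1" f "\<lambda>u. frechet_derivative f (at u)" B])
      show "(f has_derivative frechet_derivative f (at u)) (at u within cball q 1)" for u
        by (rule has_derivative_at_withinI[OF smooth_has_derivative[OF assms]])
      show "onorm (frechet_derivative f (at u)) \<le> B" if "u \<in> cball q 1" for u
        using onorm_componentwise[OF has_derivative_bounded_linear[OF smooth_has_derivative[OF assms, of u]]]
          B[OF that] by simp
    qed (use uw in auto)
  qed
qed

lemma vanishes_to_order_vec:
  fixes f :: "real \<Rightarrow> real^'n"
  assumes "\<And>j. vanishes_to_order m t (\<lambda>s. f s $ j)"
  shows "vanishes_to_order m t f"
proof -
  have "vanishes_to_order m t (\<lambda>s. \<Sum>j\<in>J. norm (f s $ j))" for J :: "'n set"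
  proof (induction J rule: infinite_finite_induct)
    case (insert j J)
    have "vanishes_to_order m t (\<lambda>s. norm (f s $ j))"
      by (rule vanishes_to_order_bounded[OF assms[of j], where B = 1]) auto
    from vanishes_to_order_add[OF this insert(3)] insert show ?case by simp
  qed (auto simp: vanishes_to_order_def)
  then show ?thesis
    by (rule vanishes_to_order_bounded[where B = 1])
      (auto intro!: always_eventually order_trans[OF norm_le_l1_cart])
qed

lemma vanishes_to_order_compose:
  fixes f :: "real^'n \<Rightarrow> real"
  assumes f: "smooth f" and y: "smooth y" and m: "m > 0" and v: "vanishes_to_order m t (\<lambda>s. x s - y s)"
  shows "vanishes_to_order m t (\<lambda>s. f (x s) - f (y s))"
proof -
  obtain B where B: "\<And>u w. u \<in> cball (y t) 1 \<Longrightarrow> w \<in> cball (y t) 1 \<Longrightarrow> norm (f u - f w) \<le> B * norm (u - w)"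
    using smooth_locally_Lipschitz[OF f] by blast
  have "vanishes_to_order 1 t (\<lambda>s. x s - y s)"
    by (rule vanishes_to_order_mono[OF v]) (use m in auto)
  then have 1: "\<forall>\<^sub>F s in nhds t. norm (x s - y s) \<le> 1 * \<bar>s - t\<bar> ^ 1"
    unfolding vanishes_to_order_def using zero_less_one by blast
  have 2: "\<forall>\<^sub>F s in nhds t. s \<in> ball t (1/2)"
    by (intro eventually_nhds_in_open) auto
  have "isCont y t"
    using smooth_continuous_on[OF y, of UNIV] by (simp add: continuous_on_eq_continuous_at)
  then have "(y \<longlongrightarrow> y t) (nhds t)" by (simp add: continuous_at tendsto_at_iff_tendsto_nhds)
  then have 3: "\<forall>\<^sub>F s in nhds t. dist (y s) (y t) < 1/2"
    by (rule tendstoD) simp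
  show ?thesis
  proof (rule vanishes_to_order_bounded[OF v])
    show "\<forall>\<^sub>F s in nhds t. norm (f (x s) - f (y s)) \<le> B * norm (x s - y s)"
      using 1 2 3
    proof eventually_elim
      case (elim s)
      have "dist (x s) (y t) \<le> dist (x s) (y s) + dist (y s) (y t)" by (rule dist_triangle)
      then show ?case
        using elim by (intro B) (auto simp: dist_norm norm_minus_commute[of "y t"] abs_minus_commute[of t])
    qed
  qed
qed

context functional_pair
begin

text \<open>Suppose a weighted sum of the functionals is constant along the nonlinear family of all smooth
  curves with prescribed data at \<open>t\<close>. If \<open>\<Lambda>1\<close> has memory, a curve \<open>y\<close> may be given the values
  \<open>q\<close> and 0 on two bumps of the past, and it may be varied by the difference of these bumps; the
  prescribed data do not change, and the derivative compares \<open>DX\<close> at \<open>q\<close> and at 0.\<close>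

lemma derivative_rigidity:
  fixes X :: "real^'n \<Rightarrow> real^'n" and \<xi> :: "'n \<Rightarrow> complex" and c1 c2 K :: complex
  assumes m1: "m1 = 0" and X: "smooth X"
    and y0: "smooth y0" "y0 t = q0" "\<And>j. \<Lambda>1 (\<lambda>s. y0 s $ j) = l j" "\<And>j. \<Lambda>2 (\<lambda>s. y0 s $ j) = r j"
    and const: "\<And>y. smooth y \<Longrightarrow> y t = q0 \<Longrightarrow> (\<And>j. \<Lambda>1 (\<lambda>s. y s $ j) = l j) \<Longrightarrow>
      (\<And>j. \<Lambda>2 (\<lambda>s. y s $ j) = r j) \<Longrightarrow>
      (\<Sum>j\<in>UNIV. \<xi> j * (c1 * of_real (\<Lambda>1 (\<lambda>s. X (y s) $ j)) + c2 * of_real (\<Lambda>2 (\<lambda>s. X (y s) $ j)))) = K"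
  shows "(\<Sum>j\<in>UNIV. \<xi> j * (c1 * of_real (frechet_derivative (\<lambda>q. X q $ j) (at q) e -
      frechet_derivative (\<lambda>q. X q $ j) (at 0) e))) = 0"
proof -
  obtain p1 p2 h1 h2 h3 where Z: "Z1 p1" "Z1 p2" "Z1 h1" "Z1 h2" "Z1 h3"
    and h: "\<Lambda>1 h1 = 1" "\<Lambda>1 h2 = 1" "\<Lambda>1 h3 = 1"
    and p: "\<And>s. p1 s * h1 s = h1 s" "\<And>s. p2 s * h2 s = h2 s" "\<And>s. p1 s * h2 s = 0"
      "\<And>s. p2 s * h1 s = 0" "\<And>s. h3 s * h1 s = 0" "\<And>s. h3 s * h2 s = 0"
    using L.steer[OF m1] unfolding steerable_def by blast
  note sm = Z[THEN L.Z_smooth]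
  note at = Z[THEN L.Z_at]
  have s0: "smooth (\<lambda>s. y0 s $ j)" for j by (rule smooth_nth[OF y0(1)])
  \<comment> \<open>\<open>z\<close> has the desired values on the bumps, and \<open>h3\<close> restores the value of \<open>\<Lambda>1\<close>\<close>
  define z where "z j s = y0 s $ j - y0 s $ j * p1 s - y0 s $ j * p2 s + q $ j * p1 s" for j s
  define c where "c j = l j - \<Lambda>1 (z j)" for j
  define y where "y s = (\<chi> j. z j s + c j * h3 s)" for s
  have sz: "smooth (z j)" for j
    unfolding z_def[abs_def] by (intro smooth_add smooth_diff smooth_mult smooth_const s0 sm)
  have sy: "smooth y"
    unfolding y_def[abs_def] by (intro smooth_vec smooth_add smooth_mult smooth_const sz sm)
  have yt: "y t = q0" using y0(2) at by (simp add: y_def z_def vec_eq_iff)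
  have y1: "\<Lambda>1 (\<lambda>s. y s $ j) = l j" for j
    by (simp add: y_def L.\<Lambda>_add L.\<Lambda>_cmult L.D_smooth L.D_cmult sz sm h c_def)
  have y2: "\<Lambda>2 (\<lambda>s. y s $ j) = r j" for j
  proof -
    have "\<Lambda>2 (\<lambda>s. y0 s $ j * p1 s) = 0" "\<Lambda>2 (\<lambda>s. y0 s $ j * p2 s) = 0"
      "\<Lambda>2 (\<lambda>s. q $ j * p1 s) = 0" "\<Lambda>2 (\<lambda>s. c j * h3 s) = 0"
      by (intro R.\<Lambda>_Z' L.Z_mult Z s0 smooth_const)+
    then show ?thesis
      by (simp add: y_def z_def R.\<Lambda>_add R.\<Lambda>_diff R.D_smooth R.D_diff R.D_add s0 sm smooth_mult
          smooth_const y0(4))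
  qed
  define k where "k s = h1 s - h2 s" for s
  have sk: "smooth k" unfolding k_def[abs_def] by (intro smooth_diff sm)
  have k1: "\<Lambda>1 k = 0" unfolding k_def[abs_def] by (simp add: L.\<Lambda>_diff L.D_smooth sm h)
  have k2: "\<Lambda>2 k = 0"
    unfolding k_def[abs_def] using R.\<Lambda>_Z' Z by (simp add: R.\<Lambda>_diff R.D_smooth sm)
  have kt: "k t = 0" by (simp add: k_def at)
  define Y where "Y \<epsilon> s = y s + (\<epsilon> * k s) *\<^sub>R e" for \<epsilon> s
  have comp: "Y \<epsilon> s $ j = y s $ j + \<epsilon> * e $ j * k s" for \<epsilon> s j
    by (simp add: Y_def)
  have yj: "smooth (\<lambda>s. y s $ j)" for j by (rule smooth_nth[OF sy])
  have sY: "smooth (Y \<epsilon>)" for \<epsilon>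
    unfolding Y_def[abs_def] by (intro smooth_add smooth_scaleR smooth_mult smooth_const sy sk)
  let ?S = "\<lambda>\<epsilon>. \<Sum>j\<in>UNIV. \<xi> j * (c1 * of_real (\<Lambda>1 (\<lambda>s. X (Y \<epsilon> s) $ j)) + c2 * of_real (\<Lambda>2 (\<lambda>s. X (Y \<epsilon> s) $ j)))"
  have K: "?S \<epsilon> = K" for \<epsilon>
  proof (rule const[OF sY])
    show "Y \<epsilon> t = q0" by (simp add: Y_def yt kt)
    show "\<Lambda>1 (\<lambda>s. Y \<epsilon> s $ j) = l j" for j
      by (simp add: comp L.\<Lambda>_add L.\<Lambda>_cmult L.D_smooth L.D_cmult yj sk y1 k1)
    show "\<Lambda>2 (\<lambda>s. Y \<epsilon> s $ j) = r j" for j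
      by (simp add: comp R.\<Lambda>_add R.\<Lambda>_cmult R.D_smooth R.D_cmult yj sk y2 k2)
  qed
  let ?d = "\<lambda>q j. frechet_derivative (\<lambda>q. X q $ j) (at q) e"
  have der: "((\<lambda>\<epsilon>. \<Lambda>1 (\<lambda>s. X (Y \<epsilon> s) $ j)) has_real_derivative (?d q j - ?d 0 j)) (at 0)"
    "((\<lambda>\<epsilon>. \<Lambda>2 (\<lambda>s. X (Y \<epsilon> s) $ j)) has_real_derivative 0) (at 0)" for j
  proof -
    define F where "F = (\<lambda>w. X (y (snd w) + (fst w * k (snd w)) *\<^sub>R e) $ j)"
    have Xj: "smooth (\<lambda>q. X q $ j)" by (rule smooth_nth[OF X])
    have F: "smooth F"
      unfolding F_def
      by (intro smooth_compose[OF Xj] smooth_add smooth_scaleR smooth_mult smooth_const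
          smooth_compose[OF sy] smooth_compose[OF sk] smooth_fst smooth_snd smooth_ident)
    have "pd1 F (0, s) = ?d q j * h1 s - ?d 0 j * h2 s" for s
    proof -
      have "((\<lambda>\<epsilon>. y s + (\<epsilon> * k s) *\<^sub>R e) has_derivative (\<lambda>\<epsilon>. (\<epsilon> * k s) *\<^sub>R e)) (at 0)"
        by (auto intro!: derivative_eq_intros)
      then have "((\<lambda>\<epsilon>. F (\<epsilon>, s)) has_derivative
          (\<lambda>\<epsilon>. frechet_derivative (\<lambda>q. X q $ j) (at (y s)) ((\<epsilon> * k s) *\<^sub>R e))) (at 0)"
        unfolding F_def fst_conv snd_conv
        by (rule has_derivative_compose[where g = "\<lambda>q. X q $ j"])
          (use smooth_has_derivative[OF Xj, of "y s"] in simp)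
      then have "((\<lambda>\<epsilon>. F (\<epsilon>, s)) has_real_derivative k s * ?d (y s) j) (at 0)"
        using linear_cmul[OF has_derivative_linear[OF smooth_has_derivative[OF Xj, of "y s"]]]
        by (simp add: has_field_derivative_def mult.assoc mult_commute_abs[of "k s * _"])
      then have "pd1 F (0, s) = k s * ?d (y s) j"
        using has_pd1[OF F] DERIV_unique by blast
      also have "\<dots> = ?d q j * h1 s - ?d 0 j * h2 s"
      proof -
        have "y s = q" if "h1 s \<noteq> 0"
          using that p(1)[of s] p(4)[of s] p(5)[of s] by (simp add: y_def z_def vec_eq_iff)
        moreover have "y s = 0" if "h2 s \<noteq> 0"
          using that p(2)[of s] p(3)[of s] p(6)[of s] by (simp add: y_def z_def vec_eq_iff)
        moreover have "h1 s = 0 \<or> h2 s = 0" using p(1)[of s] p(3)[of s] by auto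
        ultimately show ?thesis
          by (cases "h1 s = 0"; cases "h2 s = 0") (simp_all add: k_def)
      qed
      finally show ?thesis .
    qed
    then have eq: "(\<lambda>s. pd1 F (0, s)) = (\<lambda>s. ?d q j * h1 s - ?d 0 j * h2 s)" by auto
    have "\<Lambda>1 (\<lambda>s. ?d q j * h1 s - ?d 0 j * h2 s) = ?d q j - ?d 0 j"
      by (simp add: L.\<Lambda>_diff L.\<Lambda>_cmult L.D_smooth L.D_cmult sm h)
    then show "((\<lambda>\<epsilon>. \<Lambda>1 (\<lambda>s. X (Y \<epsilon> s) $ j)) has_real_derivative (?d q j - ?d 0 j)) (at 0)"
      using L.\<Lambda>_parameter[OF F, of 0] unfolding eq by (simp add: F_def Y_def)
    have "\<Lambda>2 (\<lambda>s. ?d q j * h1 s - ?d 0 j * h2 s) = 0"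
      using R.\<Lambda>_Z' Z by (simp add: R.\<Lambda>_diff R.\<Lambda>_cmult R.D_smooth R.D_cmult sm)
    then show "((\<lambda>\<epsilon>. \<Lambda>2 (\<lambda>s. X (Y \<epsilon> s) $ j)) has_real_derivative 0) (at 0)"
      using R.\<Lambda>_parameter[OF F, of 0] unfolding eq by (simp add: F_def Y_def)
  qed
  have "(?S has_vector_derivative
     (\<Sum>j\<in>UNIV. \<xi> j * (c1 * of_real (?d q j - ?d 0 j) + c2 * of_real 0))) (at 0)"
    by (intro has_vector_derivative_sum has_vector_derivative_mult_right has_vector_derivative_add
        has_vector_derivative_of_real)
      (use der in \<open>simp_all only: has_real_derivative_iff_has_vector_derivative\<close>)
  moreover have "(?S has_vector_derivative 0) (at 0)"
    by (simp add: K)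
  ultimately show ?thesis
    using vector_derivative_unique_at by fastforce
qed

text \<open>With memory, the weighted field is affine, and \<open>\<Lambda>1\<close> takes on it a value determined by the
  values of \<open>\<Lambda>1\<close> on the components of the curve. Without memory, \<open>\<Lambda>1\<close> depends on the jet at \<open>t\<close>
  only, and the composed curves have the same jet.\<close>

lemma functional_of_composition_eq:
  fixes X :: "real^'n \<Rightarrow> real^'n" and \<xi> :: "'n \<Rightarrow> complex" and c1 c2 K :: complex
  assumes X: "smooth X"
    and y0: "smooth y0" "y0 t = q0" "\<And>j. \<Lambda>1 (\<lambda>s. y0 s $ j) = l j" "\<And>j. \<Lambda>2 (\<lambda>s. y0 s $ j) = r j"
    and x: "\<And>j. D1 (\<lambda>s. x s $ j)" "\<And>j. D1 (\<lambda>s. X (x s) $ j)" "\<And>j. \<Lambda>1 (\<lambda>s. x s $ j) = l j"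
    and xy: "m1 > 0 \<Longrightarrow> vanishes_to_order m1 t (\<lambda>s. x s - y0 s)"
    and const: "\<And>y. smooth y \<Longrightarrow> y t = q0 \<Longrightarrow> (\<And>j. \<Lambda>1 (\<lambda>s. y s $ j) = l j) \<Longrightarrow>
      (\<And>j. \<Lambda>2 (\<lambda>s. y s $ j) = r j) \<Longrightarrow>
      (\<Sum>j\<in>UNIV. \<xi> j * (c1 * of_real (\<Lambda>1 (\<lambda>s. X (y s) $ j)) + c2 * of_real (\<Lambda>2 (\<lambda>s. X (y s) $ j)))) = K"
  shows "(\<Sum>j\<in>UNIV. \<xi> j * (c1 * of_real (\<Lambda>1 (\<lambda>s. X (x s) $ j)))) =
    (\<Sum>j\<in>UNIV. \<xi> j * (c1 * of_real (\<Lambda>1 (\<lambda>s. X (y0 s) $ j))))"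
proof (cases "m1 = 0")
  case False
  have "\<Lambda>1 (\<lambda>s. X (x s) $ j) = \<Lambda>1 (\<lambda>s. X (y0 s) $ j)" for j
  proof -
    have Dy: "D1 (\<lambda>s. X (y0 s) $ j)"
      by (intro L.D_smooth smooth_nth smooth_compose[OF X] y0)
    have "vanishes_to_order m1 t (\<lambda>s. X (x s) $ j - X (y0 s) $ j)"
      by (rule vanishes_to_order_compose[OF smooth_nth[OF X]])
        (use y0 xy False smooth_ident in auto)
    then have "\<Lambda>1 (\<lambda>s. X (x s) $ j - X (y0 s) $ j) = 0"
      using L.jet False L.D_diff[OF x(2) Dy] by (simp add: jet_functional_def)
    then show ?thesis using L.\<Lambda>_diff[OF x(2) Dy] by simp
  qed
  then show ?thesis by simp
next
  case True
  let ?d = "\<lambda>q j. frechet_derivative (\<lambda>q. X q $ j) (at q)"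
  have Xj: "smooth (\<lambda>q. X q $ j)" for j by (rule smooth_nth[OF X])
  have rigid: "(\<Sum>j\<in>UNIV. \<xi> j * (c1 * of_real (?d q j e - ?d 0 j e))) = 0" for q e
    by (rule derivative_rigidity[OF True X y0]) (fact const)
  have affine: "(\<Sum>j\<in>UNIV. w j * \<Lambda>1 (\<lambda>s. X (x s) $ j)) = (\<Sum>j\<in>UNIV. w j * \<Lambda>1 (\<lambda>s. X (y0 s) $ j))"
    if w: "\<And>q e. (\<Sum>j\<in>UNIV. w j * (?d q j e - ?d 0 j e)) = 0" for w :: "'n \<Rightarrow> real"
  proof -
    let ?G = "\<lambda>q. \<Sum>j\<in>UNIV. w j * X q $ j" and ?T = "\<lambda>e. \<Sum>j\<in>UNIV. w j * ?d 0 j e"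
    have linT: "linear ?T"
    proof (intro linear_compose_sum ballI)
      show "linear (\<lambda>e. w j * ?d 0 j e)" for j
        using linear_compose_scale_right[OF has_derivative_linear[OF smooth_has_derivative[OF Xj]], of "w j"]
        by simp
    qed
    have "((\<lambda>q. ?G q - ?T q) has_derivative (\<lambda>e. 0)) (at q within UNIV)" for q
    proof -
      have "(?G has_derivative (\<lambda>e. \<Sum>j\<in>UNIV. w j * ?d q j e)) (at q)"
        by (intro has_derivative_sum has_derivative_mult_right smooth_has_derivative Xj)
      then have "((\<lambda>q. ?G q - ?T q) has_derivative (\<lambda>e. (\<Sum>j\<in>UNIV. w j * ?d q j e) - ?T e)) (at q)"
        by (intro has_derivative_diff linear_imp_has_derivative linT)
      moreover have "(\<Sum>j\<in>UNIV. w j * ?d q j e) - ?T e = 0" for e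
        using w[of q e] by (simp add: right_diff_distrib sum_subtractf)
      ultimately show ?thesis by simp
    qed
    then obtain C where C: "\<And>q. ?G q - ?T q = C"
      using has_derivative_zero_constant[of UNIV "\<lambda>q. ?G q - ?T q"] by auto
    have G: "?G q = C * 1 + (\<Sum>i\<in>UNIV. ?T (axis i 1) * q $ i)" for q
    proof -
      have "?T q = ?T (\<Sum>i\<in>UNIV. q $ i *\<^sub>R axis i 1)"
        by (simp only: basis_expansion flip: scalar_mult_eq_scaleR)
      also have "\<dots> = (\<Sum>i\<in>UNIV. q $ i *\<^sub>R ?T (axis i 1))"
        by (simp only: linear_sum[OF linT] linear_cmul[OF linT])
      finally show ?thesis using C[of q] by (simp add: mult.commute)
    qed
    have "(\<Sum>j\<in>UNIV. w j * \<Lambda>1 (\<lambda>s. X (u s) $ j)) =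
        C * \<Lambda>1 (\<lambda>_. 1) + (\<Sum>i\<in>UNIV. ?T (axis i 1) * l i)"
      if u: "\<And>j. D1 (\<lambda>s. u s $ j)" "\<And>j. D1 (\<lambda>s. X (u s) $ j)" "\<And>j. \<Lambda>1 (\<lambda>s. u s $ j) = l j" for u
    proof -
      have "(\<Sum>j\<in>UNIV. w j * \<Lambda>1 (\<lambda>s. X (u s) $ j)) = \<Lambda>1 (\<lambda>s. ?G (u s))"
        by (simp add: L.\<Lambda>_sum L.\<Lambda>_cmult L.D_cmult u)
      also have "\<dots> = \<Lambda>1 (\<lambda>s. C * 1 + (\<Sum>i\<in>UNIV. ?T (axis i 1) * u s $ i))"
        by (simp only: G)
      also have "\<dots> = \<Lambda>1 (\<lambda>s. C * 1) + \<Lambda>1 (\<lambda>s. \<Sum>i\<in>UNIV. ?T (axis i 1) * u s $ i)"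
        by (intro L.\<Lambda>_add L.D_const L.D_sum L.D_cmult u)
      also have "\<dots> = C * \<Lambda>1 (\<lambda>_. 1) + (\<Sum>i\<in>UNIV. ?T (axis i 1) * l i)"
        by (subst L.\<Lambda>_cmult[OF L.D_const], subst L.\<Lambda>_sum)
          (simp_all add: L.\<Lambda>_cmult L.D_cmult u)
      finally show ?thesis .
    qed
    note eval_eq = this
    have "D1 (\<lambda>s. y0 s $ j)" "D1 (\<lambda>s. X (y0 s) $ j)" for j
      by (intro L.D_smooth smooth_nth smooth_compose[OF X] y0)+
    then show ?thesis by (simp only: eval_eq[OF x] eval_eq[OF _ _ y0(3)])
  qed
  have re_im_term: "Re (\<xi> j * (c1 * of_real v)) = Re (\<xi> j * c1) * v"
    "Im (\<xi> j * (c1 * of_real v)) = Im (\<xi> j * c1) * v" for j v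
    by (simp_all add: algebra_simps)
  have Re_Im: "Re (\<Sum>j\<in>UNIV. \<xi> j * (c1 * of_real (v j))) = (\<Sum>j\<in>UNIV. Re (\<xi> j * c1) * v j)"
    "Im (\<Sum>j\<in>UNIV. \<xi> j * (c1 * of_real (v j))) = (\<Sum>j\<in>UNIV. Im (\<xi> j * c1) * v j)" for v
    by (simp_all only: Re_sum Im_sum re_im_term)
  have "(\<Sum>j\<in>UNIV. Re (\<xi> j * c1) * (?d q j e - ?d 0 j e)) = 0"
    "(\<Sum>j\<in>UNIV. Im (\<xi> j * c1) * (?d q j e - ?d 0 j e)) = 0" for q e
    using arg_cong[OF rigid[of q e], of Re] arg_cong[OF rigid[of q e], of Im]
    by (simp_all only: Re_Im zero_complex.sel)
  from affine[OF this(1)] affine[OF this(2)] show ?thesis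
    by (simp only: complex_eq_iff Re_Im)
qed

end


section \<open>The infinitesimal generator of a one-parameter group\<close>

definition generator :: "(real \<Rightarrow> real^'n \<Rightarrow> real^'n) \<Rightarrow> real^'n \<Rightarrow> real^'n" where
  "generator \<phi> q = frechet_derivative (\<lambda>(s, y). \<phi> s y) (at (0, q)) (1, 0)"

lemma smooth_generator:
  assumes "one_parameter_group \<phi>"
  shows "smooth (generator \<phi>)"
proof -
  have "smooth (\<lambda>(s, y). \<phi> s y)" using assms by (simp add: one_parameter_group_def)
  from smooth_compose[OF smooth_partial[OF this] smooth_Pair[OF smooth_const smooth_ident]]
  show ?thesis by (simp add: generator_def[abs_def])
qed

lemma flow_has_derivative:
  assumes "one_parameter_group \<phi>"
  shows "((\<lambda>(s, y). \<phi> s y) has_derivative (\<lambda>(r, w). r *\<^sub>R generator \<phi> q + w)) (at (0, q))"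
proof -
  let ?\<Phi> = "\<lambda>(s, y). \<phi> s y"
  let ?d = "frechet_derivative ?\<Phi> (at (0, q))"
  have D: "(?\<Phi> has_derivative ?d) (at (0, q))"
    using assms by (intro smooth_has_derivative) (simp add: one_parameter_group_def)
  have "((\<lambda>y. ?\<Phi> (0, y)) has_derivative (\<lambda>w. ?d (0, w))) (at q)"
    by (rule has_derivative_compose[where f = "\<lambda>y. (0, y)" and g = ?\<Phi>, OF _ D])
      (auto intro!: derivative_eq_intros)
  moreover have "((\<lambda>y. ?\<Phi> (0, y)) has_derivative (\<lambda>w. w)) (at q)"
    using assms by (simp add: one_parameter_group_def)
  ultimately have w: "?d (0, w) = w" for w
    using has_derivative_unique by metis
  have "?d (r, w) = r *\<^sub>R generator \<phi> q + w" for r w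
  proof -
    have lin: "linear ?d" by (rule has_derivative_linear[OF D])
    have "?d (r, w) = ?d (r *\<^sub>R (1, 0) + (0, w))" by simp
    also have "\<dots> = r *\<^sub>R ?d (1, 0) + ?d (0, w)"
      by (simp only: linear_add[OF lin] linear_cmul[OF lin])
    finally show ?thesis by (simp add: generator_def w)
  qed
  then have "?d = (\<lambda>(r, w). r *\<^sub>R generator \<phi> q + w)" by auto
  with D show ?thesis by simp
qed

lemma flow_curve_has_derivative:
  assumes "one_parameter_group \<phi>"
    and "(g has_derivative g') (at 0)" "(h has_derivative h') (at 0)" "g 0 = 0"
  shows "((\<lambda>s. \<phi> (g s) (h s)) has_derivative (\<lambda>r. g' r *\<^sub>R generator \<phi> (h 0) + h' r)) (at 0)"
  using has_derivative_compose[OF has_derivative_Pair[OF assms(2,3)], of "\<lambda>(s, y). \<phi> s y"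
      "\<lambda>(r, w). r *\<^sub>R generator \<phi> (h 0) + w"] flow_has_derivative[OF assms(1), of "h 0"] assms(4)
  by simp

lemma flow_has_vector_derivative:
  assumes "one_parameter_group \<phi>"
  shows "((\<lambda>s. \<phi> s q) has_vector_derivative generator \<phi> q) (at 0)"
  using flow_curve_has_derivative[OF assms has_derivative_ident has_derivative_const, of q]
  by (simp add: has_vector_derivative_def)

lemma flow_inverse:
  assumes "one_parameter_group \<phi>"
  shows "\<phi> s (\<phi> (- s) q) = q" "\<phi> (- s) (\<phi> s q) = q"
  using assms unfolding one_parameter_group_def by (metis add.right_inverse comp_apply id_apply)
    (metis assms one_parameter_group_def add.left_inverse comp_apply id_apply)

lemma smooth_flow:
  fixes g :: "'a::euclidean_space \<Rightarrow> real"
  assumes "one_parameter_group \<phi>" "smooth g" "smooth h"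
  shows "smooth (\<lambda>z. \<phi> (g z) (h z))"
  using smooth_compose[of "\<lambda>(s, y). \<phi> s y" "\<lambda>z. (g z, h z)"] assms
  by (auto simp: one_parameter_group_def intro: smooth_Pair)


section \<open>Differentiating the invariance identity\<close>

lemma bounded_linear_cdot: "bounded_linear (cdot p)"
  unfolding cdot_def[abs_def]
  by (intro bounded_linear_sum bounded_linear_compose[OF bounded_linear_mult_right]
      bounded_linear_vec_nth)

lemma has_vector_derivative_vec:
  fixes f :: "real \<Rightarrow> complex^'n"
  assumes "\<And>j. ((\<lambda>s. f s $ j) has_vector_derivative D $ j) (at s)"
  shows "(f has_vector_derivative D) (at s)"
proof -
  have eq: "v = (\<Sum>j\<in>UNIV. axis j (v $ j))" for v :: "complex^'n"
    by (simp add: vec_eq_iff axis_def if_distrib cong: if_cong)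
  have "bounded_linear (axis j :: complex \<Rightarrow> complex^'n)" for j
  proof -
    have "linear (axis j :: complex \<Rightarrow> complex^'n)"
      by (rule linearI) (simp_all add: vec_eq_iff axis_def)
    then show ?thesis by (simp add: linear_conv_bounded_linear)
  qed
  then have "((\<lambda>s. \<Sum>j\<in>UNIV. axis j (f s $ j)) has_vector_derivative (\<Sum>j\<in>UNIV. axis j (D $ j))) (at s)"
    by (intro has_vector_derivative_sum bounded_linear.has_vector_derivative[OF _ assms])
  then show ?thesis by (simp only: eq[symmetric])
qed

context functional_pair
begin

definition velocity :: "complex \<Rightarrow> complex \<Rightarrow> (real \<Rightarrow> real^'n) \<Rightarrow> complex^'n" where
  "velocity c1 c2 y =
     (\<chi> j. c1 * of_real (\<Lambda>1 (\<lambda>s. y s $ j)) + c2 * of_real (\<Lambda>2 (\<lambda>s. y s $ j)))"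

text \<open>The key computation. In \<open>Lag q0 (velocity c1 c2 (Y s)) = Lag (\<phi> s q0) v\<close> only the velocity varies on the left and only
  the position on the right, so that the two separate differentiability assumptions suffice.\<close>

lemma noether_smooth_curve:
  fixes Lag :: "real^'n \<Rightarrow> complex^'n \<Rightarrow> complex"
  assumes \<phi>: "one_parameter_group \<phi>"
    and inv: "\<And>s y. smooth y \<Longrightarrow>
      Lag (y t) (velocity c1 c2 y) = Lag (\<phi> s (y t)) (velocity c1 c2 (\<lambda>\<tau>. \<phi> s (y \<tau>)))"
    and Ldv: "(Lag q0 has_derivative cdot \<xi>) (at v)"
    and Ldx: "((\<lambda>q. Lag q v) has_derivative A) (at q0)"
    and y: "smooth y" "y t = q0" "velocity c1 c2 y = v"
  shows "A (generator \<phi> q0) + cdot \<xi> (velocity c1 c2 (\<lambda>\<tau>. generator \<phi> (y \<tau>))) = 0"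
proof -
  let ?X = "generator \<phi>"
  note X = smooth_generator[OF \<phi>]
  obtain \<eta> where \<eta>: "smooth \<eta>" "\<eta> t = 1" "\<Lambda>1 \<eta> = 0" "\<Lambda>2 \<eta> = 0"
    by (rule exists_unit_with_null_derivatives)
  have yj: "smooth (\<lambda>s. y s $ j)" for j by (rule smooth_nth[OF y(1)])
  have \<phi>0: "\<phi> 0 q = q" for q using \<phi> by (simp add: one_parameter_group_def)
  \<comment> \<open>\<open>u s\<close> is at \<open>\<phi> s q0\<close> at time \<open>t\<close> with the velocity of \<open>y\<close>, and \<open>Y s\<close> is its pull-back by the flow\<close>
  define u where "u s \<tau> = y \<tau> + \<eta> \<tau> *\<^sub>R (\<phi> s q0 - q0)" for s \<tau>
  have su: "smooth (u s)" for s
    unfolding u_def[abs_def] by (intro smooth_add smooth_scaleR smooth_const y \<eta>)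
  have ut: "u s t = \<phi> s q0" for s by (simp add: u_def y \<eta>)
  have uv: "velocity c1 c2 (u s) = v" for s
  proof -
    have "(\<lambda>\<tau>. u s \<tau> $ j) = (\<lambda>\<tau>. y \<tau> $ j + (\<phi> s q0 - q0) $ j * \<eta> \<tau>)" for j
      by (simp add: u_def mult.commute)
    then have "\<Lambda>1 (\<lambda>\<tau>. u s \<tau> $ j) = \<Lambda>1 (\<lambda>\<tau>. y \<tau> $ j)" "\<Lambda>2 (\<lambda>\<tau>. u s \<tau> $ j) = \<Lambda>2 (\<lambda>\<tau>. y \<tau> $ j)" for j
      by (simp_all only: L.\<Lambda>_add L.\<Lambda>_cmult L.D_cmult L.D_smooth yj \<eta>
          R.\<Lambda>_add R.\<Lambda>_cmult R.D_cmult R.D_smooth mult_zero_right add_0_right)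
    then show ?thesis using y(3) by (simp add: velocity_def)
  qed
  define Y where "Y s \<tau> = \<phi> (- s) (u s \<tau>)" for s \<tau>
  have sY: "smooth (Y s)" for s
    unfolding Y_def[abs_def] by (intro smooth_flow[OF \<phi>] smooth_const su)
  have Yt: "Y s t = q0" for s by (simp add: Y_def ut flow_inverse[OF \<phi>])
  have \<phi>Y: "(\<lambda>\<tau>. \<phi> s (Y s \<tau>)) = u s" for s by (simp add: Y_def flow_inverse[OF \<phi>])
  have key: "Lag q0 (velocity c1 c2 (Y s)) = Lag (\<phi> s q0) v" for s
    using inv[OF sY, of s s] by (simp add: Yt \<phi>Y uv)
  let ?W = "velocity c1 c2 (\<lambda>\<tau>. ?X (y \<tau>))"
  have Y': "((\<lambda>s. velocity c1 c2 (Y s)) has_vector_derivative - ?W) (at 0)"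
  proof (rule has_vector_derivative_vec)
    fix j
    define F where "F = (\<lambda>z. \<phi> (- fst z) (y (snd z) + \<eta> (snd z) *\<^sub>R (\<phi> (fst z) q0 - q0)) $ j)"
    have F: "smooth F"
      unfolding F_def
      by (intro smooth_nth smooth_flow[OF \<phi>] smooth_add smooth_scaleR smooth_diff smooth_minus smooth_const
          smooth_compose[OF y(1)] smooth_compose[OF \<eta>(1)] smooth_fst smooth_snd smooth_ident)
    have "pd1 F (0, \<tau>) = ?X q0 $ j * \<eta> \<tau> - ?X (y \<tau>) $ j" for \<tau>
    proof -
      have 1: "((\<lambda>s::real. - s) has_derivative (\<lambda>r. - r)) (at 0)"
        by (auto intro!: derivative_eq_intros)
      have 2: "((\<lambda>s. \<phi> s q0) has_derivative (\<lambda>r. r *\<^sub>R ?X q0)) (at 0)"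
        using flow_has_vector_derivative[OF \<phi>, of q0] by (simp add: has_vector_derivative_def)
      have "((\<lambda>s. y \<tau> + \<eta> \<tau> *\<^sub>R (\<phi> s q0 - q0)) has_derivative (\<lambda>r. \<eta> \<tau> *\<^sub>R (r *\<^sub>R ?X q0))) (at 0)"
        by (auto intro!: derivative_eq_intros 2)
      from flow_curve_has_derivative[OF \<phi> 1 this]
      have "((\<lambda>s. \<phi> (- s) (y \<tau> + \<eta> \<tau> *\<^sub>R (\<phi> s q0 - q0))) has_derivative
          (\<lambda>r. (- r) *\<^sub>R ?X (y \<tau>) + \<eta> \<tau> *\<^sub>R (r *\<^sub>R ?X q0))) (at 0)"
        by (simp add: \<phi>0)
      from bounded_linear.has_derivative[OF bounded_linear_vec_nth this, of j]
      have "((\<lambda>s. F (s, \<tau>)) has_derivative (\<lambda>r. (?X q0 $ j * \<eta> \<tau> - ?X (y \<tau>) $ j) * r)) (at 0)"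
        by (simp add: F_def algebra_simps)
      then have "((\<lambda>s. F (s, \<tau>)) has_real_derivative ?X q0 $ j * \<eta> \<tau> - ?X (y \<tau>) $ j) (at 0)"
        by (simp add: has_field_derivative_def)
      then show ?thesis using has_pd1[OF F] DERIV_unique by blast
    qed
    then have eq: "(\<lambda>\<tau>. pd1 F (0, \<tau>)) = (\<lambda>\<tau>. ?X q0 $ j * \<eta> \<tau> - ?X (y \<tau>) $ j)" by auto
    have sX: "smooth (\<lambda>\<tau>. ?X (y \<tau>) $ j)" by (intro smooth_nth smooth_compose[OF X] y)
    have FY: "F (s, \<tau>) = Y s \<tau> $ j" for s \<tau> by (simp add: F_def Y_def u_def)
    have "((\<lambda>s. \<Lambda>1 (\<lambda>\<tau>. Y s \<tau> $ j)) has_real_derivative - \<Lambda>1 (\<lambda>\<tau>. ?X (y \<tau>) $ j)) (at 0)"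
      using L.\<Lambda>_parameter[OF F, of 0] unfolding eq FY
      by (simp add: L.\<Lambda>_diff L.\<Lambda>_cmult L.D_cmult L.D_smooth sX \<eta>)
    moreover have "((\<lambda>s. \<Lambda>2 (\<lambda>\<tau>. Y s \<tau> $ j)) has_real_derivative - \<Lambda>2 (\<lambda>\<tau>. ?X (y \<tau>) $ j)) (at 0)"
      using R.\<Lambda>_parameter[OF F, of 0] unfolding eq FY
      by (simp add: R.\<Lambda>_diff R.\<Lambda>_cmult R.D_cmult R.D_smooth sX \<eta>)
    ultimately have "((\<lambda>s. c1 * of_real (\<Lambda>1 (\<lambda>\<tau>. Y s \<tau> $ j)) + c2 * of_real (\<Lambda>2 (\<lambda>\<tau>. Y s \<tau> $ j)))
      has_vector_derivative c1 * of_real (- \<Lambda>1 (\<lambda>\<tau>. ?X (y \<tau>) $ j)) +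
        c2 * of_real (- \<Lambda>2 (\<lambda>\<tau>. ?X (y \<tau>) $ j))) (at 0)"
      by (intro has_vector_derivative_mult_right has_vector_derivative_add has_vector_derivative_of_real)
        (simp_all only: has_real_derivative_iff_has_vector_derivative)
    then show "((\<lambda>s. velocity c1 c2 (Y s) $ j) has_vector_derivative (- ?W) $ j) (at 0)"
      by (simp add: velocity_def)
  qed
  have Y0: "velocity c1 c2 (Y 0) = v"
  proof -
    have "Y 0 = y" by (simp add: fun_eq_iff Y_def u_def \<phi>0)
    then show ?thesis using y by simp
  qed
  have right: "((\<lambda>s. Lag q0 (velocity c1 c2 (Y s))) has_derivative (\<lambda>r. cdot \<xi> (r *\<^sub>R - ?W))) (at 0)"
    using has_derivative_compose[OF Y'[unfolded has_vector_derivative_def], of "Lag q0" "cdot \<xi>"] Ldv Y0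
    by simp
  have left: "((\<lambda>s. Lag (\<phi> s q0) v) has_derivative (\<lambda>r. A (r *\<^sub>R ?X q0))) (at 0)"
    by (rule has_derivative_compose[where g = "\<lambda>q. Lag q v" and f = "\<lambda>s. \<phi> s q0"])
      (use Ldx flow_has_vector_derivative[OF \<phi>, of q0] in \<open>simp_all add: \<phi>0 has_vector_derivative_def\<close>)
  have "cdot \<xi> (1 *\<^sub>R - ?W) = A (1 *\<^sub>R ?X q0)"
    by (rule fun_cong[OF has_derivative_unique[OF right[unfolded key] left]])
  then have "A (?X q0) = - cdot \<xi> ?W"
    using linear_neg[OF bounded_linear.linear[OF bounded_linear_cdot], of \<xi> ?W] by simp
  then show ?thesis by simp
qed

text \<open>For a rough curve \<open>x\<close>, the smooth approximant \<open>y0\<close> satisfies the identity, and the one-sided derivatives of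
  \<open>X \<circ> x\<close> and \<open>X \<circ> y0\<close>, multiplied by \<open>c1\<close> and \<open>c2\<close>, agree after pairing with \<open>\<xi>\<close>. The right side is the left side of the pair with its
  two functionals exchanged.\<close>

theorem noether_abstract:
  fixes Lag :: "real^'n \<Rightarrow> complex^'n \<Rightarrow> complex"
  assumes \<phi>: "one_parameter_group \<phi>"
    and inv: "\<And>s y. smooth y \<Longrightarrow>
      Lag (y t) (velocity c1 c2 y) = Lag (\<phi> s (y t)) (velocity c1 c2 (\<lambda>\<tau>. \<phi> s (y \<tau>)))"
    and Ldv: "(Lag (x t) has_derivative cdot \<xi>) (at (velocity c1 c2 x))"
    and Ldx: "((\<lambda>q. Lag q (velocity c1 c2 x)) has_derivative A) (at (x t))"
    and x: "\<And>j. D1 (\<lambda>s. x s $ j)" "\<And>j. D2 (\<lambda>s. x s $ j)"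
    and Xx: "\<And>j. D1 (\<lambda>s. generator \<phi> (x s) $ j)" "\<And>j. D2 (\<lambda>s. generator \<phi> (x s) $ j)"
  shows "A (generator \<phi> (x t)) + cdot \<xi> (velocity c1 c2 (\<lambda>\<tau>. generator \<phi> (x \<tau>))) = 0"
proof -
  let ?X = "generator \<phi>"
  note X = smooth_generator[OF \<phi>]
  have approx: "\<exists>g. smooth g \<and> g t = x t $ j \<and> \<Lambda>1 g = \<Lambda>1 (\<lambda>s. x s $ j) \<and> \<Lambda>2 g = \<Lambda>2 (\<lambda>s. x s $ j) \<and>
      (m1 > 0 \<longrightarrow> vanishes_to_order m1 t (\<lambda>s. x s $ j - g s)) \<and>
      (m2 > 0 \<longrightarrow> vanishes_to_order m2 t (\<lambda>s. x s $ j - g s))" for j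
    by (rule exists_smooth_approximant[OF x(1)[of j] x(2)[of j]]) blast
  from approx have "\<forall>j. \<exists>g. smooth g \<and> g t = x t $ j \<and> \<Lambda>1 g = \<Lambda>1 (\<lambda>s. x s $ j) \<and> \<Lambda>2 g = \<Lambda>2 (\<lambda>s. x s $ j) \<and>
      (m1 > 0 \<longrightarrow> vanishes_to_order m1 t (\<lambda>s. x s $ j - g s)) \<and>
      (m2 > 0 \<longrightarrow> vanishes_to_order m2 t (\<lambda>s. x s $ j - g s))" by blast
  from choice[OF this] obtain g where g: "\<And>j. smooth (g j)" "\<And>j. g j t = x t $ j"
    "\<And>j. \<Lambda>1 (g j) = \<Lambda>1 (\<lambda>s. x s $ j)" "\<And>j. \<Lambda>2 (g j) = \<Lambda>2 (\<lambda>s. x s $ j)"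
    "\<And>j. m1 > 0 \<Longrightarrow> vanishes_to_order m1 t (\<lambda>s. x s $ j - g j s)"
    "\<And>j. m2 > 0 \<Longrightarrow> vanishes_to_order m2 t (\<lambda>s. x s $ j - g j s)"
    by blast
  define y0 where "y0 s = (\<chi> j. g j s)" for s
  have y0: "smooth y0" "y0 t = x t" "\<And>j. \<Lambda>1 (\<lambda>s. y0 s $ j) = \<Lambda>1 (\<lambda>s. x s $ j)"
    "\<And>j. \<Lambda>2 (\<lambda>s. y0 s $ j) = \<Lambda>2 (\<lambda>s. x s $ j)"
    using g by (simp_all add: y0_def[abs_def] smooth_vec vec_eq_iff)
  have v1: "vanishes_to_order m1 t (\<lambda>s. x s - y0 s)" if "m1 > 0"
    by (rule vanishes_to_order_vec) (use g(5)[OF that] in \<open>simp add: y0_def\<close>)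
  have v2: "vanishes_to_order m2 t (\<lambda>s. x s - y0 s)" if "m2 > 0"
    by (rule vanishes_to_order_vec) (use g(6)[OF that] in \<open>simp add: y0_def\<close>)
  let ?K = "- A (?X (x t))"
  have const: "(\<Sum>j\<in>UNIV. \<xi> $ j * (c1 * of_real (\<Lambda>1 (\<lambda>s. ?X (y s) $ j)) +
      c2 * of_real (\<Lambda>2 (\<lambda>s. ?X (y s) $ j)))) = ?K"
    if "smooth y" "y t = x t" "\<And>j. \<Lambda>1 (\<lambda>s. y s $ j) = \<Lambda>1 (\<lambda>s. x s $ j)"
      "\<And>j. \<Lambda>2 (\<lambda>s. y s $ j) = \<Lambda>2 (\<lambda>s. x s $ j)" for y
  proof -
    have "velocity c1 c2 y = velocity c1 c2 x" using that by (simp add: velocity_def)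
    from noether_smooth_curve[OF \<phi> inv Ldv Ldx that(1,2) this]
    show ?thesis by (simp add: velocity_def cdot_def eq_neg_iff_add_eq_0 add.commute)
  qed
  have s1: "(\<Sum>j\<in>UNIV. \<xi> $ j * (c1 * of_real (\<Lambda>1 (\<lambda>s. ?X (x s) $ j)))) =
    (\<Sum>j\<in>UNIV. \<xi> $ j * (c1 * of_real (\<Lambda>1 (\<lambda>s. ?X (y0 s) $ j))))"
    by (rule functional_of_composition_eq[OF X y0 x(1) Xx(1) refl]) (fact v1, fact const)
  have s2: "(\<Sum>j\<in>UNIV. \<xi> $ j * (c2 * of_real (\<Lambda>2 (\<lambda>s. ?X (x s) $ j)))) =
    (\<Sum>j\<in>UNIV. \<xi> $ j * (c2 * of_real (\<Lambda>2 (\<lambda>s. ?X (y0 s) $ j))))"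
  proof (rule functional_pair.functional_of_composition_eq[OF swap X y0(1,2,4,3) x(2) Xx(2) refl])
    show "m2 > 0 \<Longrightarrow> vanishes_to_order m2 t (\<lambda>s. x s - y0 s)" by (fact v2)
    fix y assume "smooth y" "y t = x t" "\<And>j. \<Lambda>2 (\<lambda>s. y s $ j) = \<Lambda>2 (\<lambda>s. x s $ j)"
      "\<And>j. \<Lambda>1 (\<lambda>s. y s $ j) = \<Lambda>1 (\<lambda>s. x s $ j)"
    from const[OF this(1,2,4,3)]
    show "(\<Sum>j\<in>UNIV. \<xi> $ j * (c2 * of_real (\<Lambda>2 (\<lambda>s. ?X (y s) $ j)) +
      c1 * of_real (\<Lambda>1 (\<lambda>s. ?X (y s) $ j)))) = ?K"
      by (simp add: add.commute)
  qed
  have "cdot \<xi> (velocity c1 c2 (\<lambda>\<tau>. ?X (x \<tau>))) = cdot \<xi> (velocity c1 c2 (\<lambda>\<tau>. ?X (y0 \<tau>)))"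
    using s1 s2 by (simp add: cdot_def velocity_def distrib_left sum.distrib)
  also have "\<dots> = ?K"
    using const[OF y0] by (simp add: cdot_def velocity_def)
  finally show ?thesis by simp
qed

end


section \<open>The Riemann--Liouville functionals\<close>

lemma past_supportedI:
  assumes "smooth f" "d < t" "\<And>s. s \<notin> {c..d} \<Longrightarrow> f s = 0"
  shows "past_supported t f"
  unfolding past_supported_def
  using assms by (intro conjI exI[of _ "(d + t) / 2"]) auto

text \<open>Bumps on three disjoint intervals of the past, normalised by their non-zero derivatives at \<open>t\<close>.\<close>

lemma steerable_left_RL:
  assumes at: "a < t" and \<alpha>: "\<alpha> > 0" "\<nexists>m. \<alpha> = real m"
  shows "steerable (past_supported t) (\<lambda>f. left_RL a \<alpha> f t)"
proof -
  \<comment> \<open>three disjoint intervals between \<open>a\<close> and \<open>t\<close>\<close>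
  define c where "c i = a + (t - a) * (2 * real i + 1) / 8" for i :: nat
  define d where "d i = a + (t - a) * (2 * real i + 2) / 8" for i :: nat
  have cd: "a < c i" "c i < d i" for i
  proof -
    have "(t - a) * (2 * real i + 1) < (t - a) * (2 * real i + 2)"
      using at by (intro mult_strict_left_mono) auto
    then show "c i < d i" by (simp add: c_def d_def)
    show "a < c i" using at by (simp add: c_def)
  qed
  have dt: "d i < t" if "i < 3" for i
  proof -
    have "(t - a) * (2 * real i + 2) < (t - a) * 8"
      using at that by (intro mult_strict_left_mono) auto
    then show ?thesis by (simp add: d_def)
  qed
  have dc: "d i < c j" if "i < j" for i j
  proof -
    have "(t - a) * (2 * real i + 2) < (t - a) * (2 * real j + 1)"
      using at that by (intro mult_strict_left_mono) auto
    then show ?thesis by (simp add: c_def d_def)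
  qed
  have "\<exists>ph :: (real \<Rightarrow> real) \<times> (real \<Rightarrow> real). smooth (fst ph) \<and> smooth (snd ph) \<and>
     left_RL a \<alpha> (snd ph) t = 1 \<and> (\<forall>s. fst ph s * snd ph s = snd ph s) \<and>
     (\<forall>s. s \<notin> {c i..d i} \<longrightarrow> fst ph s = 0) \<and> (\<forall>s. s \<notin> {c i..d i} \<longrightarrow> snd ph s = 0)"
    if "i < 3" for i
  proof -
    obtain p h :: "real \<Rightarrow> real" where ph: "smooth p" "smooth h" "\<And>s. p s * h s = h s"
      "\<And>s. s \<notin> {c i..d i} \<Longrightarrow> p s = 0" "\<And>s. s \<notin> {c i..d i} \<Longrightarrow> h s = 0"
      "\<And>s. h s \<ge> 0" "\<exists>s. h s \<noteq> 0"
      using smooth_plateau[OF cd(2)[of i]] by metis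
    let ?N = "left_RL a \<alpha> h t"
    have N: "?N \<noteq> 0"
      by (rule left_RL_bump_nonzero[OF \<alpha> ph(2) cd(1) dt[OF that] ph(5-7)])
    have "left_RL a \<alpha> (\<lambda>s. inverse ?N * h s) t = inverse ?N * ?N"
      using left_RL_linear(2)[OF bounded_linear_mult_right left_RL_smooth(1)[OF ph(2) \<alpha>(1)],
          of t a "t + 1" "inverse ?N"] at by simp
    then show ?thesis
      using N ph by (intro exI[of _ "(p, \<lambda>s. inverse ?N * h s)"])
        (auto intro: smooth_mult simp: mult.left_commute)
  qed
  then have "\<forall>i\<in>{..<3}. \<exists>ph :: (real \<Rightarrow> real) \<times> (real \<Rightarrow> real). smooth (fst ph) \<and> smooth (snd ph) \<and>
     left_RL a \<alpha> (snd ph) t = 1 \<and> (\<forall>s. fst ph s * snd ph s = snd ph s) \<and>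
     (\<forall>s. s \<notin> {c i..d i} \<longrightarrow> fst ph s = 0) \<and> (\<forall>s. s \<notin> {c i..d i} \<longrightarrow> snd ph s = 0)"
    by (intro ballI) (simp only: lessThan_iff)
  from bchoice[OF this] obtain ph :: "nat \<Rightarrow> (real \<Rightarrow> real) \<times> (real \<Rightarrow> real)"
    where ph: "\<forall>i\<in>{..<3}. smooth (fst (ph i)) \<and> smooth (snd (ph i)) \<and>
     left_RL a \<alpha> (snd (ph i)) t = 1 \<and> (\<forall>s. fst (ph i) s * snd (ph i) s = snd (ph i) s) \<and>
     (\<forall>s. s \<notin> {c i..d i} \<longrightarrow> fst (ph i) s = 0) \<and> (\<forall>s. s \<notin> {c i..d i} \<longrightarrow> snd (ph i) s = 0)"
    by blast
  have one: "left_RL a \<alpha> (snd (ph i)) t = 1" "fst (ph i) s * snd (ph i) s = snd (ph i) s"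
    and out: "s \<notin> {c i..d i} \<Longrightarrow> fst (ph i) s = 0" "s \<notin> {c i..d i} \<Longrightarrow> snd (ph i) s = 0"
    and sm: "smooth (fst (ph i))" "smooth (snd (ph i))" if "i < 3" for i s
    using bspec[OF ph, of i] that unfolding lessThan_iff by blast+
  have Z: "past_supported t (fst (ph i))" "past_supported t (snd (ph i))" if "i < 3" for i
    by (rule past_supportedI[OF _ dt[OF that]], use sm out that in blast, use out that in blast)+
  have disj: "s \<notin> {c i..d i} \<or> s \<notin> {c j..d j}" if "i \<noteq> j" for i j s
    using dc[of i j] dc[of j i] that by (cases "i < j") auto
  have zero: "fst (ph i) s * snd (ph j) s = 0" "snd (ph i) s * snd (ph j) s = 0"
    if "i < 3" "j < 3" "i \<noteq> j" for i j s
    using disj[OF that(3), of s] out[OF that(1)] out[OF that(2)] by fastforce+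
  show ?thesis
    unfolding steerable_def
    by (rule exI[of _ "fst (ph 0)"], rule exI[of _ "fst (ph 1)"], rule exI[of _ "snd (ph 0)"],
        rule exI[of _ "snd (ph 1)"], rule exI[of _ "snd (ph 2)"])
      (use Z one zero in \<open>simp add: numeral_eq_Suc\<close>)
qed

lemma jet_functional_left_RL:
  assumes t: "t \<in> {a<..<b}" and m: "m > 0"
  shows "jet_functional t (\<lambda>f. continuous_on {a..b} f \<and> left_RL_exists a b (real m) f)
    (\<lambda>f. left_RL a (real m) f t) m"
  unfolding jet_functional_def
proof (intro conjI allI impI)
  have m1: "m \<ge> 1" using m by simp
  have "(Dt ^^ Suc k) (\<lambda>_. 1 :: real) = (\<lambda>_. 0)" for k
    by (induction k) (simp_all add: Dt_def[abs_def])
  then have "(Dt ^^ m) (\<lambda>_. 1 :: real) t = 0" using m by (metis gr0_conv_Suc)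
  then show "left_RL a (real m) (\<lambda>_. 1 :: real) t = 0"
    using left_RL_integer_order(2)[OF continuous_on_const left_RL_smooth(1)[OF smooth_const] t] m
    by simp
next
  fix f :: "real \<Rightarrow> real"
  assume f: "continuous_on {a..b} f \<and> left_RL_exists a b (real m) f"
  then have n: "n_times_differentiable_on_interval m f a b"
    by (intro left_RL_integer_order(1)) auto
  obtain P where P: "smooth P" "\<And>k. k \<le> m \<Longrightarrow> (Dt ^^ k) P t = (Dt ^^ k) f t"
    using exists_smooth_with_jet[of m t f] by auto
  have nP: "n_times_differentiable_on_interval m (\<lambda>s. - P s) a b"
    by (intro smooth_n_times_differentiable smooth_minus P)
  have "vanishes_to_order m t (\<lambda>s. f s + - P s)"
  proof (rule vanishes_to_order_if_jet_0[OF _ n_times_differentiable_add(1)[OF n nP] t])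
    fix k assume k: "k \<le> m"
    have "(Dt ^^ k) (\<lambda>s. - P s) t = - (Dt ^^ k) P t"
      by (rule n_times_differentiable_linear(2)[OF bounded_linear_minus[OF bounded_linear_ident]
            smooth_n_times_differentiable[OF P(1)] k t])
    then show "(Dt ^^ k) (\<lambda>s. f s + - P s) t = 0"
      using n_times_differentiable_add(2)[OF n nP k t] P(2)[OF k] by simp
  qed (use m in auto)
  then show "\<exists>P. smooth P \<and> vanishes_to_order m t (\<lambda>s. f s - P s)"
    using P by auto
next
  fix f :: "real \<Rightarrow> real"
  assume f: "continuous_on {a..b} f \<and> left_RL_exists a b (real m) f" and v: "vanishes_to_order m t f"
  then have n: "n_times_differentiable_on_interval m f a b"
    by (intro left_RL_integer_order(1)) auto
  show "left_RL a (real m) f t = 0"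
    using left_RL_integer_order(2)[OF _ _ t] f jet_0_if_vanishes_to_order[OF n t v _ order_refl] m by simp
qed

text \<open>The value 0 is free to mark the orders with memory, since only positive \<open>\<alpha>\<close> occur.\<close>

definition jet_order :: "real \<Rightarrow> nat" where
  "jet_order \<alpha> = (if \<exists>m. \<alpha> = real m then nat \<lfloor>\<alpha>\<rfloor> else 0)"

lemma left_RL_functional:
  assumes t: "t \<in> {a<..<b}" and \<alpha>: "\<alpha> > 0"
  shows "one_sided_functional t (\<lambda>f. continuous_on {a..b} f \<and> left_RL_exists a b \<alpha> f)
    (\<lambda>f. left_RL a \<alpha> f t) (past_supported t) (future_supported t) (jet_order \<alpha>)"
proof
  fix f g :: "real \<Rightarrow> real" and r :: real
  assume f: "continuous_on {a..b} f \<and> left_RL_exists a b \<alpha> f"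
    and g: "continuous_on {a..b} g \<and> left_RL_exists a b \<alpha> g"
  have rf: "left_RL_exists a b \<alpha> (\<lambda>s. r * f s)"
    "left_RL a \<alpha> (\<lambda>s. r * f s) t = r * left_RL a \<alpha> f t"
    using f t by (auto intro: left_RL_linear[OF bounded_linear_mult_right])
  show "continuous_on {a..b} (\<lambda>s. r * f s + g s) \<and> left_RL_exists a b \<alpha> (\<lambda>s. r * f s + g s)"
    using f g rf(1) by (intro conjI continuous_on_add continuous_on_mult_left left_RL_add(1)) auto
  show "left_RL a \<alpha> (\<lambda>s. r * f s + g s) t = r * left_RL a \<alpha> f t + left_RL a \<alpha> g t"
    using left_RL_add(2)[OF rf(1), of g t] g t by (simp add: rf(2))
next
  show "continuous_on {a..b} f \<and> left_RL_exists a b \<alpha> f" if "smooth f" for f :: "real \<Rightarrow> real"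
    using smooth_continuous_on left_RL_smooth(1) that \<alpha> by auto
next
  show "((\<lambda>s. left_RL a \<alpha> (\<lambda>\<tau>. F (s, \<tau>)) t) has_real_derivative
      left_RL a \<alpha> (\<lambda>\<tau>. pd1 F (s, \<tau>)) t) (at s)" if "smooth F" for F s
    by (rule left_RL_parameter_derivative[OF that \<alpha>]) (use t in auto)
next
  fix f g :: "real \<Rightarrow> real"
  assume f: "past_supported t f"
  then show "smooth f" by (simp add: past_supported_def)
  show "past_supported t (\<lambda>s. g s * f s)" if "smooth g"
    using f that by (auto simp: past_supported_def)
  obtain e where e: "e < t" "\<And>s. s \<ge> e \<Longrightarrow> f s = 0" using f by (auto simp: past_supported_def)
  have "\<forall>\<^sub>F s in nhds t. s \<in> {e<..}" by (intro eventually_nhds_in_open) (use e in auto)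
  then show "\<forall>\<^sub>F s in nhds t. f s = 0" by eventually_elim (use e in auto)
next
  show "past_supported t (\<lambda>_. 0)"
    by (auto simp: past_supported_def intro: exI[of _ "t - 1"])
next
  fix f assume "future_supported t f"
  then obtain e where "t < e" "\<And>s. s \<le> e \<Longrightarrow> f s = 0" by (auto simp: future_supported_def)
  then show "left_RL a \<alpha> f t = 0" using t by (intro left_RL_eq_0) auto
next
  assume "jet_order \<alpha> > 0"
  then obtain m where m: "\<alpha> = real m" by (auto simp: jet_order_def split: if_splits)
  then have "jet_order \<alpha> = m" by (simp add: jet_order_def)
  then show "jet_functional t (\<lambda>f. continuous_on {a..b} f \<and> left_RL_exists a b \<alpha> f)
    (\<lambda>f. left_RL a \<alpha> f t) (jet_order \<alpha>)"
    using jet_functional_left_RL[OF t, of m] m \<alpha> by simp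
next
  assume 0: "jet_order \<alpha> = 0"
  have "\<nexists>m. \<alpha> = real m"
  proof
    assume "\<exists>m. \<alpha> = real m"
    then obtain m where "\<alpha> = real m" by blast
    then show False using 0 \<alpha> by (simp add: jet_order_def)
  qed
  then show "steerable (past_supported t) (\<lambda>f. left_RL a \<alpha> f t)"
    using t \<alpha> by (intro steerable_left_RL) auto
qed

lemma past_supported_reflect: "past_supported (- t) (\<lambda>s. f (- s)) \<longleftrightarrow> future_supported t f"
  and future_supported_reflect: "future_supported (- t) (\<lambda>s. f (- s)) \<longleftrightarrow> past_supported t f"
proof -
  have sm: "smooth (\<lambda>s. f (- s)) \<longleftrightarrow> smooth f" for f :: "real \<Rightarrow> real"
    using smooth_compose[OF _ smooth_minus[OF smooth_ident], of f]
      smooth_compose[OF _ smooth_minus[OF smooth_ident], of "\<lambda>s. f (- s)"] by auto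
  have "(\<exists>e<(- t). \<forall>s\<ge>e. f (- s) = 0) \<longleftrightarrow> (\<exists>e>t. \<forall>s\<le>e. f s = 0)"
    by (metis minus_less_iff minus_le_iff minus_minus neg_less_iff_less neg_le_iff_le)
  then show "past_supported (- t) (\<lambda>s. f (- s)) \<longleftrightarrow> future_supported t f"
    by (simp add: past_supported_def future_supported_def sm)
  have "(\<exists>e>(- t). \<forall>s\<le>e. f (- s) = 0) \<longleftrightarrow> (\<exists>e<t. \<forall>s\<ge>e. f s = 0)"
    by (metis minus_less_iff minus_le_iff minus_minus neg_less_iff_less neg_le_iff_le)
  then show "future_supported (- t) (\<lambda>s. f (- s)) \<longleftrightarrow> past_supported t f"
    by (simp add: past_supported_def future_supported_def sm)
qed

lemma eventually_nhds_reflect: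
  "(\<forall>\<^sub>F s in nhds (- t). P s) \<longleftrightarrow> (\<forall>\<^sub>F s in nhds (t::real). P (- s))"
proof -
  have *: "\<forall>\<^sub>F s in nhds t. Q (- s)" if "\<forall>\<^sub>F s in nhds (- t). Q s" for Q and t :: real
  proof -
    have "filterlim uminus (nhds (- t)) (nhds t)"
      by (intro tendsto_intros filterlim_ident)
    with that show ?thesis by (simp add: filterlim_iff)
  qed
  from *[of P t] *[of "\<lambda>s. P (- s)" "- t"] show ?thesis by auto
qed

lemma vanishes_to_order_reflect:
  "vanishes_to_order m (- t) (\<lambda>s. f (- s)) \<longleftrightarrow> vanishes_to_order m t f"
  by (simp add: vanishes_to_order_def eventually_nhds_reflect abs_minus_commute add.commute)

lemma one_sided_functional_reflect:
  assumes "one_sided_functional (- t) D \<Lambda> Z Z' m"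
  shows "one_sided_functional t (\<lambda>f. D (\<lambda>s. f (- s))) (\<lambda>f. \<Lambda> (\<lambda>s. f (- s)))
    (\<lambda>f. Z (\<lambda>s. f (- s))) (\<lambda>f. Z' (\<lambda>s. f (- s))) m"
proof -
  interpret one_sided_functional "- t" D \<Lambda> Z Z' m by fact
  have sm: "smooth (\<lambda>s. f (- s)) \<longleftrightarrow> smooth f" for f :: "real \<Rightarrow> real"
    using smooth_compose[OF _ smooth_minus[OF smooth_ident], of f]
      smooth_compose[OF _ smooth_minus[OF smooth_ident], of "\<lambda>s. f (- s)"] by auto
  show ?thesis
  proof
    fix F :: "real \<times> real \<Rightarrow> real" and s assume F: "smooth F"
    define G where "G = (\<lambda>z. F (fst z, - snd z))"
    have G: "smooth G"
      unfolding G_def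
      by (intro smooth_compose[OF F] smooth_Pair smooth_fst smooth_minus smooth_snd smooth_ident)
    have "pd1 G (s, \<tau>) = pd1 F (s, - \<tau>)" for \<tau>
      using has_pd1[OF G, of \<tau> s] has_pd1[OF F, of "- \<tau>" s] DERIV_unique by (simp add: G_def) blast
    then show "((\<lambda>s. \<Lambda> (\<lambda>\<tau>. F (s, - \<tau>))) has_real_derivative \<Lambda> (\<lambda>\<tau>. pd1 F (s, - \<tau>))) (at s)"
      using \<Lambda>_parameter[OF G, of s] by (simp add: G_def)
  next
    assume "m > 0"
    then have j: "jet_functional (- t) D \<Lambda> m" by (rule jet)
    show "jet_functional t (\<lambda>f. D (\<lambda>s. f (- s))) (\<lambda>f. \<Lambda> (\<lambda>s. f (- s))) m"
      unfolding jet_functional_def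
    proof (intro conjI allI impI)
      show "\<Lambda> (\<lambda>s. 1) = 0" using j by (simp add: jet_functional_def)
    next
      fix f assume "D (\<lambda>s. f (- s))"
      then obtain P where P: "smooth P" "vanishes_to_order m (- t) (\<lambda>s. f (- s) - P s)"
        using j by (auto simp: jet_functional_def)
      then have "vanishes_to_order m t (\<lambda>s. f s - P (- s))"
        using vanishes_to_order_reflect[of m t "\<lambda>s. f s - P (- s)"] by simp
      with P(1) show "\<exists>P. smooth P \<and> vanishes_to_order m t (\<lambda>s. f s - P s)"
        using sm by blast
    next
      fix f :: "real \<Rightarrow> real" assume "D (\<lambda>s. f (- s))" "vanishes_to_order m t f"
      then show "\<Lambda> (\<lambda>s. f (- s)) = 0"
        using j vanishes_to_order_reflect[of m t f] by (simp add: jet_functional_def)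
    qed
  next
    assume "m = 0"
    then obtain p1 p2 h1 h2 h3 where "Z p1" "Z p2" "Z h1" "Z h2" "Z h3"
      "\<Lambda> h1 = 1" "\<Lambda> h2 = 1" "\<Lambda> h3 = 1"
      "\<And>s. p1 s * h1 s = h1 s" "\<And>s. p2 s * h2 s = h2 s" "\<And>s. p1 s * h2 s = 0"
      "\<And>s. p2 s * h1 s = 0" "\<And>s. h3 s * h1 s = 0" "\<And>s. h3 s * h2 s = 0"
      using steer unfolding steerable_def by blast
    then show "steerable (\<lambda>f. Z (\<lambda>s. f (- s))) (\<lambda>f. \<Lambda> (\<lambda>s. f (- s)))"
      unfolding steerable_def
      by (intro exI[of _ "\<lambda>s. p1 (- s)"] exI[of _ "\<lambda>s. p2 (- s)"] exI[of _ "\<lambda>s. h1 (- s)"]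
          exI[of _ "\<lambda>s. h2 (- s)"] exI[of _ "\<lambda>s. h3 (- s)"]) simp
  next
    fix f assume "Z (\<lambda>s. f (- s))"
    then show "smooth f" "\<forall>\<^sub>F s in nhds t. f s = 0"
      using Z_smooth[of "\<lambda>s. f (- s)"] Z_near[of "\<lambda>s. f (- s)"]
      by (simp_all add: sm eventually_nhds_reflect)
  next
    fix f g :: "real \<Rightarrow> real" assume "Z (\<lambda>s. f (- s))" "smooth g"
    then show "Z (\<lambda>s. g (- s) * f (- s))"
      using Z_mult[of "\<lambda>s. f (- s)" "\<lambda>s. g (- s)"] sm by simp
  qed (simp_all add: D_comb \<Lambda>_comb D_smooth sm Z_zero \<Lambda>_Z')
qed

text \<open>Continuity makes an integer-order derivative a derivative of \<open>f\<close> itself, not merely of its integral.\<close>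

definition left_dom :: "real \<Rightarrow> real \<Rightarrow> real \<Rightarrow> (real \<Rightarrow> real) \<Rightarrow> bool" where
  "left_dom a b \<alpha> f \<longleftrightarrow> continuous_on {a..b} f \<and> left_RL_exists a b \<alpha> f"

text \<open>The second functional is the left derivative in reversed time; it equals \<open>right_RL b \<beta> f t\<close> whenever the
  latter exists.\<close>

lemma functional_pair_RL:
  assumes t: "t \<in> {a<..<b}" and \<alpha>: "\<alpha> > 0" and \<beta>: "\<beta> > 0"
  shows "functional_pair t (left_dom a b \<alpha>) (\<lambda>f. left_RL a \<alpha> f t) (past_supported t) (jet_order \<alpha>)
    (\<lambda>f. left_dom (- b) (- a) \<beta> (\<lambda>s. f (- s))) (\<lambda>f. left_RL (- b) \<beta> (\<lambda>s. f (- s)) (- t))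
    (future_supported t) (jet_order \<beta>)"
proof -
  have "one_sided_functional (- t) (left_dom (- b) (- a) \<beta>) (\<lambda>f. left_RL (- b) \<beta> f (- t))
    (past_supported (- t)) (future_supported (- t)) (jet_order \<beta>)"
    using left_RL_functional[of "- t" "- b" "- a" \<beta>] t \<beta> by (simp add: left_dom_def[abs_def])
  from one_sided_functional_reflect[OF this]
  have R: "one_sided_functional t (\<lambda>f. left_dom (- b) (- a) \<beta> (\<lambda>s. f (- s)))
    (\<lambda>f. left_RL (- b) \<beta> (\<lambda>s. f (- s)) (- t)) (future_supported t) (past_supported t) (jet_order \<beta>)"
    by (simp add: past_supported_reflect future_supported_reflect)
  have L: "one_sided_functional t (left_dom a b \<alpha>) (\<lambda>f. left_RL a \<alpha> f t)
    (past_supported t) (future_supported t) (jet_order \<alpha>)"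
    using left_RL_functional[OF t \<alpha>] by (simp add: left_dom_def[abs_def])
  from L R show ?thesis by (rule functional_pair.intro)
qed


section \<open>Curves and their components\<close>

lemma left_RL_sum:
  assumes "\<And>i. i \<in> I \<Longrightarrow> left_RL_exists a b \<alpha> (f i)" "\<alpha> > 0"
  shows "left_RL_exists a b \<alpha> (\<lambda>s. \<Sum>i\<in>I. f i s :: 'v::euclidean_space)"
  using assms(1)
proof (induction I rule: infinite_finite_induct)
  case (insert i I)
  then show ?case using left_RL_add(1)[of a b \<alpha> "f i"] by simp
qed (use left_RL_linear(1)[OF bounded_linear_zero left_RL_smooth(1)[OF smooth_const assms(2)], of a b] in simp_all)

lemma is_curve_componentwise:
  fixes x :: "real \<Rightarrow> real^'n"
  assumes "\<alpha> > 0" "\<beta> > 0"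
  shows "is_curve a b \<alpha> \<beta> x \<longleftrightarrow>
    (\<forall>j. left_dom a b \<alpha> (\<lambda>s. x s $ j) \<and> left_dom (- b) (- a) \<beta> (\<lambda>s. x (- s) $ j))"
proof -
  have comp: "(\<forall>j. left_RL_exists a b \<alpha> (\<lambda>s. x s $ j)) \<longleftrightarrow> left_RL_exists a b \<alpha> x"
    if "\<alpha> > 0" for a b \<alpha> and x :: "real \<Rightarrow> real^'n"
  proof
    assume "left_RL_exists a b \<alpha> x"
    then show "\<forall>j. left_RL_exists a b \<alpha> (\<lambda>s. x s $ j)"
      using left_RL_linear(1)[OF bounded_linear_vec_nth] by blast
  next
    assume j: "\<forall>j. left_RL_exists a b \<alpha> (\<lambda>s. x s $ j)"
    have "left_RL_exists a b \<alpha> (\<lambda>s. \<Sum>j\<in>UNIV. x s $ j *\<^sub>R (axis j 1 :: real^'n))"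
      using j by (intro left_RL_sum[OF left_RL_linear(1)[OF bounded_linear_scaleR_left] that]) auto
    moreover have "(\<Sum>j\<in>UNIV. x s $ j *\<^sub>R (axis j 1 :: real^'n)) = x s" for s
      by (simp only: basis_expansion flip: scalar_mult_eq_scaleR)
    ultimately show "left_RL_exists a b \<alpha> x" by simp
  qed
  have cont: "continuous_on {a..b} x \<longleftrightarrow> (\<forall>j. continuous_on {a..b} (\<lambda>s. x s $ j))"
    for x :: "real \<Rightarrow> real^'n" and a b
    using continuous_on_vec_lambda[of "{a..b}" "\<lambda>j s. x s $ j"] by (auto intro: continuous_intros)
  have neg: "continuous_on {- b..- a} (\<lambda>s. x (- s))" if "continuous_on {a..b} x"
    by (rule continuous_on_compose2[OF that]) (auto intro: continuous_intros)
  show ?thesis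
    unfolding is_curve_def left_dom_def right_RL_exists_reflect
    using comp[OF assms(1), of a b x] comp[OF assms(2), of "- b" "- a" "\<lambda>s. x (- s)"]
      cont[of a b x] cont[of "- b" "- a" "\<lambda>s. x (- s)"] neg by auto
qed

lemma bounded_linear_cvec: "bounded_linear cvec"
  by (rule linear_conv_bounded_linear[THEN iffD1], rule linearI)
    (simp_all add: cvec_def vec_eq_iff complex_eq_iff)

lemma left_RL_cvec_component:
  assumes "left_RL_exists a b \<alpha> x" "t \<in> {a<..<b}"
  shows "left_RL a \<alpha> (\<lambda>s. cvec (x s)) t $ j = of_real (left_RL a \<alpha> (\<lambda>s. x s $ j) t)"
  using left_RL_linear(2)[OF bounded_linear_cvec assms] left_RL_linear(2)[OF bounded_linear_vec_nth assms]
  by (simp add: cvec_def)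

lemma curveD_component:
  assumes "is_curve a b \<alpha> \<beta> x" "t \<in> {a<..<b}"
  shows "curveD a b \<alpha> \<beta> \<mu> x t $ j =
    (1 + \<i> * \<mu>) / 2 * of_real (left_RL a \<alpha> (\<lambda>s. x s $ j) t) +
    (- 1 + \<i> * \<mu>) / 2 * of_real (left_RL (- b) \<beta> (\<lambda>s. x (- s) $ j) (- t))"
proof -
  have l: "left_RL_exists a b \<alpha> x" and r: "left_RL_exists (- b) (- a) \<beta> (\<lambda>s. x (- s))"
    using assms by (simp_all add: is_curve_def right_RL_exists_reflect)
  have "right_RL_exists a b \<beta> (\<lambda>s. cvec (x s))"
    using left_RL_linear(1)[OF bounded_linear_cvec r] by (simp add: right_RL_exists_reflect)
  then have "right_RL b \<beta> (\<lambda>s. cvec (x s)) t = left_RL (- b) \<beta> (\<lambda>s. cvec (x (- s))) (- t)"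
    using right_RL_reflect assms(2) by blast
  then have "right_RL b \<beta> (\<lambda>s. cvec (x s)) t $ j = of_real (left_RL (- b) \<beta> (\<lambda>s. x (- s) $ j) (- t))"
    using left_RL_cvec_component[OF r, of "- t" j] assms(2) by simp
  then show ?thesis
    using left_RL_cvec_component[OF l assms(2), of j]
    by (simp add: curveD_def fracD_def vector_scalar_mult_def) (simp add: field_simps)
qed


section \<open>The partial derivatives of the Lagrangian\<close>

lemma dL_dv_eqI:
  fixes L :: "real \<Rightarrow> real^'n \<Rightarrow> complex^'n \<Rightarrow> complex"
  assumes "((\<lambda>w. L t q w) has_derivative cdot p) (at v)"
  shows "dL_dv L t q v = p"
proof -
  have "((\<lambda>z. L t q (v + axis j z)) has_field_derivative p $ j) (at 0)" for j
  proof -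
    have lin: "linear (axis j :: complex \<Rightarrow> complex^'n)"
      by (rule linearI) (simp_all add: vec_eq_iff axis_def)
    have "((\<lambda>z. v + axis j z) has_derivative axis j) (at 0)"
      using linear_imp_has_derivative[OF lin] by (auto intro!: derivative_eq_intros)
    moreover have "axis j (0::complex) = (0 :: complex^'n)" by (simp add: vec_eq_iff axis_def)
    ultimately have "((\<lambda>z. L t q (v + axis j z)) has_derivative (\<lambda>z. cdot p (axis j z))) (at 0)"
      using has_derivative_compose[of "\<lambda>z. v + axis j z" "axis j" 0 UNIV "L t q" "cdot p"] assms
      by (simp del: axis_eq_0_iff)
    moreover have "cdot p (axis j z) = p $ j * z" for z
      by (simp add: cdot_def axis_def if_distrib cong: if_cong)
    ultimately show ?thesis by (simp add: has_field_derivative_def)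
  qed
  then show ?thesis by (simp add: dL_dv_def vec_eq_iff DERIV_imp_deriv)
qed

lemma dL_dx_cdot:
  fixes L :: "real \<Rightarrow> real^'n \<Rightarrow> complex^'n \<Rightarrow> complex"
  assumes "((\<lambda>y. L t y v) has_derivative A) (at q)"
  shows "cdot (dL_dx L t q v) (cvec w) = A w"
proof -
  have linA: "linear A" using assms by (rule has_derivative_linear)
  have "((\<lambda>r. L t (q + axis j r) v) has_vector_derivative A (axis j 1)) (at 0)" for j
  proof -
    have ax: "q + axis j r = q + r *\<^sub>R axis j 1" for r by (simp add: vec_eq_iff axis_def)
    have "((\<lambda>r. q + r *\<^sub>R axis j 1) has_derivative (\<lambda>r. r *\<^sub>R axis j 1)) (at 0)"
      by (auto intro!: derivative_eq_intros)
    from has_derivative_compose[OF this, of "\<lambda>y. L t y v" A] assms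
    have "((\<lambda>r. L t (q + r *\<^sub>R axis j 1) v) has_derivative (\<lambda>r. A (r *\<^sub>R axis j 1))) (at 0)" by simp
    then show ?thesis
      by (simp only: has_vector_derivative_def linear_cmul[OF linA] ax)
  qed
  then have "dL_dx L t q v $ j = A (axis j 1)" for j
    by (simp add: dL_dx_def vector_derivative_at)
  then have "cdot (dL_dx L t q v) (cvec w) = (\<Sum>j\<in>UNIV. A (axis j 1) * of_real (w $ j))"
    by (simp add: cdot_def cvec_def)
  also have "\<dots> = (\<Sum>j\<in>UNIV. w $ j *\<^sub>R A (axis j 1))"
    by (simp add: scaleR_conv_of_real mult.commute)
  also have "\<dots> = A (\<Sum>j\<in>UNIV. w $ j *\<^sub>R axis j 1)"
    by (simp only: linear_sum[OF linA] linear_cmul[OF linA])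
  also have "(\<Sum>j\<in>UNIV. w $ j *\<^sub>R axis j 1) = w"
    by (simp only: basis_expansion flip: scalar_mult_eq_scaleR)
  finally show ?thesis .
qed


section \<open>Noether's theorem for fractional Lagrangians\<close>

text \<open>The abstract theorem applies with the coefficients \<open>(1 + \<i>\<mu>)/2\<close> and \<open>(- 1 + \<i>\<mu>)/2\<close> of the left and the right
  derivative in the fractional velocity; the Euler--Lagrange equation turns its first term into the one
  of the statement.\<close>

theorem theorem5p1:
  fixes a b \<alpha> \<beta> :: real and \<mu> :: complex
    and L :: "real \<Rightarrow> real^'n \<Rightarrow> complex^'n \<Rightarrow> complex"
    and \<phi> :: "real \<Rightarrow> real^'n \<Rightarrow> real^'n"
  assumes "a < b" and "\<alpha> > 0" and "\<beta> > 0"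
    and "admissible_Lagrangian L"
    and "one_parameter_group \<phi>"
    and "invariant_under a b \<alpha> \<beta> \<mu> L \<phi>"
  shows "\<forall>x. fractional_EL_solution a b \<alpha> \<beta> \<mu> L x \<longrightarrow>
             is_curve a b \<alpha> \<beta> (flow_velocity \<phi> x 0) \<longrightarrow>
             (\<forall>t\<in>{a<..<b}. noether_expression a b \<alpha> \<beta> \<mu> L \<phi> x 0 t = 0)"
proof (intro allI impI ballI)
  fix x t
  assume EL: "fractional_EL_solution a b \<alpha> \<beta> \<mu> L x"
    and Xc: "is_curve a b \<alpha> \<beta> (flow_velocity \<phi> x 0)" and t: "t \<in> {a<..<b}"
  note pos = assms(2,3)
  let ?X = "generator \<phi>"
  have fv: "flow_velocity \<phi> x 0 = (\<lambda>\<tau>. ?X (x \<tau>))"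
    using flow_has_vector_derivative[OF assms(5)]
    by (auto simp: flow_velocity_def[abs_def] fun_eq_iff intro: vector_derivative_at)
  have xc: "is_curve a b \<alpha> \<beta> x" using EL by (simp add: fractional_EL_solution_def)
  interpret functional_pair t "left_dom a b \<alpha>" "\<lambda>f. left_RL a \<alpha> f t" "past_supported t" "jet_order \<alpha>"
    "\<lambda>f. left_dom (- b) (- a) \<beta> (\<lambda>s. f (- s))" "\<lambda>f. left_RL (- b) \<beta> (\<lambda>s. f (- s)) (- t)"
    "future_supported t" "jet_order \<beta>"
    by (rule functional_pair_RL[OF t pos])
  define c1 c2 where "c1 = (1 + \<i> * \<mu>) / 2" and "c2 = (- 1 + \<i> * \<mu>) / 2"
  have vel: "curveD a b \<alpha> \<beta> \<mu> y t = velocity c1 c2 y" if "is_curve a b \<alpha> \<beta> y" for y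
    using curveD_component[OF that t] by (simp add: velocity_def vec_eq_iff c1_def c2_def)
  have smooth_curve: "is_curve a b \<alpha> \<beta> y" if "smooth y" for y :: "real \<Rightarrow> real^'n"
    unfolding is_curve_componentwise[OF pos]
    using L.D_smooth[OF smooth_nth[OF that]] R.D_smooth[OF smooth_nth[OF that]] by simp
  let ?v = "curveD a b \<alpha> \<beta> \<mu> x t"
  let ?\<xi> = "dL_dv L t (x t) ?v"
  obtain p where p: "(L t (x t) has_derivative cdot p) (at ?v)"
    using assms(4) unfolding admissible_Lagrangian_def by blast
  then have Ldv: "(L t (x t) has_derivative cdot ?\<xi>) (at (velocity c1 c2 x))"
    by (simp only: dL_dv_eqI[where L = L, OF p] vel[OF xc, symmetric])
  obtain A where A: "((\<lambda>q. L t q ?v) has_derivative A) (at (x t))"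
    using assms(4) unfolding admissible_Lagrangian_def differentiable_def by blast
  have "A (?X (x t)) + cdot ?\<xi> (velocity c1 c2 (\<lambda>\<tau>. ?X (x \<tau>))) = 0"
  proof (rule noether_abstract[where Lag = "L t" and x = x, OF assms(5) _ Ldv])
    show "L t (y t) (velocity c1 c2 y) = L t (\<phi> s (y t)) (velocity c1 c2 (\<lambda>\<tau>. \<phi> s (y \<tau>)))"
      if y: "smooth y" for s y
    proof -
      have "is_curve a b \<alpha> \<beta> (\<lambda>\<tau>. \<phi> s (y \<tau>))"
        by (intro smooth_curve smooth_flow[OF assms(5)] smooth_const y)
      then show ?thesis
        using assms(6) smooth_curve[OF y] t vel unfolding invariant_under_def by metis
    qed
    show "((\<lambda>q. L t q (velocity c1 c2 x)) has_derivative A) (at (x t))"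
      using A by (simp add: vel[OF xc])
    show "left_dom a b \<alpha> (\<lambda>s. x s $ j)" "left_dom (- b) (- a) \<beta> (\<lambda>s. x (- s) $ j)" for j
      using xc by (simp_all add: is_curve_componentwise[OF pos])
    show "left_dom a b \<alpha> (\<lambda>s. ?X (x s) $ j)" "left_dom (- b) (- a) \<beta> (\<lambda>s. ?X (x (- s)) $ j)" for j
      using Xc by (simp_all add: is_curve_componentwise[OF pos] fv)
  qed
  moreover have "(\<lambda>\<tau>. \<phi> 0 (x \<tau>)) = x"
    using assms(5) by (simp add: one_parameter_group_def)
  ultimately show "noether_expression a b \<alpha> \<beta> \<mu> L \<phi> x 0 t = 0"
    using EL t dL_dx_cdot[where L = L, OF A] vel[OF Xc[unfolded fv]]
    by (simp add: noether_expression_def fractional_EL_solution_def momentum_def fv)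
qed

end
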